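(* Let $L$ be a null hypersurface of a time-orientable Lorentzian manifold $(M,g)$ and $\zeta$ a closed rigging for it, with rigged vector field $\xi$, rigged metric $\widetilde g$ and screen distribution $\mathcal S^\zeta$. Then: 1. $L$ is totally geodesic if and only if the rigged vector field $\xi$ is $\widetilde g$-parallel. 2. $L$ is totally geodesic (resp. totally umbilic) if and only if each leaf of $\mathcal S^\zeta$ is totally geodesic (resp. totally umbilic) as a hypersurface of the Riemannian manifold $(L,\widetilde g)$.
   Context: $(M,g)$ is a time-orientable Lorentzian manifold with Levi-Civita connection $\nabla$. A null hypersurface $i:L\hookrightarrow M$ is a hypersurface on which the induced metric is degenerate. A rigging for $L$ is a vector field $\zeta$ defined on an open set of $M$ containing $L$ with $\zeta_p\notin T_pL$ for all $p\in L$. Put $\alpha=g(\zeta,\cdot)$, $\omega=i^*\alpha$. The rigging is closed if $d\alpha=0$. The rigged metric $\widetilde g=i^*g+\omega\otimes\omega$ is a Riemannian metric on $L$. The rigged vector field $\xi\in\mathfrak X(L)$ is defined by $\widetilde g(\xi,\cdot)=\omega$; it is the unique null vector field in $L$ with $g(\zeta,\xi)=1$. The screen distribution is $\mathcal S^\zeta=TL\cap\zeta^\perp$; it is the $\widetilde g$-orthogonal complement of $\xi$ and is integrable when $\zeta$ is closed. The second fundamental form of $L$ is $B(U,V)=-g(\nabla_U\xi,V)$ for $U,V\in\mathfrak X(L)$; $L$ is totally geodesic if $B\equiv0$ and totally umbilic if $B=\rho g$ for some $\rho\in C^\infty(L)$ (these notions do not depend on the choice of null section). *)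

theory Defs
  imports "HOL-Analysis.Analysis" "HOL-Library.Function_Algebras"
begin

section \<open>Smooth manifolds\<close>

(* Only used for open S, where "at x within S" and "at x" agree. *)
primrec Ck_on :: "nat \<Rightarrow> 'a::euclidean_space set \<Rightarrow> ('a \<Rightarrow> 'b::real_normed_vector) \<Rightarrow> bool" where
  "Ck_on 0 S f \<longleftrightarrow> continuous_on S f"
| "Ck_on (Suc k) S f \<longleftrightarrow>
     f differentiable_on S \<and> (\<forall>v. Ck_on k S (\<lambda>x. frechet_derivative f (at x) v))"

definition smooth_on :: "'a::euclidean_space set \<Rightarrow> ('a \<Rightarrow> 'b::real_normed_vector) \<Rightarrow> bool" where
  "smooth_on S f \<longleftrightarrow> (\<forall>k. Ck_on k S f)"

text \<open>
  The points of a manifold are the elements of a topological type. A chart is a pair of its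
  domain and a coordinate map; the values of the coordinate map outside the domain are irrelevant.
\<close>

type_synonym ('m, 'e) chart = "'m set \<times> ('m \<Rightarrow> 'e)"

definition is_chart :: "('m::topological_space, 'e::euclidean_space) chart \<Rightarrow> bool" where
  "is_chart c \<longleftrightarrow> (case c of (U, \<phi>) \<Rightarrow>
     open U \<and> open (\<phi> ` U) \<and> homeomorphism U (\<phi> ` U) \<phi> (inv_into U \<phi>))"

definition compatible ::
    "('m::topological_space, 'e::euclidean_space) chart \<Rightarrow> ('m, 'e) chart \<Rightarrow> bool" where
  "compatible c d \<longleftrightarrow> (case c of (U, \<phi>) \<Rightarrow> case d of (V, \<psi>) \<Rightarrow>
     smooth_on (\<phi> ` (U \<inter> V)) (\<psi> \<circ> inv_into U \<phi>) \<and>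
     smooth_on (\<psi> ` (U \<inter> V)) (\<phi> \<circ> inv_into V \<psi>))"

(* A maximal smooth atlas. *)
definition smooth_structure ::
    "('m::topological_space, 'e::euclidean_space) chart set \<Rightarrow> bool" where
  "smooth_structure A \<longleftrightarrow>
     (\<forall>c\<in>A. is_chart c) \<and> (\<Union>c\<in>A. fst c) = UNIV \<and>
     (\<forall>c\<in>A. \<forall>d\<in>A. compatible c d) \<and>
     (\<forall>c. is_chart c \<and> (\<forall>d\<in>A. compatible c d) \<longrightarrow> c \<in> A)"

definition smooth_fun ::
    "('m::topological_space, 'e::euclidean_space) chart set \<Rightarrow> 'm set \<Rightarrow> ('m \<Rightarrow> real) \<Rightarrow> bool" where
  "smooth_fun A W f \<longleftrightarrow>
     open W \<and> (\<forall>(U, \<phi>)\<in>A. smooth_on (\<phi> ` (U \<inter> W)) (f \<circ> inv_into U \<phi>))"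

definition smooth_fun_near ::
    "('m::topological_space, 'e::euclidean_space) chart set \<Rightarrow> 'm \<Rightarrow> ('m \<Rightarrow> real) \<Rightarrow> bool" where
  "smooth_fun_near A p f \<longleftrightarrow> (\<exists>W. p \<in> W \<and> smooth_fun A W f)"

definition smooth_map ::
    "('l::topological_space, 'f::euclidean_space) chart set \<Rightarrow>
     ('m::topological_space, 'e::euclidean_space) chart set \<Rightarrow> ('l \<Rightarrow> 'm) \<Rightarrow> bool" where
  "smooth_map B A i \<longleftrightarrow> continuous_on UNIV i \<and>
     (\<forall>(U, \<phi>)\<in>B. \<forall>(V, \<psi>)\<in>A. smooth_on (\<phi> ` (U \<inter> i -` V)) (\<psi> \<circ> i \<circ> inv_into U \<phi>))"

section \<open>Tangent vectors and vector fields\<close>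

instantiation "fun" :: (type, real_vector) real_vector
begin

definition "scaleR_fun (a::real) (f :: 'a \<Rightarrow> 'b) = (\<lambda>x. a *\<^sub>R f x)"

instance
  by standard (auto simp: scaleR_fun_def fun_eq_iff algebra_simps)

end

text \<open>
  A tangent vector at \<open>p\<close> is the operator of directional derivative at \<open>p\<close> on the functions that
  are smooth near \<open>p\<close>. Operators are made extensional by the value 0 on all other functions.
\<close>

type_synonym 'm tvec = "('m \<Rightarrow> real) \<Rightarrow> real"
type_synonym 'm field = "'m \<Rightarrow> 'm tvec"
type_synonym 'm form1 = "'m \<Rightarrow> 'm tvec \<Rightarrow> real"
type_synonym 'm tensor2 = "'m \<Rightarrow> 'm tvec \<Rightarrow> 'm tvec \<Rightarrow> real"

definition chart_vec ::
    "('m::topological_space, 'e::euclidean_space) chart set \<Rightarrow> ('m, 'e) chart \<Rightarrow> 'm \<Rightarrow> 'e \<Rightarrow> 'm tvec" where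
  "chart_vec A c p u = (\<lambda>f. if smooth_fun_near A p f
     then frechet_derivative (f \<circ> inv_into (fst c) (snd c)) (at (snd c p)) u else 0)"

definition tangent_space ::
    "('m::topological_space, 'e::euclidean_space) chart set \<Rightarrow> 'm \<Rightarrow> 'm tvec set" where
  "tangent_space A p = {chart_vec A c p u | c u. c \<in> A \<and> p \<in> fst c}"

definition smooth_field ::
    "('m::topological_space, 'e::euclidean_space) chart set \<Rightarrow> 'm set \<Rightarrow> 'm field \<Rightarrow> bool" where
  "smooth_field A W X \<longleftrightarrow> open W \<and> (\<forall>p\<in>W. X p \<in> tangent_space A p) \<and>
     (\<forall>V f. V \<subseteq> W \<and> smooth_fun A V f \<longrightarrow> smooth_fun A V (\<lambda>p. X p f))"

definition smooth_field_near ::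
    "('m::topological_space, 'e::euclidean_space) chart set \<Rightarrow> 'm \<Rightarrow> 'm field \<Rightarrow> bool" where
  "smooth_field_near A p X \<longleftrightarrow> (\<exists>W. p \<in> W \<and> smooth_field A W X)"

definition lie_bracket ::
    "('m::topological_space, 'e::euclidean_space) chart set \<Rightarrow> 'm field \<Rightarrow> 'm field \<Rightarrow> 'm field" where
  "lie_bracket A X Y = (\<lambda>p f. if smooth_fun_near A p f
     then X p (\<lambda>q. Y q f) - Y p (\<lambda>q. X q f) else 0)"

(* The exterior derivative of a 1-form, evaluated at p on vector fields. *)
definition ext_deriv ::
    "('m::topological_space, 'e::euclidean_space) chart set \<Rightarrow> 'm form1 \<Rightarrow> 'm field \<Rightarrow> 'm field \<Rightarrow> 'm \<Rightarrow> real" where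
  "ext_deriv A \<alpha> X Y p =
     X p (\<lambda>q. \<alpha> q (Y q)) - Y p (\<lambda>q. \<alpha> q (X q)) - \<alpha> p (lie_bracket A X Y p)"

definition closed_form ::
    "('m::topological_space, 'e::euclidean_space) chart set \<Rightarrow> 'm set \<Rightarrow> 'm form1 \<Rightarrow> bool" where
  "closed_form A W \<alpha> \<longleftrightarrow>
     (\<forall>V X Y. V \<subseteq> W \<and> smooth_field A V X \<and> smooth_field A V Y \<longrightarrow>
        (\<forall>p\<in>V. ext_deriv A \<alpha> X Y p = 0))"

definition differential ::
    "('m::topological_space, 'e::euclidean_space) chart set \<Rightarrow> ('l \<Rightarrow> 'm) \<Rightarrow> 'l \<Rightarrow> 'l tvec \<Rightarrow> 'm tvec" where
  "differential A i p v = (\<lambda>f. if smooth_fun_near A (i p) f then v (f \<circ> i) else 0)"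

section \<open>Metrics and connections\<close>

definition symmetric_tensor ::
    "('m::topological_space, 'e::euclidean_space) chart set \<Rightarrow> 'm tensor2 \<Rightarrow> bool" where
  "symmetric_tensor A g \<longleftrightarrow>
     (\<forall>p. \<forall>u\<in>tangent_space A p. \<forall>v\<in>tangent_space A p. \<forall>w\<in>tangent_space A p. \<forall>a.
        g p u v = g p v u \<and> g p (u + v) w = g p u w + g p v w \<and>
        g p (a *\<^sub>R u) v = a * g p u v) \<and>
     (\<forall>W X Y. smooth_field A W X \<and> smooth_field A W Y \<longrightarrow>
        smooth_fun A W (\<lambda>p. g p (X p) (Y p)))"

(* Signature (-,+,...,+): every tangent space has an orthonormal basis with exactly one
   timelike vector; the basis is indexed by the standard basis of the model space. *)
definition lorentzian_metric ::
    "('m::topological_space, 'e::euclidean_space) chart set \<Rightarrow> 'm tensor2 \<Rightarrow> bool" where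
  "lorentzian_metric A g \<longleftrightarrow> symmetric_tensor A g \<and>
     (\<forall>p. \<exists>(E :: 'e \<Rightarrow> 'm tvec) b0. b0 \<in> Basis \<and> span (E ` Basis) = tangent_space A p \<and>
        (\<forall>b\<in>Basis. \<forall>c\<in>Basis.
           g p (E b) (E c) = (if b \<noteq> c then 0 else if b = b0 then -1 else 1)))"

definition time_orientable ::
    "('m::topological_space, 'e::euclidean_space) chart set \<Rightarrow> 'm tensor2 \<Rightarrow> bool" where
  "time_orientable A g \<longleftrightarrow> (\<exists>X. smooth_field A UNIV X \<and> (\<forall>p. g p (X p) (X p) < 0))"

text \<open>
  \<open>D p v X\<close> is the covariant derivative at \<open>p\<close> of the field \<open>X\<close>, which need only be smooth near
  \<open>p\<close>, in the direction of the tangent vector \<open>v\<close> at \<open>p\<close>. Because fields that are only locally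
  defined are allowed, dependence on the germ of \<open>X\<close> alone is part of the definition.
\<close>

type_synonym 'm connection = "'m \<Rightarrow> 'm tvec \<Rightarrow> 'm field \<Rightarrow> 'm tvec"

definition affine_connection ::
    "('m::topological_space, 'e::euclidean_space) chart set \<Rightarrow> 'm connection \<Rightarrow> bool" where
  "affine_connection A D \<longleftrightarrow>
     (\<forall>p u v X Y f a.
        u \<in> tangent_space A p \<and> v \<in> tangent_space A p \<and>
        smooth_field_near A p X \<and> smooth_field_near A p Y \<and> smooth_fun_near A p f \<longrightarrow>
          D p u X \<in> tangent_space A p \<and>
          D p (u + v) X = D p u X + D p v X \<and>
          D p (a *\<^sub>R u) X = a *\<^sub>R D p u X \<and>
          D p u (\<lambda>q. X q + Y q) = D p u X + D p u Y \<and>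
          D p u (\<lambda>q. f q *\<^sub>R X q) = u f *\<^sub>R X p + f p *\<^sub>R D p u X \<and>
          ((\<exists>W. open W \<and> p \<in> W \<and> (\<forall>q\<in>W. X q = Y q)) \<longrightarrow> D p u X = D p u Y)) \<and>
     (\<forall>W X Y. smooth_field A W X \<and> smooth_field A W Y \<longrightarrow>
        smooth_field A W (\<lambda>p. D p (X p) Y))"

definition levi_civita ::
    "('m::topological_space, 'e::euclidean_space) chart set \<Rightarrow> 'm tensor2 \<Rightarrow> 'm connection \<Rightarrow> bool" where
  "levi_civita A g D \<longleftrightarrow> affine_connection A D \<and>
     (\<forall>p X Y. smooth_field_near A p X \<and> smooth_field_near A p Y \<longrightarrow>
        D p (X p) Y - D p (Y p) X = lie_bracket A X Y p) \<and>
     (\<forall>p u X Y. u \<in> tangent_space A p \<and> smooth_field_near A p X \<and> smooth_field_near A p Y \<longrightarrow>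
        u (\<lambda>q. g q (X q) (Y q)) = g p (D p u X) (Y p) + g p (X p) (D p u Y))"

definition parallel_field ::
    "('m::topological_space, 'e::euclidean_space) chart set \<Rightarrow> 'm connection \<Rightarrow> 'm field \<Rightarrow> bool" where
  "parallel_field A D X \<longleftrightarrow> (\<forall>p. \<forall>u\<in>tangent_space A p. D p u X = 0)"

section \<open>Null hypersurfaces and riggings\<close>

definition hypersurface ::
    "('l::topological_space, 'f::euclidean_space) chart set \<Rightarrow>
     ('m::topological_space, 'e::euclidean_space) chart set \<Rightarrow> ('l \<Rightarrow> 'm) \<Rightarrow> bool" where
  "hypersurface B A i \<longleftrightarrow> DIM('e) = DIM('f) + 1 \<and> smooth_map B A i \<and> inj i \<and>
     (\<forall>p. inj_on (differential A i p) (tangent_space B p))"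

definition null_hypersurface ::
    "('l::topological_space, 'f::euclidean_space) chart set \<Rightarrow>
     ('m::topological_space, 'e::euclidean_space) chart set \<Rightarrow> 'm tensor2 \<Rightarrow> ('l \<Rightarrow> 'm) \<Rightarrow> bool" where
  "null_hypersurface B A g i \<longleftrightarrow> hypersurface B A i \<and>
     (\<forall>p. \<exists>u\<in>tangent_space B p. u \<noteq> 0 \<and>
        (\<forall>v\<in>tangent_space B p. g (i p) (differential A i p u) (differential A i p v) = 0))"

definition rigging ::
    "('l::topological_space, 'f::euclidean_space) chart set \<Rightarrow>
     ('m::topological_space, 'e::euclidean_space) chart set \<Rightarrow> ('l \<Rightarrow> 'm) \<Rightarrow> 'm set \<Rightarrow> 'm field \<Rightarrow> bool" where
  "rigging B A i W \<zeta> \<longleftrightarrow> range i \<subseteq> W \<and> smooth_field A W \<zeta> \<and>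
     (\<forall>p. \<zeta> (i p) \<notin> differential A i p ` tangent_space B p)"

definition closed_rigging ::
    "('l::topological_space, 'f::euclidean_space) chart set \<Rightarrow>
     ('m::topological_space, 'e::euclidean_space) chart set \<Rightarrow> 'm tensor2 \<Rightarrow> ('l \<Rightarrow> 'm) \<Rightarrow>
     'm set \<Rightarrow> 'm field \<Rightarrow> bool" where
  "closed_rigging B A g i W \<zeta> \<longleftrightarrow> rigging B A i W \<zeta> \<and> closed_form A W (\<lambda>p. g p (\<zeta> p))"

definition rigged_form ::
    "('m::topological_space, 'e::euclidean_space) chart set \<Rightarrow> 'm tensor2 \<Rightarrow> ('l \<Rightarrow> 'm) \<Rightarrow>
     'm field \<Rightarrow> 'l form1" where
  "rigged_form A g i \<zeta> p u = g (i p) (\<zeta> (i p)) (differential A i p u)"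

definition rigged_metric ::
    "('m::topological_space, 'e::euclidean_space) chart set \<Rightarrow> 'm tensor2 \<Rightarrow> ('l \<Rightarrow> 'm) \<Rightarrow>
     'm field \<Rightarrow> 'l tensor2" where
  "rigged_metric A g i \<zeta> p u v =
     g (i p) (differential A i p u) (differential A i p v) +
     rigged_form A g i \<zeta> p u * rigged_form A g i \<zeta> p v"

definition rigged_field ::
    "('l::topological_space, 'f::euclidean_space) chart set \<Rightarrow>
     ('m::topological_space, 'e::euclidean_space) chart set \<Rightarrow> 'm tensor2 \<Rightarrow> ('l \<Rightarrow> 'm) \<Rightarrow>
     'm field \<Rightarrow> 'l field \<Rightarrow> bool" where
  "rigged_field B A g i \<zeta> \<xi> \<longleftrightarrow> smooth_field B UNIV \<xi> \<and>
     (\<forall>p. \<forall>u\<in>tangent_space B p. rigged_metric A g i \<zeta> p (\<xi> p) u = rigged_form A g i \<zeta> p u)"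

definition screen ::
    "('l::topological_space, 'f::euclidean_space) chart set \<Rightarrow>
     ('m::topological_space, 'e::euclidean_space) chart set \<Rightarrow> 'm tensor2 \<Rightarrow> ('l \<Rightarrow> 'm) \<Rightarrow>
     'm field \<Rightarrow> 'l \<Rightarrow> 'l tvec set" where
  "screen B A g i \<zeta> p =
     {u \<in> tangent_space B p. g (i p) (\<zeta> (i p)) (differential A i p u) = 0}"

definition extends_along ::
    "('m::topological_space, 'e::euclidean_space) chart set \<Rightarrow> ('l::topological_space \<Rightarrow> 'm) \<Rightarrow>
     'l field \<Rightarrow> 'l \<Rightarrow> 'm field \<Rightarrow> bool" where
  "extends_along A i X p Y \<longleftrightarrow> smooth_field_near A (i p) Y \<and>
     (\<exists>V. open V \<and> p \<in> V \<and> (\<forall>q\<in>V. Y (i q) = differential A i q (X q)))"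

(* The ambient covariant derivative at p of a field X on the hypersurface, through a local
   extension of X; the result does not depend on the extension. *)
definition cov_along ::
    "('m::topological_space, 'e::euclidean_space) chart set \<Rightarrow> 'm connection \<Rightarrow>
     ('l::topological_space \<Rightarrow> 'm) \<Rightarrow> 'l \<Rightarrow> 'l tvec \<Rightarrow> 'l field \<Rightarrow> 'm tvec" where
  "cov_along A D i p u X = D (i p) (differential A i p u) (SOME Y. extends_along A i X p Y)"

definition null_sff ::
    "('m::topological_space, 'e::euclidean_space) chart set \<Rightarrow> 'm tensor2 \<Rightarrow> 'm connection \<Rightarrow>
     ('l::topological_space \<Rightarrow> 'm) \<Rightarrow> 'l field \<Rightarrow> 'l tensor2" where
  "null_sff A g D i \<xi> p u v = - g (i p) (cov_along A D i p u \<xi>) (differential A i p v)"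

definition null_totally_geodesic ::
    "('l::topological_space, 'f::euclidean_space) chart set \<Rightarrow>
     ('m::topological_space, 'e::euclidean_space) chart set \<Rightarrow> 'm tensor2 \<Rightarrow> 'm connection \<Rightarrow>
     ('l \<Rightarrow> 'm) \<Rightarrow> 'l field \<Rightarrow> bool" where
  "null_totally_geodesic B A g D i \<xi> \<longleftrightarrow>
     (\<forall>p. \<forall>u\<in>tangent_space B p. \<forall>v\<in>tangent_space B p. null_sff A g D i \<xi> p u v = 0)"

definition null_totally_umbilic ::
    "('l::topological_space, 'f::euclidean_space) chart set \<Rightarrow>
     ('m::topological_space, 'e::euclidean_space) chart set \<Rightarrow> 'm tensor2 \<Rightarrow> 'm connection \<Rightarrow>
     ('l \<Rightarrow> 'm) \<Rightarrow> 'l field \<Rightarrow> bool" where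
  "null_totally_umbilic B A g D i \<xi> \<longleftrightarrow>
     (\<exists>\<rho>. smooth_fun B UNIV \<rho> \<and>
        (\<forall>p. \<forall>u\<in>tangent_space B p. \<forall>v\<in>tangent_space B p. null_sff A g D i \<xi> p u v =
           \<rho> p * g (i p) (differential A i p u) (differential A i p v)))"

section \<open>Leaves of a hyperplane distribution\<close>

text \<open>
  An immersed hypersurface is a subset \<open>topspace N\<close> of the manifold with its own topology \<open>N\<close>, in
  general finer than the subspace topology, that is covered by \<open>N\<close>-open sets \<open>W\<close> which carry the
  subspace topology and are coordinate hyperplanes \<open>\<phi> \<bullet> b = 0\<close> of charts. Describing it inside the
  charts of the ambient manifold, rather than by an immersion from another type, also covers
  hypersurfaces of dimension 0, for which there is no Euclidean model type.
\<close>

definition slice ::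
    "('l::topological_space, 'f::euclidean_space) chart set \<Rightarrow> 'l topology \<Rightarrow> 'l set \<Rightarrow>
     ('l, 'f) chart \<Rightarrow> 'f \<Rightarrow> bool" where
  "slice B N W c b \<longleftrightarrow> c \<in> B \<and> b \<in> Basis \<and> openin N W \<and> W \<subseteq> fst c \<and>
     subtopology N W = top_of_set W \<and> snd c ` W = {x \<in> snd c ` fst c. x \<bullet> b = 0}"

definition immersed_hypersurface ::
    "('l::topological_space, 'f::euclidean_space) chart set \<Rightarrow> 'l topology \<Rightarrow> bool" where
  "immersed_hypersurface B N \<longleftrightarrow> (\<forall>q\<in>topspace N. \<exists>W c b. slice B N W c b \<and> q \<in> W)"

definition sub_tangent ::
    "('l::topological_space, 'f::euclidean_space) chart set \<Rightarrow> 'l topology \<Rightarrow> 'l \<Rightarrow> 'l tvec set" where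
  "sub_tangent B N q = {v \<in> tangent_space B q.
     \<exists>W c b. slice B N W c b \<and> q \<in> W \<and> v (\<lambda>x. snd c x \<bullet> b) = 0}"

definition connected_integral_manifold ::
    "('l::topological_space, 'f::euclidean_space) chart set \<Rightarrow> ('l \<Rightarrow> 'l tvec set) \<Rightarrow> 'l topology \<Rightarrow> bool" where
  "connected_integral_manifold B \<Delta> N \<longleftrightarrow>
     immersed_hypersurface B N \<and> topspace N \<noteq> {} \<and> connected_space N \<and>
     (\<forall>q\<in>topspace N. sub_tangent B N q = \<Delta> q)"

(* Leaves of an integrable distribution in a second countable manifold are automatically second
   countable, so this is not demanded separately. *)
definition is_leaf ::
    "('l::topological_space, 'f::euclidean_space) chart set \<Rightarrow> ('l \<Rightarrow> 'l tvec set) \<Rightarrow> 'l topology \<Rightarrow> bool" where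
  "is_leaf B \<Delta> N \<longleftrightarrow> connected_integral_manifold B \<Delta> N \<and>
     (\<forall>N'. connected_integral_manifold B \<Delta> N' \<and> topspace N \<subseteq> topspace N' \<longrightarrow>
        topspace N' = topspace N)"

section \<open>Totally geodesic and totally umbilic hypersurfaces of a Riemannian manifold\<close>

definition normal_to ::
    "('l::topological_space, 'f::euclidean_space) chart set \<Rightarrow> 'l tensor2 \<Rightarrow> 'l topology \<Rightarrow> 'l \<Rightarrow>
     'l tvec set" where
  "normal_to B h N q = {n \<in> tangent_space B q. \<forall>u\<in>sub_tangent B N q. h q n u = 0}"

definition normal_part ::
    "('l::topological_space, 'f::euclidean_space) chart set \<Rightarrow> 'l tensor2 \<Rightarrow> 'l topology \<Rightarrow> 'l \<Rightarrow>
     'l tvec \<Rightarrow> 'l tvec" where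
  "normal_part B h N q w = (THE n. n \<in> normal_to B h N q \<and> w - n \<in> sub_tangent B N q)"

(* V is (a local extension to the ambient manifold of) a field on the hypersurface near q. *)
definition tangent_field_near ::
    "('l::topological_space, 'f::euclidean_space) chart set \<Rightarrow> 'l topology \<Rightarrow> 'l \<Rightarrow> 'l field \<Rightarrow> bool" where
  "tangent_field_near B N q V \<longleftrightarrow> smooth_field_near B q V \<and>
     (\<exists>W. openin N W \<and> q \<in> W \<and> (\<forall>x\<in>W. V x \<in> sub_tangent B N x))"

definition second_ff ::
    "('l::topological_space, 'f::euclidean_space) chart set \<Rightarrow> 'l tensor2 \<Rightarrow> 'l connection \<Rightarrow>
     'l topology \<Rightarrow> 'l \<Rightarrow> 'l tvec \<Rightarrow> 'l field \<Rightarrow> 'l tvec" where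
  "second_ff B h D N q u V = normal_part B h N q (D q u V)"

definition totally_geodesic ::
    "('l::topological_space, 'f::euclidean_space) chart set \<Rightarrow> 'l tensor2 \<Rightarrow> 'l connection \<Rightarrow>
     'l topology \<Rightarrow> bool" where
  "totally_geodesic B h D N \<longleftrightarrow>
     (\<forall>q\<in>topspace N. \<forall>u\<in>sub_tangent B N q. \<forall>V. tangent_field_near B N q V \<longrightarrow>
        second_ff B h D N q u V = 0)"

definition smooth_normal_field ::
    "('l::topological_space, 'f::euclidean_space) chart set \<Rightarrow> 'l tensor2 \<Rightarrow> 'l topology \<Rightarrow>
     'l field \<Rightarrow> bool" where
  "smooth_normal_field B h N H \<longleftrightarrow> (\<forall>q\<in>topspace N. H q \<in> normal_to B h N q \<and>
     (\<exists>X W. smooth_field_near B q X \<and> openin N W \<and> q \<in> W \<and> (\<forall>x\<in>W. H x = X x)))"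

definition totally_umbilic ::
    "('l::topological_space, 'f::euclidean_space) chart set \<Rightarrow> 'l tensor2 \<Rightarrow> 'l connection \<Rightarrow>
     'l topology \<Rightarrow> bool" where
  "totally_umbilic B h D N \<longleftrightarrow> (\<exists>H. smooth_normal_field B h N H \<and>
     (\<forall>q\<in>topspace N. \<forall>u\<in>sub_tangent B N q. \<forall>V. tangent_field_near B N q V \<longrightarrow>
        second_ff B h D N q u V = h q u (V q) *\<^sub>R H q))"

end

theory Submission
  imports Defs
begin

text \<open>
  The Koszul formula expresses both \<open>g(\<nabla>\<^sub>U \<xi>, V)\<close> and, for the rigged metric,
  \<open>h(\<nabla>'\<^sub>U \<xi>, V)\<close> through Lie derivatives along \<open>\<xi>\<close>. As \<open>\<omega>\<close> is closed and \<open>\<omega>(\<xi>) = 1\<close>,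
  the Lie derivative of \<open>\<omega>\<close> along \<open>\<xi>\<close> vanishes, so the two agree and
  \<open>B(U, V) = - h(\<nabla>'\<^sub>U \<xi>, V)\<close>. Nondegeneracy of \<open>h\<close> gives the first claim. The second fundamental form
  of a leaf of the screen distribution, whose unit normal is \<open>\<xi>\<close>, is therefore the restriction of
  \<open>B\<close>, which determines \<open>B\<close> because \<open>B(\<xi>, _) = 0\<close>. That a leaf passes through every point is seen
  without Frobenius and Zorn: the level sets of the local primitives of \<open>\<omega>\<close> form the base of a finer
  topology, whose connected components are the leaves.
\<close>

section \<open>Smooth maps between Euclidean spaces\<close>

text \<open>The Koszul formula is usable although the induced metric is degenerate: paired with
  vectors tangent to \<open>L\<close>, it contains only derivatives along \<open>L\<close> and
  brackets of tangent fields, so for fields related by \<open>i\<close> the computation never leaves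
  \<open>L\<close>. To have related fields at all, fields must be extended locally off an immersed,
  perhaps not embedded, hypersurface. This is why a smooth inverse function theorem is built; it
  serves again to straighten the level sets of a primitive. That \<xi> annihilates \<open>B\<close>
  on one side means that it has constant length 1; the other side follows from the symmetry of
  \<open>B\<close>, which is once more the closedness of \<omega>. In the converse for umbilicity
  every leaf yields its own factor, smooth along that leaf only, and factors of neighbouring leaves
  are a priori unrelated. Smoothness across the leaves is recovered from a quotient formula, which
  needs a nonzero screen. If \<open>L\<close> has dimension 1 the leaves are points, the factor is
  unconstrained, and a smooth one has to be supplied.\<close>

lemma Ck_on_cong:
  assumes "open S" "\<And>x. x \<in> S \<Longrightarrow> f x = g x" "Ck_on k S f"
  shows "Ck_on k S g"
  using assms(2,3)
proof (induction k arbitrary: f g)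
  case 0
  then show ?case by simp
next
  case (Suc k)
  have d: "(g has_derivative frechet_derivative f (at x)) (at x)" if "x \<in> S" for x
  proof -
    have "f differentiable (at x)"
      using Suc.prems(2) \<open>open S\<close> that by (simp add: differentiable_on_eq_differentiable_at)
    then have "(f has_derivative frechet_derivative f (at x)) (at x)"
      by (simp add: frechet_derivative_works)
    then show ?thesis
      by (rule has_derivative_transform_within_open[OF _ \<open>open S\<close> that]) (use Suc.prems in auto)
  qed
  then have "g differentiable_on S"
    using \<open>open S\<close> by (auto simp: differentiable_on_eq_differentiable_at differentiable_def)
  moreover have "Ck_on k S (\<lambda>x. frechet_derivative g (at x) v)" for v
    by (rule Suc.IH[of "\<lambda>x. frechet_derivative f (at x) v"])
       (use Suc.prems in \<open>simp_all add: frechet_derivative_at[OF d, symmetric]\<close>)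
  ultimately show ?case by simp
qed

lemma Ck_on_Suc_has_derivative:
  assumes "open S" "Ck_on (Suc k) S f" "x \<in> S"
  shows "(f has_derivative frechet_derivative f (at x)) (at x)"
  using assms by (simp add: differentiable_on_eq_differentiable_at frechet_derivative_works)

lemma Ck_on_SucI:
  assumes "open S" "\<And>x. x \<in> S \<Longrightarrow> (f has_derivative f' x) (at x)"
    and "\<And>v. Ck_on k S (\<lambda>x. f' x v)"
  shows "Ck_on (Suc k) S f"
proof -
  have "f differentiable_on S"
    using assms by (auto simp: differentiable_on_eq_differentiable_at differentiable_def)
  moreover have "Ck_on k S (\<lambda>x. frechet_derivative f (at x) v)" for v
    by (rule Ck_on_cong[OF assms(1) _ assms(3)]) (simp add: frechet_derivative_at[OF assms(2), symmetric])
  ultimately show ?thesis by simp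
qed

lemma Ck_on_Suc_imp:
  "Ck_on (Suc k) S f \<Longrightarrow> Ck_on k S f"
proof (induction k arbitrary: f)
  case 0
  then show ?case by (simp add: differentiable_imp_continuous_on)
next
  case (Suc k)
  then show ?case by (metis Ck_on.simps(2))
qed

lemma Ck_on_imp_continuous_on: "Ck_on k S f \<Longrightarrow> continuous_on S f"
  by (cases k) (auto simp: differentiable_imp_continuous_on)

lemma Ck_on_subset: "Ck_on k S f \<Longrightarrow> T \<subseteq> S \<Longrightarrow> Ck_on k T f"
  by (induction k arbitrary: f)
     (auto intro: continuous_on_subset differentiable_on_subset)

lemma Ck_on_local:
  assumes "open S" "\<And>x. x \<in> S \<Longrightarrow> \<exists>T. open T \<and> x \<in> T \<and> T \<subseteq> S \<and> Ck_on k T f"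
  shows "Ck_on k S f"
  using assms(2)
proof (induction k arbitrary: f)
  case 0
  then show ?case
    using assms(1) by (simp add: continuous_on_eq_continuous_at) (metis continuous_on_eq_continuous_at)
next
  case (Suc k)
  have "f differentiable_on S"
    using Suc.prems assms(1) differentiable_on_eq_differentiable_at Ck_on.simps(2) by metis
  moreover have "Ck_on k S (\<lambda>x. frechet_derivative f (at x) v)" for v
    by (rule Suc.IH) (use Suc.prems in \<open>metis Ck_on.simps(2)\<close>)
  ultimately show ?case by simp
qed

lemma Ck_on_const: "Ck_on k S (\<lambda>x. c)"
  by (induction k arbitrary: c) (auto simp: frechet_derivative_const)

lemma Ck_on_bounded_linear:
  assumes "open S" "bounded_linear L" shows "Ck_on k S L"
proof (cases k)
  case 0
  then show ?thesis using assms(2) by (simp add: linear_continuous_on)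
next
  case (Suc n)
  show ?thesis unfolding Suc
    by (rule Ck_on_SucI[OF assms(1) bounded_linear_imp_has_derivative[OF assms(2)]])
       (rule Ck_on_const)
qed

lemma Ck_on_linear_compose:
  assumes "open S" "bounded_linear L" "Ck_on k S f" shows "Ck_on k S (\<lambda>x. L (f x))"
  using assms(3)
proof (induction k arbitrary: f)
  case 0
  then show ?case by (simp add: assms(2) bounded_linear.continuous_on)
next
  case (Suc k)
  show ?case
  proof (rule Ck_on_SucI[OF assms(1)])
    show "((\<lambda>x. L (f x)) has_derivative (\<lambda>v. L (frechet_derivative f (at x) v))) (at x)" if "x \<in> S" for x
      using bounded_linear.has_derivative[OF assms(2) Ck_on_Suc_has_derivative[OF assms(1) Suc.prems that]] .
    show "Ck_on k S (\<lambda>x. L (frechet_derivative f (at x) v))" for v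
      using Suc by simp
  qed
qed

lemma Ck_on_add:
  assumes "open S" "Ck_on k S f" "Ck_on k S h" shows "Ck_on k S (\<lambda>x. f x + h x)"
  using assms(2,3)
proof (induction k arbitrary: f h)
  case 0
  then show ?case by (simp add: continuous_on_add)
next
  case (Suc k)
  show ?case
    by (rule Ck_on_SucI[OF assms(1) has_derivative_add[OF Ck_on_Suc_has_derivative[OF assms(1) Suc.prems(1)]
          Ck_on_Suc_has_derivative[OF assms(1) Suc.prems(2)]]])
       (use Suc in auto)
qed

lemma Ck_on_sum:
  assumes "open S" "\<And>i. i \<in> I \<Longrightarrow> Ck_on k S (f i)" shows "Ck_on k S (\<lambda>x. \<Sum>i\<in>I. f i x)"
  using assms(2)
  by (induction I rule: infinite_finite_induct) (auto intro: Ck_on_const Ck_on_add assms(1))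

lemma Ck_on_scaleR:
  fixes f :: "'a::euclidean_space \<Rightarrow> real"
  assumes "open S" "Ck_on k S f" "Ck_on k S h" shows "Ck_on k S (\<lambda>x. f x *\<^sub>R h x)"
  using assms(2,3)
proof (induction k arbitrary: f h)
  case 0
  then show ?case by (simp add: continuous_on_scaleR)
next
  case (Suc k)
  have "Ck_on k S f" "Ck_on k S h" using Suc.prems Ck_on_Suc_imp by blast+
  with Suc show ?case
    by (intro Ck_on_SucI[OF assms(1) has_derivative_scaleR[OF Ck_on_Suc_has_derivative[OF assms(1) Suc.prems(1)]
          Ck_on_Suc_has_derivative[OF assms(1) Suc.prems(2)]]])
       (auto intro!: Ck_on_add assms(1) Suc.IH)
qed

lemma Ck_on_inner:
  fixes f :: "'a::euclidean_space \<Rightarrow> 'b::euclidean_space"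
  assumes "open S" "Ck_on k S f"
  shows "Ck_on k S (\<lambda>x. f x \<bullet> b)"
  by (rule Ck_on_linear_compose[OF assms(1) bounded_linear_inner_left assms(2)])

lemma linear_basis_expand:
  fixes L :: "'a::euclidean_space \<Rightarrow> 'b::real_vector"
  assumes "linear L" shows "L u = (\<Sum>b\<in>Basis. (u \<bullet> b) *\<^sub>R L b)"
  by (metis (no_types, lifting) assms euclidean_representation linear_scale linear_sum sum.cong)

lemma Ck_on_compose:
  fixes f :: "'a::euclidean_space \<Rightarrow> 'b::euclidean_space"
  assumes "open S" "open T" "Ck_on k S f" "Ck_on k T h" "f ` S \<subseteq> T"
  shows "Ck_on k S (\<lambda>x. h (f x))"
  using assms(3,4)
proof (induction k arbitrary: h)
  case 0
  then show ?case using assms(5) continuous_on_compose2 by auto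
next
  case (Suc k)
  have dh: "(h has_derivative frechet_derivative h (at (f x))) (at (f x))" if "x \<in> S" for x
    using Ck_on_Suc_has_derivative[OF assms(2) Suc.prems(2)] assms(5) that by auto
  show ?case
  proof (rule Ck_on_SucI[OF assms(1)])
    show "((\<lambda>x. h (f x)) has_derivative
        (\<lambda>v. frechet_derivative h (at (f x)) (frechet_derivative f (at x) v))) (at x)" if "x \<in> S" for x
      using diff_chain_at[OF Ck_on_Suc_has_derivative[OF assms(1) Suc.prems(1) that] dh[OF that]]
      by (simp add: o_def)
    fix v
    \<comment> \<open>\<open>Ck_on\<close> controls derivatives in fixed directions only, but here
      the direction \<open>frechet_derivative f (at x) v\<close> moves with \<open>x\<close>.
      Expanding it in the basis leaves products of functions already known to be C^k.\<close>
    have "Ck_on k S (\<lambda>x. \<Sum>b\<in>Basis. (frechet_derivative f (at x) v \<bullet> b) *\<^sub>R frechet_derivative h (at (f x)) b)"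
      using Suc Ck_on_Suc_imp[OF Suc.prems(1)] by (auto intro!: Ck_on_sum Ck_on_scaleR Ck_on_inner assms(1))
    then show "Ck_on k S (\<lambda>x. frechet_derivative h (at (f x)) (frechet_derivative f (at x) v))"
      by (rule Ck_on_cong[OF assms(1), rotated]) (simp add: linear_basis_expand[OF has_derivative_linear[OF dh], symmetric])
  qed
qed

lemma smooth_on_cong:
  assumes "open S" "\<And>x. x \<in> S \<Longrightarrow> f x = g x" "smooth_on S f"
  shows "smooth_on S g"
  using assms unfolding smooth_on_def by (meson Ck_on_cong)

lemma smooth_on_subset: "smooth_on S f \<Longrightarrow> T \<subseteq> S \<Longrightarrow> smooth_on T f"
  unfolding smooth_on_def by (meson Ck_on_subset)

lemma smooth_on_local:
  assumes "open S" "\<And>x. x \<in> S \<Longrightarrow> \<exists>T. open T \<and> x \<in> T \<and> T \<subseteq> S \<and> smooth_on T f"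
  shows "smooth_on S f"
  using assms unfolding smooth_on_def by (meson Ck_on_local)

lemma smooth_on_imp_continuous_on: "smooth_on S f \<Longrightarrow> continuous_on S f"
  unfolding smooth_on_def by (meson Ck_on_imp_continuous_on)

lemma smooth_on_has_derivative:
  "open S \<Longrightarrow> smooth_on S f \<Longrightarrow> x \<in> S \<Longrightarrow> (f has_derivative frechet_derivative f (at x)) (at x)"
  unfolding smooth_on_def by (meson Ck_on_Suc_has_derivative)

lemma smooth_on_frechet_derivative:
  "smooth_on S f \<Longrightarrow> smooth_on S (\<lambda>x. frechet_derivative f (at x) v)"
  unfolding smooth_on_def by (metis Ck_on.simps(2))

lemma smooth_onI_derivative:
  assumes "open S" "\<And>x. x \<in> S \<Longrightarrow> (f has_derivative f' x) (at x)"
    and "\<And>v. smooth_on S (\<lambda>x. f' x v)"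
  shows "smooth_on S f"
  using Ck_on_SucI[OF assms(1,2)] assms(3) Ck_on_Suc_imp unfolding smooth_on_def by blast

lemma smooth_on_const: "smooth_on S (\<lambda>x. c)"
  by (simp add: smooth_on_def Ck_on_const)

lemma smooth_on_bounded_linear: "open S \<Longrightarrow> bounded_linear L \<Longrightarrow> smooth_on S L"
  by (simp add: smooth_on_def Ck_on_bounded_linear)

lemma smooth_on_add:
  "open S \<Longrightarrow> smooth_on S f \<Longrightarrow> smooth_on S h \<Longrightarrow> smooth_on S (\<lambda>x. f x + h x)"
  by (simp add: smooth_on_def Ck_on_add)

lemma smooth_on_sum:
  "open S \<Longrightarrow> (\<And>i. i \<in> I \<Longrightarrow> smooth_on S (f i)) \<Longrightarrow> smooth_on S (\<lambda>x. \<Sum>i\<in>I. f i x)"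
  by (simp add: smooth_on_def Ck_on_sum)

lemma smooth_on_scaleR:
  "open S \<Longrightarrow> smooth_on S f \<Longrightarrow> smooth_on S h \<Longrightarrow> smooth_on S (\<lambda>x. f x *\<^sub>R h x)"
  by (simp add: smooth_on_def Ck_on_scaleR)

lemma smooth_on_mult:
  fixes f h :: "'a::euclidean_space \<Rightarrow> real"
  shows "open S \<Longrightarrow> smooth_on S f \<Longrightarrow> smooth_on S h \<Longrightarrow> smooth_on S (\<lambda>x. f x * h x)"
  using smooth_on_scaleR[of S f h] by simp

lemma smooth_on_inner:
  fixes f :: "'a::euclidean_space \<Rightarrow> 'b::euclidean_space"
  shows "open S \<Longrightarrow> smooth_on S f \<Longrightarrow> smooth_on S (\<lambda>x. f x \<bullet> b)"
  by (simp add: smooth_on_def Ck_on_inner)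

lemma smooth_on_compose:
  fixes f :: "'a::euclidean_space \<Rightarrow> 'b::euclidean_space"
  shows "open S \<Longrightarrow> open T \<Longrightarrow> smooth_on S f \<Longrightarrow> smooth_on T h \<Longrightarrow> f ` S \<subseteq> T \<Longrightarrow>
    smooth_on S (\<lambda>x. h (f x))"
  by (simp add: smooth_on_def Ck_on_compose)

lemma Ck_on_inverse:
  fixes f :: "'a::euclidean_space \<Rightarrow> real"
  assumes "open S" "\<And>x. x \<in> S \<Longrightarrow> f x \<noteq> 0" "Ck_on k S f"
  shows "Ck_on k S (\<lambda>x. inverse (f x))"
  using assms(3)
proof (induction k)
  case 0
  then show ?case using assms(2) by (simp add: continuous_on_inverse)
next
  case (Suc k)
  have i: "Ck_on k S (\<lambda>x. inverse (f x))" using Suc Ck_on_Suc_imp by blast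
  show ?case
  proof (rule Ck_on_SucI[OF assms(1) Deriv.has_derivative_inverse[OF assms(2) Ck_on_Suc_has_derivative[OF assms(1) Suc.prems]]])
    fix v
    have "Ck_on k S (\<lambda>x. (-1) *\<^sub>R (inverse (f x) *\<^sub>R (frechet_derivative f (at x) v *\<^sub>R inverse (f x))))"
      by (intro Ck_on_scaleR Ck_on_const assms(1) i) (use Suc.prems in simp)
    then show "Ck_on k S (\<lambda>x. - (inverse (f x) * frechet_derivative f (at x) v * inverse (f x)))"
      by (simp add: mult.assoc)
  qed
qed

lemma smooth_on_inverse:
  fixes f :: "'a::euclidean_space \<Rightarrow> real"
  shows "open S \<Longrightarrow> (\<And>x. x \<in> S \<Longrightarrow> f x \<noteq> 0) \<Longrightarrow> smooth_on S f \<Longrightarrow> smooth_on S (\<lambda>x. inverse (f x))"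
  by (simp add: smooth_on_def Ck_on_inverse)

text \<open>At a zero of \<open>f\<close> the first-order error of the product involves only the
  limit of \<open>k\<close>, so the second factor may be merely continuous. For a family of inverse
  operators that factor is the inverse itself, whose differentiability is still to be shown.\<close>

lemma has_derivative_scaleR_zero:
  fixes f :: "'a::real_normed_vector \<Rightarrow> real" and k :: "'a \<Rightarrow> 'b::real_normed_vector"
  assumes f: "(f has_derivative f') (at x)" and "f x = 0" and k: "continuous (at x) k"
  shows "((\<lambda>y. f y *\<^sub>R k y) has_derivative (\<lambda>z. f' z *\<^sub>R k x)) (at x)"
proof -
  have bl: "bounded_linear f'" using f has_derivative_bounded_linear by blast
  obtain K where K: "\<And>z. norm (f' z) \<le> norm z * K" "K > 0"
    using bounded_linear.pos_bounded[OF bl] by blast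
  let ?r = "\<lambda>y. norm (f y - f x - f' (y - x)) / norm (y - x)"
  have r: "(?r \<longlongrightarrow> 0) (at x)"
    using f by (simp add: has_derivative_iff_norm)
  have lim: "((\<lambda>y. ?r y * norm (k y) + K * norm (k y - k x)) \<longlongrightarrow> 0) (at x)"
  proof -
    have kx: "(k \<longlongrightarrow> k x) (at x)" using k by (simp add: isCont_def)
    have "((\<lambda>y. ?r y * norm (k y) + K * norm (k y - k x)) \<longlongrightarrow> 0 * norm (k x) + K * norm (k x - k x)) (at x)"
      by (intro tendsto_add tendsto_mult r tendsto_norm tendsto_diff tendsto_const kx)
    then show ?thesis by simp
  qed
  have "((\<lambda>y. norm (f y *\<^sub>R k y - f x *\<^sub>R k x - f' (y - x) *\<^sub>R k x) / norm (y - x)) \<longlongrightarrow> 0) (at x)"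
  proof (rule tendsto_sandwich[OF _ _ tendsto_const lim])
    show "\<forall>\<^sub>F y in at x. norm (f y *\<^sub>R k y - f x *\<^sub>R k x - f' (y - x) *\<^sub>R k x) / norm (y - x)
        \<le> ?r y * norm (k y) + K * norm (k y - k x)"
    proof (rule eventually_mono[OF eventually_neq_at_within])
      fix y assume "y \<noteq> x"
      have "f y *\<^sub>R k y - f x *\<^sub>R k x - f' (y - x) *\<^sub>R k x =
          (f y - f x - f' (y - x)) *\<^sub>R k y + f' (y - x) *\<^sub>R (k y - k x)"
        by (simp add: algebra_simps \<open>f x = 0\<close>)
      then have "norm (f y *\<^sub>R k y - f x *\<^sub>R k x - f' (y - x) *\<^sub>R k x) \<le>
          norm (f y - f x - f' (y - x)) * norm (k y) + norm (f' (y - x)) * norm (k y - k x)"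
        by (metis norm_triangle_ineq norm_scaleR real_norm_def)
      also have "\<dots> \<le> norm (f y - f x - f' (y - x)) * norm (k y) + (norm (y - x) * K) * norm (k y - k x)"
        using K(1) by (intro add_left_mono mult_right_mono) auto
      finally show "norm (f y *\<^sub>R k y - f x *\<^sub>R k x - f' (y - x) *\<^sub>R k x) / norm (y - x)
        \<le> ?r y * norm (k y) + K * norm (k y - k x)"
        using \<open>y \<noteq> x\<close> by (simp add: field_simps)
    qed
  qed auto
  then show ?thesis
    using bl by (simp add: has_derivative_iff_norm bounded_linear_scaleR_const)
qed

section \<open>Inverses of smooth operator families and the smooth inverse function theorem\<close>

context
  fixes S :: "'a::euclidean_space set" and L M :: "'a \<Rightarrow> 'b::euclidean_space \<Rightarrow> 'b"
  assumes S: "open S"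
    and linL: "\<And>y. y \<in> S \<Longrightarrow> linear (L y)" and linM: "\<And>y. y \<in> S \<Longrightarrow> linear (M y)"
    and L_inv: "\<And>y v. y \<in> S \<Longrightarrow> L y (M y v) = v" and inv_L: "\<And>y v. y \<in> S \<Longrightarrow> M y (L y v) = v"
begin

text \<open>If \<open>K\<close> bounds \<open>M y0\<close> and \<open>L y\<close> differs from
  \<open>L y0\<close> by less than \<open>1 / (2 * K)\<close>, then the error costs at most half of
  \<open>norm (M y z)\<close> and can be absorbed on the left, which leaves the bound
  \<open>2 * K\<close>, uniform in \<open>y\<close>.\<close>

lemma inverse_operator_bounded:
  assumes cont: "\<And>v. continuous_on S (\<lambda>y. L y v)" and y0: "y0 \<in> S"
  obtains T C where "open T" "y0 \<in> T" "T \<subseteq> S" "\<And>y z. y \<in> T \<Longrightarrow> norm (M y z) \<le> C * norm z"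
proof -
  have "bounded_linear (M y0)" using linM[OF y0] linear_conv_bounded_linear by blast
  then obtain K where K: "K > 0" "\<And>z. norm (M y0 z) \<le> norm z * K"
    using bounded_linear.pos_bounded by blast
  let ?e = "\<lambda>y. \<Sum>b\<in>Basis. norm (L y b - L y0 b)"
  define T where "T = {y \<in> S. ?e y < 1 / (2 * K)}"
  have "continuous_on S ?e" by (intro continuous_intros cont)
  then have "open T"
    unfolding T_def using continuous_open_preimage[OF _ S, of ?e "{..<1 / (2 * K)}"]
    by (simp add: vimage_def Int_def)
  moreover have "y0 \<in> T" using K y0 by (simp add: T_def)
  moreover have "norm (M y z) \<le> 2 * K * norm z" if y: "y \<in> T" for y z
  proof -
    define w where "w = M y z"
    have yS: "y \<in> S" using y by (simp add: T_def)
    have "L y w - L y0 w = (\<Sum>b\<in>Basis. (w \<bullet> b) *\<^sub>R (L y b - L y0 b))"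
      using linear_basis_expand[OF linL[OF yS], of w] linear_basis_expand[OF linL[OF y0], of w]
      by (simp add: scaleR_right_diff_distrib sum_subtractf)
    also have "norm \<dots> \<le> (\<Sum>b\<in>Basis. norm w * norm (L y b - L y0 b))"
      by (rule sum_norm_le) (simp add: Basis_le_norm mult_right_mono)
    also have "\<dots> = norm w * ?e y" by (simp add: sum_distrib_left)
    also have "\<dots> \<le> norm w * (1 / (2 * K))"
      using y by (intro mult_left_mono) (auto simp: T_def)
    finally have e: "norm (L y w - L y0 w) \<le> norm w * (1 / (2 * K))" .
    have "norm w = norm (M y0 (L y0 w))" by (simp add: inv_L y0)
    also have "\<dots> \<le> norm (L y0 w) * K" by (rule K)
    also have "\<dots> \<le> (norm (L y w) + norm w * (1 / (2 * K))) * K"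
      using e K(1) norm_triangle_sub[of "L y0 w" "L y w"]
      by (intro mult_right_mono) (auto simp: norm_minus_commute)
    also have "\<dots> = norm z * K + norm w / 2" using K(1) L_inv[OF yS] by (simp add: w_def field_simps)
    finally have "norm w \<le> 2 * (norm z * K)" by linarith
    then show ?thesis by (simp add: w_def mult_ac)
  qed
  ultimately show ?thesis using that T_def by blast
qed

text \<open>A resolvent identity. It reduces the increment of \<open>M\<close> to the increment of
  \<open>L\<close> at the fixed vector \<open>M y0 v\<close>, up to a factor \<open>M y\<close> that
  is locally bounded.\<close>

lemma inverse_operator_diff:
  assumes "y \<in> S" "y0 \<in> S" shows "M y v - M y0 v = - M y (L y (M y0 v) - v)"
  using linM[OF assms(1)] by (simp add: linear_diff inv_L assms)

lemma continuous_on_inverse_operator: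
  assumes cont: "\<And>v. continuous_on S (\<lambda>y. L y v)"
  shows "continuous_on S (\<lambda>y. M y v)"
proof -
  have "isCont (\<lambda>y. M y v) y0" if y0: "y0 \<in> S" for y0
  proof -
    obtain T C where T: "open T" "y0 \<in> T" "T \<subseteq> S" "\<And>y z. y \<in> T \<Longrightarrow> norm (M y z) \<le> C * norm z"
      using inverse_operator_bounded[OF cont y0] by metis
    have "((\<lambda>y. L y (M y0 v)) \<longlongrightarrow> v) (at y0)"
      using cont[of "M y0 v"] S y0 L_inv[OF y0, of v] by (auto simp: continuous_on_eq_continuous_at isCont_def dest!: bspec[OF _ y0])
    then have lim: "((\<lambda>y. C * norm (L y (M y0 v) - v)) \<longlongrightarrow> 0) (at y0)"
      by (auto intro!: tendsto_eq_intros simp: LIM_zero)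
    have "((\<lambda>y. M y v - M y0 v) \<longlongrightarrow> 0) (at y0)"
    proof (rule Lim_null_comparison[OF _ lim])
      show "\<forall>\<^sub>F y in at y0. norm (M y v - M y0 v) \<le> C * norm (L y (M y0 v) - v)"
        unfolding eventually_at_topological using T y0
        by (intro exI[of _ T]) (auto simp: inverse_operator_diff)
    qed
    then show ?thesis by (simp add: isCont_def LIM_zero_iff)
  qed
  then show ?thesis using S continuous_on_eq_continuous_at by blast
qed

text \<open>The rule d(L^-1) = - L^-1 dL L^-1. By \<open>inverse_operator_diff\<close> the increment
  of \<open>M\<close> is a sum of products of a coordinate of \<open>L y (M y0 v) - v\<close>, which
  vanishes at \<open>y0\<close>, with \<open>M y b\<close>, which is known to be continuous; this is
  the case of \<open>has_derivative_scaleR_zero\<close>.\<close>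

lemma has_derivative_inverse_operator:
  assumes cont: "\<And>v. continuous_on S (\<lambda>y. L y v)" and y0: "y0 \<in> S"
    and d: "((\<lambda>y. L y (M y0 v)) has_derivative L') (at y0)"
  shows "((\<lambda>y. M y v) has_derivative (\<lambda>z. - M y0 (L' z))) (at y0)"
proof -
  let ?a = "\<lambda>y. L y (M y0 v) - v"
  have a: "((\<lambda>y. ?a y \<bullet> b) has_derivative (\<lambda>z. L' z \<bullet> b)) (at y0)" for b
    using has_derivative_inner_left[OF has_derivative_diff[OF d has_derivative_const[of v]], of b] by simp
  have "isCont (\<lambda>y. M y b) y0" for b
    using continuous_on_inverse_operator[OF cont] S y0 continuous_on_eq_continuous_at by blast
  then have "((\<lambda>y. (?a y \<bullet> b) *\<^sub>R M y b) has_derivative (\<lambda>z. (L' z \<bullet> b) *\<^sub>R M y0 b)) (at y0)" for b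
    by (intro has_derivative_scaleR_zero[OF a]) (simp_all add: L_inv[OF y0])
  then have "((\<lambda>y. M y0 v - (\<Sum>b\<in>Basis. (?a y \<bullet> b) *\<^sub>R M y b)) has_derivative
      (\<lambda>z. 0 - (\<Sum>b\<in>Basis. (L' z \<bullet> b) *\<^sub>R M y0 b))) (at y0)"
    by (intro has_derivative_diff has_derivative_const has_derivative_sum)
  then have "((\<lambda>y. M y0 v - (\<Sum>b\<in>Basis. (?a y \<bullet> b) *\<^sub>R M y b)) has_derivative
      (\<lambda>z. - M y0 (L' z))) (at y0)"
    by (simp add: linear_basis_expand[OF linM[OF y0], symmetric])
  then show ?thesis
  proof (rule has_derivative_transform_within_open[OF _ S y0])
    show "M y0 v - (\<Sum>b\<in>Basis. (?a y \<bullet> b) *\<^sub>R M y b) = M y v" if "y \<in> S" for y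
      using inverse_operator_diff[OF that y0, of v] linear_basis_expand[OF linM[OF that], of "?a y"]
      by (simp add: algebra_simps)
  qed
qed

lemma Ck_on_inverse_operator:
  assumes "\<And>v. Ck_on k S (\<lambda>y. L y v)"
  shows "Ck_on k S (\<lambda>y. M y v)"
  using assms
proof (induction k arbitrary: v)
  case 0
  then show ?case using continuous_on_inverse_operator by simp
next
  case (Suc k)
  have cont: "continuous_on S (\<lambda>y. L y v)" for v
    using Ck_on_imp_continuous_on[OF Suc.prems] .
  have M: "Ck_on k S (\<lambda>y. M y v)" for v
    using Suc Ck_on_Suc_imp by blast
  define L' where "L' = (\<lambda>y w. frechet_derivative (\<lambda>y. L y w) (at y))"
  have dL: "((\<lambda>y. L y w) has_derivative L' y w) (at y)" if "y \<in> S" for y w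
    unfolding L'_def by (rule Ck_on_Suc_has_derivative[OF S Suc.prems that])
  \<comment> \<open>The vector \<open>M y v\<close> that goes into \<open>L'\<close> moves with
    \<open>y\<close>. Linearity in this slot, inherited from \<open>L\<close>, permits a basis
    expansion whose coefficients the induction hypothesis covers.\<close>
  have linw: "linear (\<lambda>w. L' y w z)" if y: "y \<in> S" for y z
  proof (rule linearI)
    show "L' y (a + b) z = L' y a z + L' y b z" for a b
    proof -
      have "((\<lambda>y. L y (a + b)) has_derivative (\<lambda>z. L' y a z + L' y b z)) (at y)"
        by (rule has_derivative_transform_within_open[OF has_derivative_add[OF dL[OF y] dL[OF y]] S y])
           (simp add: linL linear_add)
      then show ?thesis using has_derivative_unique dL[OF y] by metis
    qed
    show "L' y (r *\<^sub>R a) z = r *\<^sub>R L' y a z" for r a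
    proof -
      have "((\<lambda>y. L y (r *\<^sub>R a)) has_derivative (\<lambda>z. r *\<^sub>R L' y a z)) (at y)"
        by (rule has_derivative_transform_within_open[OF has_derivative_scaleR_right[OF dL[OF y]] S y])
           (simp add: linL linear_scale)
      then show ?thesis using has_derivative_unique dL[OF y] by metis
    qed
  qed
  show ?case
  proof (rule Ck_on_SucI[OF S has_derivative_inverse_operator[OF cont _ dL]])
    fix z
    have "Ck_on k S (\<lambda>y. (-1) *\<^sub>R (\<Sum>b\<in>Basis.
        ((\<Sum>c\<in>Basis. (M y v \<bullet> c) *\<^sub>R L' y c z) \<bullet> b) *\<^sub>R M y b))"
      by (intro Ck_on_scaleR Ck_on_const Ck_on_sum Ck_on_inner S M) (use Suc.prems in \<open>simp add: L'_def\<close>)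
    then show "Ck_on k S (\<lambda>y. - M y (L' y (M y v) z))"
      by (rule Ck_on_cong[OF S, rotated])
         (simp add: linear_basis_expand[OF linw, symmetric] linear_basis_expand[OF linM, symmetric])
  qed
qed

end

text \<open>The C^1 theorem gives an inverse \<open>G\<close> whose derivative at \<open>y\<close>
  is the inverse of the derivative of \<open>F\<close> at \<open>G y\<close>. If \<open>G\<close> is
  C^k, then so is this family of derivatives, and by \<open>Ck_on_inverse_operator\<close> the
  family of their inverses; hence \<open>G\<close> is C^(k+1).\<close>

lemma smooth_inverse_function:
  fixes F :: "'a::euclidean_space \<Rightarrow> 'a"
  assumes S: "open S" and F: "smooth_on S F" and x0: "x0 \<in> S"
    and inj: "\<And>w. frechet_derivative F (at x0) w = 0 \<Longrightarrow> w = 0"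
  obtains U V G where "open U" "x0 \<in> U" "U \<subseteq> S" "open V" "homeomorphism U V F G" "smooth_on V G"
proof -
  let ?D = "\<lambda>x. frechet_derivative F (at x)"
  define F' where "F' = (\<lambda>x. Blinfun (?D x))"
  have d: "(F has_derivative ?D x) (at x)" if "x \<in> S" for x
    by (rule smooth_on_has_derivative[OF S F that])
  then have F': "blinfun_apply (F' x) = ?D x" if "x \<in> S" for x
    unfolding F'_def by (rule bounded_linear_Blinfun_apply[OF has_derivative_bounded_linear]) fact
  have cont: "continuous_on S F'"
  proof (rule continuous_on_blinfun_componentwise)
    fix b :: 'a
    show "continuous_on S (\<lambda>x. blinfun_apply (F' x) b)"
      using smooth_on_imp_continuous_on[OF smooth_on_frechet_derivative[OF F, of b]]
      by (simp add: F' cong: continuous_on_cong)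
  qed
  have lin: "linear (?D x)" if "x \<in> S" for x using d[OF that] has_derivative_linear by blast
  have "inj (?D x0)" using inj lin[OF x0] linear_injective_0 by blast
  then obtain h where h: "linear h" "h \<circ> ?D x0 = id"
    using linear_injective_left_inverse lin[OF x0] by blast
  then have inv_h: "Blinfun h o\<^sub>L F' x0 = id_blinfun"
    by (intro blinfun_eqI) (simp add: F' x0 bounded_linear_Blinfun_apply linear_conv_bounded_linear[symmetric] pointfree_idE)
  have dF: "(F has_derivative blinfun_apply (F' x)) (at x)" if "x \<in> S" for x
    using d[OF that] F'[OF that] by simp
  obtain U V G g' where U: "open U" "U \<subseteq> S" "x0 \<in> U" "open V" "F x0 \<in> V" "homeomorphism U V F G"
    and dG: "\<And>y. y \<in> V \<Longrightarrow> (G has_derivative (g' y)) (at y)"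
    and g': "\<And>y. y \<in> V \<Longrightarrow> g' y = inv (blinfun_apply (F' (G y)))"
    and bij: "\<And>y. y \<in> V \<Longrightarrow> bij (blinfun_apply (F' (G y)))"
    by (rule inverse_function_theorem[OF S dF cont x0 inv_h]) (assumption, rule that)
  have GS: "G y \<in> S" if "y \<in> V" for y
    using U that unfolding homeomorphism_def by blast
  have "Ck_on k V G" for k
  proof (induction k)
    case 0
    then show ?case using U(6) by (simp add: homeomorphism_def)
  next
    case (Suc k)
    show ?case
    proof (rule Ck_on_SucI[OF U(4) dG])
      show "Ck_on k V (\<lambda>y. g' y v)" for v
      proof (rule Ck_on_inverse_operator[OF U(4), of "\<lambda>y. ?D (G y)"])
        fix y w assume y: "y \<in> V"
        have eq: "g' y = inv (?D (G y))" and b: "bij (?D (G y))"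
          using g' bij F' GS y by auto
        show "linear (?D (G y))" using lin GS y by blast
        show "linear (g' y)" using dG[OF y] has_derivative_linear by blast
        show "?D (G y) (g' y w) = w" using eq b by (simp add: bij_is_surj surj_f_inv_f)
        show "g' y (?D (G y) w) = w" using eq b by (simp add: bij_is_inj)
      next
        show "Ck_on k V (\<lambda>y. ?D (G y) w)" for w
          using smooth_on_frechet_derivative[OF F] GS
          by (intro Ck_on_compose[OF U(4) S Suc]) (auto simp: smooth_on_def)
      qed
    qed
  qed
  then show ?thesis using that U by (simp add: smooth_on_def)
qed

section \<open>Smooth manifolds\<close>

abbreviation cinv :: "('m, 'e) chart \<Rightarrow> 'e \<Rightarrow> 'm" where
  "cinv c \<equiv> inv_into (fst c) (snd c)"

lemma isCont_imp_filterlim_nhds: "isCont f x \<Longrightarrow> filterlim f (nhds (f x)) (nhds x)"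
  by (simp add: isCont_def tendsto_at_iff_tendsto_nhds)

locale smooth_manifold =
  fixes A :: "('m::t2_space, 'e::euclidean_space) chart set"
  assumes smooth_structure: "smooth_structure A"
begin

lemma chart_homeomorphism: "c \<in> A \<Longrightarrow> homeomorphism (fst c) (snd c ` fst c) (snd c) (cinv c)"
  and open_chart_domain: "c \<in> A \<Longrightarrow> open (fst c)"
  and open_chart_range: "c \<in> A \<Longrightarrow> open (snd c ` fst c)"
proof -
  assume "c \<in> A"
  then have "is_chart c" using smooth_structure unfolding smooth_structure_def by blast
  then show "homeomorphism (fst c) (snd c ` fst c) (snd c) (cinv c)" "open (fst c)" "open (snd c ` fst c)"
    by (simp_all add: is_chart_def case_prod_unfold)
qed

lemma ex_chart: "\<exists>c\<in>A. p \<in> fst c"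
  using smooth_structure unfolding smooth_structure_def by blast

lemma cinv_chart [simp]: "c \<in> A \<Longrightarrow> p \<in> fst c \<Longrightarrow> cinv c (snd c p) = p"
  using chart_homeomorphism by (auto simp: homeomorphism_def)

lemma chart_cinv [simp]: "c \<in> A \<Longrightarrow> x \<in> snd c ` fst c \<Longrightarrow> snd c (cinv c x) = x"
  using chart_homeomorphism by (auto simp: homeomorphism_def)

lemma cinv_in_domain: "c \<in> A \<Longrightarrow> x \<in> snd c ` fst c \<Longrightarrow> cinv c x \<in> fst c"
  by auto

lemma continuous_on_chart: "c \<in> A \<Longrightarrow> continuous_on (fst c) (snd c)"
  using chart_homeomorphism homeomorphism_def by blast

lemma continuous_on_cinv: "c \<in> A \<Longrightarrow> continuous_on (snd c ` fst c) (cinv c)"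
  using chart_homeomorphism homeomorphism_def by blast

lemma open_chart_vimage: "c \<in> A \<Longrightarrow> open T \<Longrightarrow> open (fst c \<inter> snd c -` T)"
  using continuous_on_chart continuous_open_preimage open_chart_domain by blast

lemma open_chart_image:
  assumes "c \<in> A" "open W" shows "open (snd c ` (fst c \<inter> W))"
proof -
  have "snd c ` (fst c \<inter> W) = snd c ` fst c \<inter> cinv c -` W" using assms by auto
  then show ?thesis
    using assms continuous_on_cinv continuous_open_preimage open_chart_range by metis
qed

lemma transition_smooth:
  "c \<in> A \<Longrightarrow> d \<in> A \<Longrightarrow> smooth_on (snd c ` (fst c \<inter> fst d)) (snd d \<circ> cinv c)"
proof -
  assume "c \<in> A" "d \<in> A"
  then have "compatible c d" using smooth_structure unfolding smooth_structure_def by blast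
  then show ?thesis by (simp add: compatible_def case_prod_unfold)
qed

lemma filterlim_chart:
  assumes "c \<in> A" "p \<in> fst c" shows "filterlim (snd c) (nhds (snd c p)) (nhds p)"
  using continuous_on_chart[OF assms(1)] open_chart_domain[OF assms(1)] assms(2)
  by (simp add: continuous_on_eq_continuous_at isCont_def tendsto_at_iff_tendsto_nhds)

lemma filterlim_cinv:
  assumes "c \<in> A" "p \<in> fst c" shows "filterlim (cinv c) (nhds p) (nhds (snd c p))"
proof -
  have "isCont (cinv c) (snd c p)"
    using continuous_on_cinv[OF assms(1)] open_chart_range[OF assms(1)] assms(2)
    by (auto simp: continuous_on_eq_continuous_at)
  from isCont_imp_filterlim_nhds[OF this] show ?thesis using assms by simp
qed

lemma eventually_in_chart:
  assumes "c \<in> A" "p \<in> fst c" shows "\<forall>\<^sub>F q in nhds p. q \<in> fst c"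
  using eventually_nhds_in_open open_chart_domain assms by blast

lemma eventually_in_chart_range:
  assumes "c \<in> A" "p \<in> fst c" shows "\<forall>\<^sub>F x in nhds (snd c p). x \<in> snd c ` fst c"
  using eventually_nhds_in_open open_chart_range assms by blast

lemma eventually_chart_iff:
  assumes "c \<in> A" "p \<in> fst c"
  shows "(\<forall>\<^sub>F x in nhds (snd c p). P (cinv c x)) \<longleftrightarrow> (\<forall>\<^sub>F q in nhds p. P q)"
proof
  assume "\<forall>\<^sub>F x in nhds (snd c p). P (cinv c x)"
  then have "\<forall>\<^sub>F q in nhds p. P (cinv c (snd c q))"
    using filterlim_chart[OF assms] by (rule eventually_compose_filterlim)
  with eventually_in_chart[OF assms] show "\<forall>\<^sub>F q in nhds p. P q"
    by eventually_elim (simp add: assms(1))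
next
  assume "\<forall>\<^sub>F q in nhds p. P q"
  then show "\<forall>\<^sub>F x in nhds (snd c p). P (cinv c x)"
    using filterlim_cinv[OF assms] by (rule eventually_compose_filterlim)
qed

subsection \<open>Smooth functions\<close>

lemma smooth_fun_iff:
  "smooth_fun A W f \<longleftrightarrow> open W \<and> (\<forall>c\<in>A. smooth_on (snd c ` (fst c \<inter> W)) (f \<circ> cinv c))"
  by (auto simp: smooth_fun_def split: prod.splits)

text \<open>Smooth transition maps carry smoothness from one chart around \<open>p\<close> to all
  others. Later smoothness checks therefore take place in a single chart.\<close>

lemma smooth_fun_near_chart_iff:
  assumes c: "c \<in> A" and p: "p \<in> fst c"
  shows "smooth_fun_near A p f \<longleftrightarrow>
    (\<exists>T. open T \<and> snd c p \<in> T \<and> smooth_on T (f \<circ> cinv c))"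
proof
  assume "smooth_fun_near A p f"
  then obtain W where "p \<in> W" "smooth_fun A W f" by (auto simp: smooth_fun_near_def)
  then show "\<exists>T. open T \<and> snd c p \<in> T \<and> smooth_on T (f \<circ> cinv c)"
    using c p open_chart_image by (intro exI[of _ "snd c ` (fst c \<inter> W)"]) (auto simp: smooth_fun_iff)
next
  assume "\<exists>T. open T \<and> snd c p \<in> T \<and> smooth_on T (f \<circ> cinv c)"
  then obtain T where T: "open T" "snd c p \<in> T" "smooth_on T (f \<circ> cinv c)" by blast
  define W where "W = fst c \<inter> snd c -` T"
  have "open W" unfolding W_def by (rule open_chart_vimage[OF c T(1)])
  moreover have "smooth_on (snd d ` (fst d \<inter> W)) (f \<circ> cinv d)" if d: "d \<in> A" for d
  proof (rule smooth_on_cong[where f = "\<lambda>x. (f \<circ> cinv c) ((snd c \<circ> cinv d) x)"])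
    show o: "open (snd d ` (fst d \<inter> W))" using open_chart_image[OF d \<open>open W\<close>] .
    show "smooth_on (snd d ` (fst d \<inter> W)) (\<lambda>x. (f \<circ> cinv c) ((snd c \<circ> cinv d) x))"
    proof (rule smooth_on_compose[OF o T(1) _ T(3)])
      show "smooth_on (snd d ` (fst d \<inter> W)) (snd c \<circ> cinv d)"
        by (rule smooth_on_subset[OF transition_smooth[OF d c]]) (auto simp: W_def)
    qed (use c d in \<open>auto simp: W_def\<close>)
  qed (use c d in \<open>auto simp: W_def\<close>)
  ultimately have "smooth_fun A W f" by (simp add: smooth_fun_iff)
  moreover have "p \<in> W" using p T by (simp add: W_def)
  ultimately show "smooth_fun_near A p f" unfolding smooth_fun_near_def by (intro exI[of _ W] conjI)
qed

lemma smooth_fun_near_chartE: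
  assumes "smooth_fun_near A p f" "c \<in> A" "p \<in> fst c"
  obtains T where "open T" "snd c p \<in> T" "smooth_on T (f \<circ> cinv c)"
  using assms smooth_fun_near_chart_iff by metis

lemma smooth_fun_imp_near: "smooth_fun A W f \<Longrightarrow> p \<in> W \<Longrightarrow> smooth_fun_near A p f"
  by (auto simp: smooth_fun_near_def)

lemma smooth_fun_localI:
  assumes "open W" "\<And>p. p \<in> W \<Longrightarrow> smooth_fun_near A p f"
  shows "smooth_fun A W f"
  unfolding smooth_fun_iff
proof (intro conjI ballI assms(1))
  fix c assume c: "c \<in> A"
  have o: "open (snd c ` (fst c \<inter> W))" by (rule open_chart_image[OF c assms(1)])
  then show "smooth_on (snd c ` (fst c \<inter> W)) (f \<circ> cinv c)"
  proof (rule smooth_on_local)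
    fix x assume x: "x \<in> snd c ` (fst c \<inter> W)"
    then obtain p where p: "p \<in> fst c" "p \<in> W" "x = snd c p" by blast
    then obtain T where "open T" "x \<in> T" "smooth_on T (f \<circ> cinv c)"
      using smooth_fun_near_chartE[OF assms(2) c] by metis
    then show "\<exists>T. open T \<and> x \<in> T \<and> T \<subseteq> snd c ` (fst c \<inter> W) \<and> smooth_on T (f \<circ> cinv c)"
      using x o by (intro exI[of _ "T \<inter> snd c ` (fst c \<inter> W)"]) (auto intro: smooth_on_subset)
  qed
qed

lemma smooth_fun_subset: "smooth_fun A W f \<Longrightarrow> open V \<Longrightarrow> V \<subseteq> W \<Longrightarrow> smooth_fun A V f"
  using smooth_fun_imp_near smooth_fun_localI subsetD by metis

lemma eventually_smooth_fun_near:
  "smooth_fun_near A p f \<Longrightarrow> \<forall>\<^sub>F q in nhds p. smooth_fun_near A q f"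
  unfolding eventually_nhds smooth_fun_near_def by (metis smooth_fun_iff)

lemma smooth_fun_near_cong:
  assumes "\<forall>\<^sub>F q in nhds p. f q = h q" "smooth_fun_near A p f"
  shows "smooth_fun_near A p h"
proof -
  obtain c where c: "c \<in> A" "p \<in> fst c" using ex_chart by blast
  obtain T where T: "open T" "snd c p \<in> T" "smooth_on T (f \<circ> cinv c)"
    by (rule smooth_fun_near_chartE[OF assms(2) c])
  have "\<forall>\<^sub>F x in nhds (snd c p). f (cinv c x) = h (cinv c x)"
    using assms(1) eventually_chart_iff[OF c, of "\<lambda>q. f q = h q"] by blast
  then obtain T' where T': "open T'" "snd c p \<in> T'" "\<And>x. x \<in> T' \<Longrightarrow> f (cinv c x) = h (cinv c x)"
    unfolding eventually_nhds by blast
  have "smooth_on (T \<inter> T') (h \<circ> cinv c)"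
    by (rule smooth_on_cong[OF _ _ smooth_on_subset[OF T(3)]]) (use T T' in auto)
  then show ?thesis
    unfolding smooth_fun_near_chart_iff[OF c] using T T' by (intro exI[of _ "T \<inter> T'"]) auto
qed

lemma smooth_fun_near_cong_iff:
  "\<forall>\<^sub>F q in nhds p. f q = h q \<Longrightarrow> smooth_fun_near A p f \<longleftrightarrow> smooth_fun_near A p h"
  using smooth_fun_near_cong[of f h p] smooth_fun_near_cong[of h f p]
  by (auto simp: eq_commute)

lemma smooth_fun_near_const: "smooth_fun_near A p (\<lambda>q. a)"
proof -
  obtain c where c: "c \<in> A" "p \<in> fst c" using ex_chart by blast
  show ?thesis unfolding smooth_fun_near_chart_iff[OF c]
    by (intro exI[of _ UNIV]) (auto simp: o_def smooth_on_const)
qed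

lemma smooth_fun_near_add:
  assumes "smooth_fun_near A p f" "smooth_fun_near A p h"
  shows "smooth_fun_near A p (\<lambda>q. f q + h q)"
proof -
  obtain c where c: "c \<in> A" "p \<in> fst c" using ex_chart by blast
  obtain T where T: "open T" "snd c p \<in> T" "smooth_on T (f \<circ> cinv c)"
    by (rule smooth_fun_near_chartE[OF assms(1) c])
  obtain T' where T': "open T'" "snd c p \<in> T'" "smooth_on T' (h \<circ> cinv c)"
    by (rule smooth_fun_near_chartE[OF assms(2) c])
  from T T' have "smooth_on (T \<inter> T') (\<lambda>x. (f \<circ> cinv c) x + (h \<circ> cinv c) x)"
    by (intro smooth_on_add smooth_on_subset[OF T(3)] smooth_on_subset[OF T'(3)] open_Int) auto
  then show ?thesis
    unfolding smooth_fun_near_chart_iff[OF c] using T T'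
    by (intro exI[of _ "T \<inter> T'"]) (auto simp: o_def)
qed

lemma smooth_fun_near_mult:
  assumes "smooth_fun_near A p f" "smooth_fun_near A p h"
  shows "smooth_fun_near A p (\<lambda>q. f q * h q)"
proof -
  obtain c where c: "c \<in> A" "p \<in> fst c" using ex_chart by blast
  obtain T where T: "open T" "snd c p \<in> T" "smooth_on T (f \<circ> cinv c)"
    by (rule smooth_fun_near_chartE[OF assms(1) c])
  obtain T' where T': "open T'" "snd c p \<in> T'" "smooth_on T' (h \<circ> cinv c)"
    by (rule smooth_fun_near_chartE[OF assms(2) c])
  from T T' have "smooth_on (T \<inter> T') (\<lambda>x. (f \<circ> cinv c) x * (h \<circ> cinv c) x)"
    by (intro smooth_on_mult smooth_on_subset[OF T(3)] smooth_on_subset[OF T'(3)] open_Int) auto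
  then show ?thesis
    unfolding smooth_fun_near_chart_iff[OF c] using T T'
    by (intro exI[of _ "T \<inter> T'"]) (auto simp: o_def)
qed

lemma smooth_fun_near_uminus: "smooth_fun_near A p f \<Longrightarrow> smooth_fun_near A p (\<lambda>q. - f q)"
  using smooth_fun_near_mult[OF smooth_fun_near_const[of p "-1"]] by fastforce

lemma smooth_fun_near_diff:
  "smooth_fun_near A p f \<Longrightarrow> smooth_fun_near A p h \<Longrightarrow> smooth_fun_near A p (\<lambda>q. f q - h q)"
  using smooth_fun_near_add[OF _ smooth_fun_near_uminus] by fastforce

lemma smooth_fun_near_sum:
  "(\<And>i. i \<in> I \<Longrightarrow> smooth_fun_near A p (f i)) \<Longrightarrow> smooth_fun_near A p (\<lambda>q. \<Sum>i\<in>I. f i q)"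
  by (induction I rule: infinite_finite_induct) (auto intro: smooth_fun_near_const smooth_fun_near_add)

lemma smooth_fun_near_has_derivative:
  assumes "c \<in> A" "p \<in> fst c" "smooth_fun_near A p f"
  shows "((f \<circ> cinv c) has_derivative frechet_derivative (f \<circ> cinv c) (at (snd c p))) (at (snd c p))"
  by (rule smooth_fun_near_chartE[OF assms(3,1,2)]) (rule smooth_on_has_derivative)

lemma smooth_fun_near_imp_isCont:
  assumes "smooth_fun_near A p f" shows "filterlim f (nhds (f p)) (nhds p)"
proof -
  obtain c where c: "c \<in> A" "p \<in> fst c" using ex_chart by blast
  have "isCont (f \<circ> cinv c) (snd c p)"
    using smooth_fun_near_has_derivative[OF c assms] has_derivative_continuous by blast
  then have "filterlim (f \<circ> cinv c) (nhds (f p)) (nhds (snd c p))"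
    using isCont_imp_filterlim_nhds c by fastforce
  then have lim: "filterlim (\<lambda>q. (f \<circ> cinv c) (snd c q)) (nhds (f p)) (nhds p)"
    using filterlim_chart[OF c] by (rule filterlim_compose)
  have "\<forall>\<^sub>F q in nhds p. (f \<circ> cinv c) (snd c q) = f q"
    using eventually_in_chart[OF c] by eventually_elim (simp add: c)
  from filterlim_cong[OF refl refl this] lim show ?thesis by (rule iffD1)
qed

lemma smooth_fun_near_inverse:
  assumes "smooth_fun_near A p f" "f p \<noteq> 0"
  shows "smooth_fun_near A p (\<lambda>q. inverse (f q))"
proof -
  obtain c where c: "c \<in> A" "p \<in> fst c" using ex_chart by blast
  obtain T where T: "open T" "snd c p \<in> T" "smooth_on T (f \<circ> cinv c)"
    by (rule smooth_fun_near_chartE[OF assms(1) c])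
  define T' where "T' = T \<inter> (f \<circ> cinv c) -` (- {0})"
  have "open T'" unfolding T'_def
    using T smooth_on_imp_continuous_on continuous_open_preimage by (metis open_Compl closed_singleton)
  moreover have "smooth_on T' (\<lambda>x. inverse ((f \<circ> cinv c) x))"
    by (rule smooth_on_inverse[OF \<open>open T'\<close> _ smooth_on_subset[OF T(3)]]) (auto simp: T'_def)
  ultimately show ?thesis
    unfolding smooth_fun_near_chart_iff[OF c] using T assms(2) c
    by (intro exI[of _ T']) (auto simp: T'_def o_def)
qed

lemma smooth_fun_near_coordinate:
  assumes c: "c \<in> A" "p \<in> fst c" shows "smooth_fun_near A p (\<lambda>q. snd c q \<bullet> b)"
  unfolding smooth_fun_near_chart_iff[OF c]
proof (intro exI conjI)
  show "open (snd c ` fst c)" using open_chart_range c by blast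
  show "smooth_on (snd c ` fst c) ((\<lambda>q. snd c q \<bullet> b) \<circ> cinv c)"
    by (rule smooth_on_cong[OF _ _ smooth_on_bounded_linear[OF _ bounded_linear_inner_left]])
       (use c open_chart_range in auto)
qed (use c in auto)

subsection \<open>Tangent vectors\<close>

lemma chart_vec_apply:
  "smooth_fun_near A p f \<Longrightarrow>
    chart_vec A c p u f = frechet_derivative (f \<circ> cinv c) (at (snd c p)) u"
  by (simp add: chart_vec_def)

lemma chart_vec_eqI:
  assumes "c \<in> A" "p \<in> fst c" "smooth_fun_near A p f" "((f \<circ> cinv c) has_derivative L) (at (snd c p))"
  shows "chart_vec A c p u f = L u"
  using assms(3) frechet_derivative_at[OF assms(4)] by (simp add: chart_vec_apply)

lemma chart_vec_coordinate:
  assumes "c \<in> A" "p \<in> fst c" shows "chart_vec A c p u (\<lambda>q. snd c q \<bullet> b) = u \<bullet> b"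
proof (rule chart_vec_eqI[OF assms smooth_fun_near_coordinate[OF assms]])
  show "(((\<lambda>q. snd c q \<bullet> b) \<circ> cinv c) has_derivative (\<lambda>u. u \<bullet> b)) (at (snd c p))"
    by (rule has_derivative_transform_within_open[OF bounded_linear_imp_has_derivative[OF bounded_linear_inner_left]
        open_chart_range[OF assms(1)]]) (use assms in auto)
qed

lemma linear_chart_vec:
  assumes "c \<in> A" "p \<in> fst c" shows "linear (chart_vec A c p)"
proof -
  have "linear (frechet_derivative (f \<circ> cinv c) (at (snd c p)))" if "smooth_fun_near A p f" for f
    using smooth_fun_near_has_derivative[OF assms that] has_derivative_linear by blast
  then show ?thesis
    by (intro linearI ext) (auto simp: chart_vec_def linear_add linear_scale scaleR_fun_def)
qed

text \<open>One chain rule for two uses: with \<open>i\<close> the identity it compares two charts,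
  and with \<open>i\<close> an immersion it computes the differential in coordinates.\<close>

lemma frechet_derivative_through_chart:
  assumes d: "d \<in> A" "i (k x) \<in> fst d" and f: "smooth_fun_near A (i (k x)) f"
    and L: "((snd d \<circ> i \<circ> k) has_derivative L) (at x)"
    and ev: "\<forall>\<^sub>F y in nhds x. i (k y) \<in> fst d"
  shows "((f \<circ> i \<circ> k) has_derivative
    (\<lambda>u. frechet_derivative (f \<circ> cinv d) (at (snd d (i (k x)))) (L u))) (at x)"
proof -
  obtain T where T: "open T" "x \<in> T" "\<And>y. y \<in> T \<Longrightarrow> i (k y) \<in> fst d"
    using ev unfolding eventually_nhds by blast
  have "((f \<circ> cinv d) \<circ> (snd d \<circ> i \<circ> k) has_derivative
     (frechet_derivative (f \<circ> cinv d) (at (snd d (i (k x)))) \<circ> L)) (at x)"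
    by (rule diff_chain_at[OF L]) (simp add: smooth_fun_near_has_derivative[OF d f])
  then have "((f \<circ> i \<circ> k) has_derivative
     (frechet_derivative (f \<circ> cinv d) (at (snd d (i (k x)))) \<circ> L)) (at x)"
    by (rule has_derivative_transform_within_open[OF _ T(1,2)]) (use T d in auto)
  then show ?thesis by (simp add: o_def)
qed

lemma chart_vec_change:
  assumes c: "c \<in> A" "p \<in> fst c" and d: "d \<in> A" "p \<in> fst d"
  shows "chart_vec A c p u =
    chart_vec A d p (frechet_derivative (snd d \<circ> cinv c) (at (snd c p)) u)"
proof
  fix f
  let ?L = "frechet_derivative (snd d \<circ> cinv c) (at (snd c p))"
  have L: "((snd d \<circ> cinv c) has_derivative ?L) (at (snd c p))"
    by (rule smooth_on_has_derivative[OF open_chart_image transition_smooth])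
       (use c d open_chart_domain in auto)
  have ev: "\<forall>\<^sub>F x in nhds (snd c p). cinv c x \<in> fst d"
    using eventually_in_chart[OF d] eventually_chart_iff[OF c, of "\<lambda>q. q \<in> fst d"] by blast
  show "chart_vec A c p u f = chart_vec A d p (?L u) f"
  proof (cases "smooth_fun_near A p f")
    case True
    have "((f \<circ> cinv c) has_derivative
        (\<lambda>u. frechet_derivative (f \<circ> cinv d) (at (snd d p)) (?L u))) (at (snd c p))"
      using frechet_derivative_through_chart[of d id "cinv c" "snd c p" f ?L] c d L ev True
      by (simp add: o_def)
    from chart_vec_eqI[OF c True this] show ?thesis
      by (simp add: chart_vec_apply True)
  qed (simp add: chart_vec_def)
qed

lemma chart_vec_in_tangent_space: "c \<in> A \<Longrightarrow> p \<in> fst c \<Longrightarrow> chart_vec A c p u \<in> tangent_space A p"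
  using tangent_space_def by blast

lemma tangent_space_eq_range:
  assumes c: "c \<in> A" "p \<in> fst c" shows "tangent_space A p = range (chart_vec A c p)"
proof -
  have "chart_vec A d p u \<in> range (chart_vec A c p)" if "d \<in> A" "p \<in> fst d" for d u
    using chart_vec_change[OF that c] by auto
  then have "tangent_space A p \<subseteq> range (chart_vec A c p)" unfolding tangent_space_def by blast
  moreover have "range (chart_vec A c p) \<subseteq> tangent_space A p"
    using chart_vec_in_tangent_space[OF c] by blast
  ultimately show ?thesis by blast
qed

lemma tangent_vector_coordinates:
  assumes c: "c \<in> A" "p \<in> fst c" and v: "v \<in> tangent_space A p"
  shows "v = chart_vec A c p (\<Sum>b\<in>Basis. v (\<lambda>q. snd c q \<bullet> b) *\<^sub>R b)"
proof -
  obtain u where u: "v = chart_vec A c p u" using v tangent_space_eq_range[OF c] by auto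
  show ?thesis
    by (simp add: u chart_vec_coordinate[OF c] euclidean_representation)
qed

lemma inj_chart_vec:
  assumes "c \<in> A" "p \<in> fst c" shows "inj (chart_vec A c p)"
proof (rule injI)
  fix u v assume "chart_vec A c p u = chart_vec A c p v"
  then show "u = v" using chart_vec_coordinate[OF assms] euclidean_eqI by metis
qed

lemma subspace_tangent_space: "subspace (tangent_space A p)"
proof -
  obtain c where c: "c \<in> A" "p \<in> fst c" using ex_chart by blast
  show ?thesis
    using tangent_space_eq_range[OF c] linear_subspace_image[OF linear_chart_vec[OF c] subspace_UNIV] by simp
qed

lemma tangent_space_closed:
  shows tangent_space_add: "u \<in> tangent_space A p \<Longrightarrow> v \<in> tangent_space A p \<Longrightarrow> u + v \<in> tangent_space A p"
    and tangent_space_diff: "u \<in> tangent_space A p \<Longrightarrow> v \<in> tangent_space A p \<Longrightarrow> u - v \<in> tangent_space A p"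
    and tangent_space_scale: "u \<in> tangent_space A p \<Longrightarrow> a *\<^sub>R u \<in> tangent_space A p"
    and tangent_space_zero: "0 \<in> tangent_space A p"
  using subspace_tangent_space[of p] subspace_add subspace_diff subspace_scale subspace_0 by blast+

lemma tangent_vector_not_smooth: "v \<in> tangent_space A p \<Longrightarrow> \<not> smooth_fun_near A p f \<Longrightarrow> v f = 0"
  by (auto simp: tangent_space_def chart_vec_def)

text \<open>Smoothness near \<open>p\<close> is itself a property of the germ, and outside the
  smooth germs both sides take the default value 0. So equality of germs is enough, and later uses
  need not prove smoothness first.\<close>

lemma tangent_vector_cong:
  assumes v: "v \<in> tangent_space A p" and ev: "\<forall>\<^sub>F q in nhds p. f q = h q"
  shows "v f = v h"
proof (cases "smooth_fun_near A p f")
  case True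
  obtain c where c: "c \<in> A" "p \<in> fst c" using ex_chart by blast
  obtain u where u: "v = chart_vec A c p u" using v tangent_space_eq_range[OF c] by auto
  have h: "smooth_fun_near A p h" using smooth_fun_near_cong[OF ev True] .
  have "\<forall>\<^sub>F x in nhds (snd c p). f (cinv c x) = h (cinv c x)"
    using ev eventually_chart_iff[OF c, of "\<lambda>q. f q = h q"] by blast
  then obtain T where T: "open T" "snd c p \<in> T" "\<And>x. x \<in> T \<Longrightarrow> f (cinv c x) = h (cinv c x)"
    unfolding eventually_nhds by blast
  have "((h \<circ> cinv c) has_derivative frechet_derivative (f \<circ> cinv c) (at (snd c p))) (at (snd c p))"
    by (rule has_derivative_transform_within_open[OF smooth_fun_near_has_derivative[OF c True] T(1,2)])
       (use T in auto)
  then show ?thesis unfolding u using chart_vec_eqI[OF c h] chart_vec_apply[OF True] by metis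
next
  case False
  then show ?thesis using assms smooth_fun_near_cong_iff tangent_vector_not_smooth by metis
qed

lemma tangent_vector_const:
  assumes v: "v \<in> tangent_space A p" shows "v (\<lambda>q. a) = 0"
proof -
  obtain c where c: "c \<in> A" "p \<in> fst c" using ex_chart by blast
  obtain u where u: "v = chart_vec A c p u" using v tangent_space_eq_range[OF c] by auto
  show ?thesis unfolding u
    by (rule chart_vec_eqI[OF c smooth_fun_near_const]) (simp add: o_def)
qed

lemma tangent_vector_const_near:
  assumes "v \<in> tangent_space A p" "\<forall>\<^sub>F q in nhds p. f q = a" shows "v f = 0"
  using tangent_vector_cong[OF assms] tangent_vector_const[OF assms(1)] by simp

lemma tangent_vector_add:
  assumes v: "v \<in> tangent_space A p" and f: "smooth_fun_near A p f" and h: "smooth_fun_near A p h"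
  shows "v (\<lambda>q. f q + h q) = v f + v h"
proof -
  obtain c where c: "c \<in> A" "p \<in> fst c" using ex_chart by blast
  obtain u where u: "v = chart_vec A c p u" using v tangent_space_eq_range[OF c] by auto
  show ?thesis unfolding u chart_vec_apply[OF f] chart_vec_apply[OF h]
    by (rule chart_vec_eqI[OF c smooth_fun_near_add[OF f h]])
       (use has_derivative_add[OF smooth_fun_near_has_derivative[OF c f] smooth_fun_near_has_derivative[OF c h]]
         in \<open>simp add: o_def\<close>)
qed

lemma tangent_vector_mult:
  assumes v: "v \<in> tangent_space A p" and f: "smooth_fun_near A p f" and h: "smooth_fun_near A p h"
  shows "v (\<lambda>q. f q * h q) = f p * v h + v f * h p"
proof -
  obtain c where c: "c \<in> A" "p \<in> fst c" using ex_chart by blast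
  obtain u where u: "v = chart_vec A c p u" using v tangent_space_eq_range[OF c] by auto
  show ?thesis unfolding u chart_vec_apply[OF f] chart_vec_apply[OF h]
    by (rule chart_vec_eqI[OF c smooth_fun_near_mult[OF f h]])
       (use has_derivative_mult[OF smooth_fun_near_has_derivative[OF c f] smooth_fun_near_has_derivative[OF c h]]
         in \<open>simp add: o_def c\<close>)
qed

lemma tangent_vector_diff:
  assumes v: "v \<in> tangent_space A p" and f: "smooth_fun_near A p f" and h: "smooth_fun_near A p h"
  shows "v (\<lambda>q. f q - h q) = v f - v h"
  using tangent_vector_add[OF v smooth_fun_near_diff[OF f h] h] by simp

subsection \<open>Vector fields\<close>

lemma smooth_field_imp_near: "smooth_field A W X \<Longrightarrow> p \<in> W \<Longrightarrow> smooth_field_near A p X"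
  by (auto simp: smooth_field_near_def)

lemma smooth_field_subset: "smooth_field A W X \<Longrightarrow> open V \<Longrightarrow> V \<subseteq> W \<Longrightarrow> smooth_field A V X"
  unfolding smooth_field_def by (meson subset_iff)

lemma smooth_field_near_tangent:
  "smooth_field_near A p X \<Longrightarrow> \<forall>\<^sub>F q in nhds p. X q \<in> tangent_space A q"
  unfolding smooth_field_near_def smooth_field_def eventually_nhds by blast

lemma smooth_field_near_tangent_at: "smooth_field_near A p X \<Longrightarrow> X p \<in> tangent_space A p"
  unfolding smooth_field_near_def smooth_field_def by blast

lemma smooth_field_near_apply:
  assumes "smooth_field_near A p X" "smooth_fun_near A p f"
  shows "smooth_fun_near A p (\<lambda>q. X q f)"
proof -
  obtain W V where W: "p \<in> W" "smooth_field A W X" "p \<in> V" "smooth_fun A V f"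
    using assms unfolding smooth_field_near_def smooth_fun_near_def by metis
  then have "open (V \<inter> W)" by (auto simp: smooth_fun_iff smooth_field_def)
  then have "smooth_fun A (V \<inter> W) f" using smooth_fun_subset[OF W(4)] by blast
  then have "smooth_fun A (V \<inter> W) (\<lambda>q. X q f)" using W(2) unfolding smooth_field_def by blast
  then show ?thesis using W smooth_fun_imp_near by blast
qed

lemma smooth_field_near_coordinates:
  assumes "smooth_field_near A p X" "c \<in> A" "p \<in> fst c"
  shows "\<forall>\<^sub>F q in nhds p. X q = chart_vec A c q (\<Sum>b\<in>Basis. X q (\<lambda>x. snd c x \<bullet> b) *\<^sub>R b)"
  using smooth_field_near_tangent[OF assms(1)] eventually_in_chart[OF assms(2,3)]
  by eventually_elim (rule tangent_vector_coordinates[OF assms(2)])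

text \<open>Smoothness of a field is defined by testing against all smooth functions. In a chart the
  test \<open>X q f\<close> is the sum of the coefficients times the partial derivatives of
  \<open>f\<close>, so smooth coefficients suffice; this is how fields get constructed.\<close>

lemma smooth_field_nearI:
  assumes c: "c \<in> A" "p \<in> fst c"
    and h: "\<And>b. b \<in> Basis \<Longrightarrow> smooth_fun_near A p (h b)"
    and X: "\<forall>\<^sub>F q in nhds p. X q = chart_vec A c q (\<Sum>b\<in>Basis. h b q *\<^sub>R b)"
  shows "smooth_field_near A p X"
proof -
  have "\<forall>\<^sub>F q in nhds p. \<forall>b\<in>Basis. smooth_fun_near A q (h b)"
    using h eventually_smooth_fun_near by (intro eventually_ball_finite) auto
  with X eventually_in_chart[OF c] have "\<forall>\<^sub>F q in nhds p. q \<in> fst c \<and>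
      X q = chart_vec A c q (\<Sum>b\<in>Basis. h b q *\<^sub>R b) \<and> (\<forall>b\<in>Basis. smooth_fun_near A q (h b))"
    by eventually_elim auto
  then obtain W where W: "open W" "p \<in> W" "W \<subseteq> fst c"
    "\<And>q. q \<in> W \<Longrightarrow> X q = chart_vec A c q (\<Sum>b\<in>Basis. h b q *\<^sub>R b)"
    "\<And>q b. q \<in> W \<Longrightarrow> b \<in> Basis \<Longrightarrow> smooth_fun_near A q (h b)"
    unfolding eventually_nhds by blast
  have "smooth_field A W X"
    unfolding smooth_field_def
  proof (intro conjI ballI allI impI W(1))
    show "X q \<in> tangent_space A q" if "q \<in> W" for q
      using W that chart_vec_in_tangent_space c by (metis subset_iff)
  next
    fix V f assume V: "V \<subseteq> W \<and> smooth_fun A V f"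
    show "smooth_fun A V (\<lambda>q. X q f)"
    proof (rule smooth_fun_localI)
      show "open V" using V smooth_fun_def by blast
      fix q assume q: "q \<in> V"
      have qc: "q \<in> fst c" "q \<in> W" using V W q by auto
      define F where "F = (\<lambda>b r. frechet_derivative (f \<circ> cinv c) (at (snd c r)) b)"
      obtain T where T: "open T" "snd c q \<in> T" "smooth_on T (f \<circ> cinv c)"
        using V q smooth_fun_imp_near smooth_fun_near_chartE[OF _ c(1) qc(1)] by metis
      have F: "smooth_fun_near A q (F b)" for b
        unfolding smooth_fun_near_chart_iff[OF c(1) qc(1)]
      proof (intro exI conjI)
        show "open (T \<inter> snd c ` fst c)" using T open_chart_range c by blast
        show "smooth_on (T \<inter> snd c ` fst c) (F b \<circ> cinv c)"
          by (rule smooth_on_cong[OF _ _ smooth_on_subset[OF smooth_on_frechet_derivative[OF T(3)]]])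
             (use T open_chart_range c in \<open>auto simp: F_def\<close>)
      qed (use T qc in auto)
      have eq: "(\<Sum>b\<in>Basis. h b r * F b r) = X r f" if "r \<in> V" for r
      proof -
        have r: "r \<in> fst c" "r \<in> W" and f: "smooth_fun_near A r f"
          using V W that smooth_fun_imp_near by auto
        have lin: "linear (\<lambda>u. chart_vec A c r u f)"
          using linear_chart_vec[OF c(1) r(1)]
          by (simp add: linear_iff scaleR_fun_def)
        then have "chart_vec A c r (\<Sum>b\<in>Basis. h b r *\<^sub>R b) f = (\<Sum>b\<in>Basis. h b r * chart_vec A c r b f)"
          using linear_sum[OF lin, of "\<lambda>b. h b r *\<^sub>R b" Basis] linear_scale[OF lin] by simp
        then show ?thesis using W(4)[OF r(2)] by (simp add: F_def chart_vec_apply[OF f])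
      qed
      have "smooth_fun_near A q (\<lambda>r. \<Sum>b\<in>Basis. h b r * F b r)"
        by (intro smooth_fun_near_sum smooth_fun_near_mult F W(5) qc)
      then show "smooth_fun_near A q (\<lambda>r. X r f)"
        by (rule smooth_fun_near_cong[rotated])
           (use eq eventually_nhds_in_open[OF \<open>open V\<close> q] in \<open>auto elim: eventually_mono\<close>)
    qed
  qed
  then show ?thesis using W by (auto simp: smooth_field_near_def)
qed

lemma common_domain:
  assumes "smooth_field_near A p X" "smooth_field_near A p Y"
  obtains W where "p \<in> W" "smooth_field A W X" "smooth_field A W Y"
proof -
  obtain W V where W: "p \<in> W" "smooth_field A W X" "p \<in> V" "smooth_field A V Y"
    using assms unfolding smooth_field_near_def by metis
  then have "open (W \<inter> V)" by (auto simp: smooth_field_def)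
  then show ?thesis using W by (intro that[of "W \<inter> V"] smooth_field_subset[OF W(2)] smooth_field_subset[OF W(4)]) auto
qed

lemma smooth_field_near_add:
  assumes X: "smooth_field_near A p X" and Y: "smooth_field_near A p Y"
  shows "smooth_field_near A p (\<lambda>q. X q + Y q)"
proof -
  obtain c where c: "c \<in> A" "p \<in> fst c" using ex_chart by blast
  show ?thesis
  proof (rule smooth_field_nearI[OF c, of "\<lambda>b q. X q (\<lambda>x. snd c x \<bullet> b) + Y q (\<lambda>x. snd c x \<bullet> b)"])
    show "\<forall>\<^sub>F q in nhds p. X q + Y q = chart_vec A c q
        (\<Sum>b\<in>Basis. (X q (\<lambda>x. snd c x \<bullet> b) + Y q (\<lambda>x. snd c x \<bullet> b)) *\<^sub>R b)"
      using smooth_field_near_coordinates[OF X c] smooth_field_near_coordinates[OF Y c] eventually_in_chart[OF c]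
    proof eventually_elim
      case (elim q)
      then show ?case
        by (simp only: scaleR_add_left sum.distrib linear_add[OF linear_chart_vec[OF c(1) elim(3)]])
    qed
  qed (intro smooth_fun_near_add smooth_field_near_apply[OF X] smooth_field_near_apply[OF Y] smooth_fun_near_coordinate c)+
qed

lemma smooth_field_near_scale:
  assumes f: "smooth_fun_near A p f" and X: "smooth_field_near A p X"
  shows "smooth_field_near A p (\<lambda>q. f q *\<^sub>R X q)"
proof -
  obtain c where c: "c \<in> A" "p \<in> fst c" using ex_chart by blast
  show ?thesis
  proof (rule smooth_field_nearI[OF c, of "\<lambda>b q. f q * X q (\<lambda>x. snd c x \<bullet> b)"])
    show "\<forall>\<^sub>F q in nhds p. f q *\<^sub>R X q = chart_vec A c q
        (\<Sum>b\<in>Basis. (f q * X q (\<lambda>x. snd c x \<bullet> b)) *\<^sub>R b)"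
      using smooth_field_near_coordinates[OF X c] eventually_in_chart[OF c]
    proof eventually_elim
      case (elim q)
      then show ?case
        by (simp only: scaleR_scaleR[symmetric] scaleR_sum_right[symmetric]
            linear_scale[OF linear_chart_vec[OF c(1) elim(2)]])
    qed
  qed (intro smooth_fun_near_mult f smooth_field_near_apply[OF X] smooth_fun_near_coordinate c)
qed

lemma smooth_field_near_chart_vec:
  assumes c: "c \<in> A" "p \<in> fst c" shows "smooth_field_near A p (\<lambda>q. chart_vec A c q u)"
  by (rule smooth_field_nearI[OF c, of "\<lambda>b q. u \<bullet> b"])
     (simp_all add: smooth_fun_near_const euclidean_representation)

lemma ex_smooth_field_near:
  assumes "v \<in> tangent_space A p" obtains X where "smooth_field_near A p X" "X p = v"
proof -
  obtain c where c: "c \<in> A" "p \<in> fst c" using ex_chart by blast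
  obtain u where "v = chart_vec A c p u" using assms tangent_space_eq_range[OF c] by auto
  then show ?thesis using that[OF smooth_field_near_chart_vec[OF c]] by simp
qed

end

context smooth_manifold
begin

subsection \<open>Metric tensors and connections\<close>

lemma tensor_sym:
  "symmetric_tensor A g \<Longrightarrow> u \<in> tangent_space A p \<Longrightarrow> v \<in> tangent_space A p \<Longrightarrow> g p u v = g p v u"
  unfolding symmetric_tensor_def by blast

lemma tensor_add_left:
  "symmetric_tensor A g \<Longrightarrow> u \<in> tangent_space A p \<Longrightarrow> v \<in> tangent_space A p \<Longrightarrow> w \<in> tangent_space A p \<Longrightarrow>
    g p (u + v) w = g p u w + g p v w"
  unfolding symmetric_tensor_def by blast

lemma tensor_scale_left:
  "symmetric_tensor A g \<Longrightarrow> u \<in> tangent_space A p \<Longrightarrow> w \<in> tangent_space A p \<Longrightarrow>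
    g p (a *\<^sub>R u) w = a * g p u w"
  unfolding symmetric_tensor_def by blast

lemma tensor_add_right:
  "symmetric_tensor A g \<Longrightarrow> u \<in> tangent_space A p \<Longrightarrow> v \<in> tangent_space A p \<Longrightarrow> w \<in> tangent_space A p \<Longrightarrow>
    g p w (u + v) = g p w u + g p w v"
  by (metis tensor_add_left tensor_sym tangent_space_add)

lemma tensor_scale_right:
  "symmetric_tensor A g \<Longrightarrow> u \<in> tangent_space A p \<Longrightarrow> w \<in> tangent_space A p \<Longrightarrow>
    g p w (a *\<^sub>R u) = a * g p w u"
  by (metis tensor_scale_left tensor_sym tangent_space_scale)

lemma tensor_diff_left:
  "symmetric_tensor A g \<Longrightarrow> u \<in> tangent_space A p \<Longrightarrow> v \<in> tangent_space A p \<Longrightarrow> w \<in> tangent_space A p \<Longrightarrow>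
    g p (u - v) w = g p u w - g p v w"
  using tensor_add_left[of g "u - v" p v w] tangent_space_diff by simp

lemma tensor_zero_left: "symmetric_tensor A g \<Longrightarrow> w \<in> tangent_space A p \<Longrightarrow> g p 0 w = 0"
  using tensor_scale_left[of g 0 p w 0] tangent_space_zero by simp

lemma tensor_zero_right: "symmetric_tensor A g \<Longrightarrow> w \<in> tangent_space A p \<Longrightarrow> g p w 0 = 0"
  using tensor_scale_right[of g 0 p w 0] tangent_space_zero by simp

lemma tensor_smooth:
  assumes "symmetric_tensor A g" "smooth_field_near A p X" "smooth_field_near A p Y"
  shows "smooth_fun_near A p (\<lambda>q. g q (X q) (Y q))"
proof -
  obtain W where W: "p \<in> W" "smooth_field A W X" "smooth_field A W Y"
    using common_domain assms(2,3) .
  then have "smooth_fun A W (\<lambda>p. g p (X p) (Y p))"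
    using assms(1) unfolding symmetric_tensor_def by blast
  then show ?thesis using W(1) smooth_fun_imp_near by blast
qed

lemma levi_civita_tangent:
  "levi_civita A g D \<Longrightarrow> u \<in> tangent_space A p \<Longrightarrow> smooth_field_near A p X \<Longrightarrow> D p u X \<in> tangent_space A p"
  unfolding levi_civita_def affine_connection_def using smooth_fun_near_const by blast

lemma levi_civita_torsion_free:
  "levi_civita A g D \<Longrightarrow> smooth_field_near A p X \<Longrightarrow> smooth_field_near A p Y \<Longrightarrow>
    lie_bracket A X Y p = D p (X p) Y - D p (Y p) X"
  unfolding levi_civita_def by metis

lemma levi_civita_metric:
  "levi_civita A g D \<Longrightarrow> u \<in> tangent_space A p \<Longrightarrow> smooth_field_near A p X \<Longrightarrow> smooth_field_near A p Y \<Longrightarrow>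
    u (\<lambda>q. g q (X q) (Y q)) = g p (D p u X) (Y p) + g p (X p) (D p u Y)"
  unfolding levi_civita_def by blast

lemma levi_civita_smooth:
  assumes "levi_civita A g D" "smooth_field_near A p X" "smooth_field_near A p Y"
  shows "smooth_field_near A p (\<lambda>q. D q (X q) Y)"
proof -
  obtain W where W: "p \<in> W" "smooth_field A W X" "smooth_field A W Y"
    using common_domain assms(2,3) .
  then have "smooth_field A W (\<lambda>p. D p (X p) Y)"
    using assms(1) unfolding levi_civita_def affine_connection_def by blast
  then show ?thesis using W(1) smooth_field_imp_near by blast
qed

lemma lie_bracket_tangent:
  assumes "levi_civita A g D" "smooth_field_near A p X" "smooth_field_near A p Y"
  shows "lie_bracket A X Y p \<in> tangent_space A p"
  unfolding levi_civita_torsion_free[OF assms]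
  by (intro tangent_space_diff levi_civita_tangent[OF assms(1)] smooth_field_near_tangent_at assms)

text \<open>Metric compatibility turns the three derivatives into six terms, vanishing torsion the
  three brackets into six more; all cancel in pairs except two copies of
  \<open>g p (D p (X p) Y) (Z p)\<close>. It is applied both to the ambient metric and to the rigged
  metric.\<close>

lemma koszul:
  assumes lc: "levi_civita A g D" and g: "symmetric_tensor A g"
    and X: "smooth_field_near A p X" and Y: "smooth_field_near A p Y" and Z: "smooth_field_near A p Z"
  shows "2 * g p (D p (X p) Y) (Z p) =
    X p (\<lambda>q. g q (Y q) (Z q)) + Y p (\<lambda>q. g q (X q) (Z q)) - Z p (\<lambda>q. g q (X q) (Y q))
    + g p (lie_bracket A X Y p) (Z p) - g p (lie_bracket A X Z p) (Y p) - g p (lie_bracket A Y Z p) (X p)"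
proof -
  note t = smooth_field_near_tangent_at[OF X] smooth_field_near_tangent_at[OF Y] smooth_field_near_tangent_at[OF Z]
  note c = levi_civita_tangent[OF lc t(1) Y] levi_civita_tangent[OF lc t(1) Z] levi_civita_tangent[OF lc t(2) X]
    levi_civita_tangent[OF lc t(2) Z] levi_civita_tangent[OF lc t(3) X] levi_civita_tangent[OF lc t(3) Y]
  show ?thesis
    unfolding levi_civita_metric[OF lc t(1) Y Z] levi_civita_metric[OF lc t(2) X Z]
      levi_civita_metric[OF lc t(3) X Y] levi_civita_torsion_free[OF lc X Y]
      levi_civita_torsion_free[OF lc X Z] levi_civita_torsion_free[OF lc Y Z]
    using tensor_diff_left[OF g c(1) c(3) t(3)] tensor_diff_left[OF g c(2) c(5) t(2)]
      tensor_diff_left[OF g c(4) c(6) t(1)] tensor_sym[OF g t(2) c(2)] tensor_sym[OF g t(1) c(4)]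
      tensor_sym[OF g t(1) c(6)]
    by simp
qed

end

section \<open>Immersed hypersurfaces\<close>

locale hypersurface_in_manifold = M: smooth_manifold A + L: smooth_manifold B
  for A :: "('m::t2_space, 'e::euclidean_space) chart set"
    and B :: "('l::t2_space, 'f::euclidean_space) chart set" +
  fixes i :: "'l \<Rightarrow> 'm"
  assumes hypersurface: "hypersurface B A i"
begin

abbreviation di :: "'l \<Rightarrow> 'l tvec \<Rightarrow> 'm tvec" where "di \<equiv> differential A i"

lemma continuous_immersion: "continuous_on UNIV i"
  using hypersurface by (simp add: hypersurface_def smooth_map_def)

lemma filterlim_immersion: "filterlim i (nhds (i p)) (nhds p)"
  using continuous_immersion by (intro isCont_imp_filterlim_nhds) (simp add: continuous_on_eq_continuous_at)

lemma eventually_immersion: "\<forall>\<^sub>F m in nhds (i p). P m \<Longrightarrow> \<forall>\<^sub>F q in nhds p. P (i q)"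
  using filterlim_immersion by (rule eventually_compose_filterlim[rotated])

lemma immersion_smooth:
  assumes "c \<in> B" "d \<in> A" shows "smooth_on (snd c ` (fst c \<inter> i -` fst d)) (snd d \<circ> i \<circ> cinv c)"
proof -
  have "\<forall>(U, \<phi>)\<in>B. \<forall>(V, \<psi>)\<in>A. smooth_on (\<phi> ` (U \<inter> i -` V)) (\<psi> \<circ> i \<circ> inv_into U \<phi>)"
    using hypersurface by (simp add: hypersurface_def smooth_map_def)
  from bspec[OF this assms(1)] assms(2) show ?thesis by (auto simp: case_prod_unfold)
qed

lemma open_immersion_domain:
  assumes "c \<in> B" "d \<in> A" shows "open (snd c ` (fst c \<inter> i -` fst d))"
  using L.open_chart_image[OF assms(1)] open_vimage[OF M.open_chart_domain[OF assms(2)] continuous_immersion] .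

lemma immersion_has_derivative:
  assumes c: "c \<in> B" "p \<in> fst c" and d: "d \<in> A" "i p \<in> fst d"
  shows "((snd d \<circ> i \<circ> cinv c) has_derivative
    frechet_derivative (snd d \<circ> i \<circ> cinv c) (at (snd c p))) (at (snd c p))"
  by (rule smooth_on_has_derivative[OF open_immersion_domain[OF c(1) d(1)] immersion_smooth[OF c(1) d(1)]])
     (use assms in auto)

lemma smooth_fun_near_pullback:
  assumes f: "smooth_fun_near A (i p) f" shows "smooth_fun_near B p (f \<circ> i)"
proof -
  obtain c where c: "c \<in> B" "p \<in> fst c" using L.ex_chart by blast
  obtain d where d: "d \<in> A" "i p \<in> fst d" using M.ex_chart by blast
  obtain T where T: "open T" "snd d (i p) \<in> T" "smooth_on T (f \<circ> cinv d)"
    by (rule M.smooth_fun_near_chartE[OF f d])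
  let ?F = "snd d \<circ> i \<circ> cinv c" and ?S = "snd c ` (fst c \<inter> i -` fst d)"
  define S where "S = ?S \<inter> ?F -` T"
  have o: "open S" unfolding S_def
    by (rule continuous_open_preimage[OF smooth_on_imp_continuous_on[OF immersion_smooth[OF c(1) d(1)]]
        open_immersion_domain[OF c(1) d(1)] T(1)])
  have "smooth_on S (\<lambda>x. (f \<circ> cinv d) (?F x))"
    by (rule smooth_on_compose[OF o T(1) smooth_on_subset[OF immersion_smooth[OF c(1) d(1)]] T(3)])
       (auto simp: S_def)
  then have "smooth_on S (f \<circ> i \<circ> cinv c)"
    by (rule smooth_on_cong[OF o, rotated]) (use c d in \<open>auto simp: S_def\<close>)
  moreover have "snd c p \<in> S" using c d T by (auto simp: S_def)
  ultimately show ?thesis unfolding L.smooth_fun_near_chart_iff[OF c] using o by blast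
qed

section \<open>The differential of the immersion and vectors transversal to it\<close>

lemma differential_apply: "smooth_fun_near A (i p) f \<Longrightarrow> di p u f = u (f \<circ> i)"
  by (simp add: differential_def)

lemma differential_add: "di p (u + v) = di p u + di p v"
  by (auto simp: differential_def)

lemma differential_scale: "di p (a *\<^sub>R u) = a *\<^sub>R di p u"
  by (auto simp: differential_def scaleR_fun_def)

lemma differential_zero [simp]: "di p 0 = 0"
  by (auto simp: differential_def)

lemma differential_chart_vec:
  assumes c: "c \<in> B" "p \<in> fst c" and d: "d \<in> A" "i p \<in> fst d"
  shows "di p (chart_vec B c p u) =
    chart_vec A d (i p) (frechet_derivative (snd d \<circ> i \<circ> cinv c) (at (snd c p)) u)"
proof
  fix f
  show "di p (chart_vec B c p u) f =
    chart_vec A d (i p) (frechet_derivative (snd d \<circ> i \<circ> cinv c) (at (snd c p)) u) f"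
  proof (cases "smooth_fun_near A (i p) f")
    case True
    have "\<forall>\<^sub>F x in nhds (snd c p). i (cinv c x) \<in> fst d"
      using eventually_immersion[OF M.eventually_in_chart[OF d]]
        L.eventually_chart_iff[OF c, of "\<lambda>q. i q \<in> fst d"] by blast
    then have "((f \<circ> i \<circ> cinv c) has_derivative
        (\<lambda>u. frechet_derivative (f \<circ> cinv d) (at (snd d (i p)))
          (frechet_derivative (snd d \<circ> i \<circ> cinv c) (at (snd c p)) u))) (at (snd c p))"
      using M.frechet_derivative_through_chart[of d i "cinv c" "snd c p" f]
        immersion_has_derivative[OF c d] c d True by simp
    from L.chart_vec_eqI[OF c smooth_fun_near_pullback[OF True] this, of u]
    show ?thesis using True by (simp add: differential_def M.chart_vec_apply)
  qed (simp add: differential_def chart_vec_def)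
qed

lemma differential_tangent: "u \<in> tangent_space B p \<Longrightarrow> di p u \<in> tangent_space A (i p)"
proof -
  assume u: "u \<in> tangent_space B p"
  obtain c where c: "c \<in> B" "p \<in> fst c" using L.ex_chart by blast
  obtain d where d: "d \<in> A" "i p \<in> fst d" using M.ex_chart by blast
  obtain x where "u = chart_vec B c p x" using u L.tangent_space_eq_range[OF c] by blast
  then show ?thesis using differential_chart_vec[OF c d] M.chart_vec_in_tangent_space[OF d] by simp
qed

lemma differential_eq_0_iff: "u \<in> tangent_space B p \<Longrightarrow> di p u = 0 \<longleftrightarrow> u = 0"
proof -
  assume u: "u \<in> tangent_space B p"
  have "inj_on (di p) (tangent_space B p)" using hypersurface by (simp add: hypersurface_def)
  then show ?thesis using u L.tangent_space_zero[of p] by (metis differential_zero inj_onD)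
qed

lemma immersion_derivative_eq_0:
  assumes c: "c \<in> B" "p \<in> fst c" and d: "d \<in> A" "i p \<in> fst d"
    and "frechet_derivative (snd d \<circ> i \<circ> cinv c) (at (snd c p)) u = 0"
  shows "u = 0"
proof -
  have "di p (chart_vec B c p u) = 0"
    using assms linear_0[OF M.linear_chart_vec[OF d]] by (simp add: differential_chart_vec[OF c d])
  then have "chart_vec B c p u = 0"
    using differential_eq_0_iff L.chart_vec_in_tangent_space[OF c] by blast
  then show ?thesis
    using L.inj_chart_vec[OF c] linear_0[OF L.linear_chart_vec[OF c]] by (metis injD)
qed

text \<open>The derivative of the immersion is injective and \<open>DIM('e) = DIM('f) + 1\<close>,
  so its range is a hyperplane, and any vector outside a hyperplane spans the whole space together
  with it.\<close>

lemma tangent_decomposition: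
  assumes z: "z \<in> tangent_space A (i p)" "z \<notin> di p ` tangent_space B p" and w: "w \<in> tangent_space A (i p)"
  obtains u a where "u \<in> tangent_space B p" "w = di p u + a *\<^sub>R z"
proof -
  obtain c where c: "c \<in> B" "p \<in> fst c" using L.ex_chart by blast
  obtain d where d: "d \<in> A" "i p \<in> fst d" using M.ex_chart by blast
  let ?D = "frechet_derivative (snd d \<circ> i \<circ> cinv c) (at (snd c p))"
  obtain x y where x: "z = chart_vec A d (i p) x" and y: "w = chart_vec A d (i p) y"
    using z w M.tangent_space_eq_range[OF d] by auto
  have lin: "linear ?D" using immersion_has_derivative[OF c d] has_derivative_linear by blast
  have inj: "inj ?D" using immersion_derivative_eq_0[OF c d] lin linear_injective_0 by blast
  have sub: "subspace (range ?D)" using linear_subspace_image[OF lin subspace_UNIV] .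
  have "x \<notin> range ?D"
  proof
    assume "x \<in> range ?D"
    then obtain u where "x = ?D u" by blast
    then have "z = di p (chart_vec B c p u)" using x differential_chart_vec[OF c d] by simp
    then show False using z L.chart_vec_in_tangent_space[OF c] by blast
  qed
  then have "dim (insert x (range ?D)) = DIM('e)"
    using dim_insert[of x "range ?D"] span_eq_iff[THEN iffD2, OF sub]
      dim_image_eq[OF lin, of UNIV] inj hypersurface by (simp add: hypersurface_def)
  then have "span (insert x (range ?D)) = UNIV" by (simp add: dim_eq_full)
  then have "y \<in> span (insert x (range ?D))" by simp
  then obtain a where "y - a *\<^sub>R x \<in> range ?D"
    using span_breakdown_eq[of y x "range ?D"] span_eq_iff[THEN iffD2, OF sub] by auto
  then obtain u where "y - a *\<^sub>R x = ?D u" by blast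
  then have "y = ?D u + a *\<^sub>R x" by (simp add: algebra_simps)
  then have "w = di p (chart_vec B c p u) + a *\<^sub>R z"
    using y x M.linear_chart_vec[OF d] by (simp add: differential_chart_vec[OF c d] linear_add linear_scale)
  then show ?thesis using that L.chart_vec_in_tangent_space[OF c] by blast
qed

text \<open>An immersion has a smooth local left inverse: compose its coordinate form
  \<open>F\<close> with a linear left inverse \<open>P\<close> of the derivative at one point, and
  invert \<open>P o F\<close> near that point. Then \<open>h\<close> after this left inverse is the
  extension. Agreement can be asked only for parameters \<open>q\<close> near \<open>p\<close>,
  because other parts of an immersed \<open>L\<close> may come arbitrarily close to
  \<open>i p\<close>.\<close>

lemma extend_function:
  assumes h: "smooth_fun_near B p h"
  obtains H where "smooth_fun_near A (i p) H" "\<forall>\<^sub>F q in nhds p. H (i q) = h q"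
proof -
  obtain c where c: "c \<in> B" "p \<in> fst c" using L.ex_chart by blast
  obtain d where d: "d \<in> A" "i p \<in> fst d" using M.ex_chart by blast
  define F where "F = snd d \<circ> i \<circ> cinv c"
  define S where "S = snd c ` (fst c \<inter> i -` fst d)"
  let ?x = "snd c p" and ?D = "frechet_derivative F (at (snd c p))"
  have S: "open S" "?x \<in> S" and F: "smooth_on S F"
    unfolding S_def F_def using open_immersion_domain immersion_smooth c d by auto
  have dF: "(F has_derivative ?D) (at ?x)"
    unfolding F_def by (rule immersion_has_derivative[OF c d])
  have "inj ?D"
    using immersion_derivative_eq_0[OF c d] has_derivative_linear[OF dF] linear_injective_0
    unfolding F_def by blast
  then obtain P where P: "linear P" "P \<circ> ?D = id"
    using linear_injective_left_inverse has_derivative_linear[OF dF] by blast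
  have blP: "bounded_linear P" using P linear_conv_bounded_linear by blast
  have PF: "smooth_on S (\<lambda>x. P (F x))"
    by (rule smooth_on_compose[OF S(1) open_UNIV F smooth_on_bounded_linear[OF open_UNIV blP]]) simp
  have dPF: "((\<lambda>x. P (F x)) has_derivative (\<lambda>v. P (?D v))) (at ?x)"
    by (rule bounded_linear.has_derivative[OF blP dF])
  have inj_PF: "w = 0" if "frechet_derivative (\<lambda>x. P (F x)) (at ?x) w = 0" for w
    using that fun_cong[OF P(2), of w] fun_cong[OF frechet_derivative_at[OF dPF], of w] by simp
  obtain U V G where UV: "open U" "?x \<in> U" "U \<subseteq> S" "open V"
    "homeomorphism U V (\<lambda>x. P (F x)) G" "smooth_on V G"
    by (rule smooth_inverse_function[OF S(1) PF S(2) inj_PF]) (assumption, rule that)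
  then have G: "G (P (F x)) = x" "P (F x) \<in> V" if "x \<in> U" for x
    using that by (auto simp: homeomorphism_def)
  obtain T where T: "open T" "?x \<in> T" "smooth_on T (h \<circ> cinv c)"
    by (rule L.smooth_fun_near_chartE[OF h c])
  define N where "N = V \<inter> G -` T"
  have N: "open N" unfolding N_def
    by (rule continuous_open_preimage[OF smooth_on_imp_continuous_on[OF UV(6)] UV(4) T(1)])
  have k: "smooth_on N (\<lambda>y. (h \<circ> cinv c) (G y))"
    by (rule smooth_on_compose[OF N T(1) smooth_on_subset[OF UV(6)] T(3)]) (auto simp: N_def)
  define H where "H = (\<lambda>m. (h \<circ> cinv c) (G (P (snd d m))))"
  define Q where "Q = snd d ` fst d \<inter> P -` N"
  have Q: "open Q" unfolding Q_def
    using continuous_open_preimage[OF linear_continuous_on[OF blP] M.open_chart_range[OF d(1)] N] .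
  have "smooth_on Q (\<lambda>y. (h \<circ> cinv c) (G (P y)))"
    by (rule smooth_on_compose[OF Q N smooth_on_bounded_linear[OF Q blP] k]) (auto simp: Q_def)
  then have "smooth_on Q (H \<circ> cinv d)"
    by (rule smooth_on_cong[OF Q, rotated]) (use d in \<open>auto simp: Q_def H_def\<close>)
  moreover have "snd d (i p) \<in> Q"
    using G[OF UV(2)] T d c by (auto simp: Q_def N_def F_def)
  ultimately have "smooth_fun_near A (i p) H"
    unfolding M.smooth_fun_near_chart_iff[OF d] using Q by blast
  moreover have "\<forall>\<^sub>F q in nhds p. snd c q \<in> U"
    using L.filterlim_chart[OF c] eventually_nhds_in_open[OF UV(1,2)]
    by (rule eventually_compose_filterlim[rotated])
  then have "\<forall>\<^sub>F q in nhds p. H (i q) = h q"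
    using L.eventually_in_chart[OF c]
  proof eventually_elim
    case (elim q)
    then have "P (snd d (i q)) = P (F (snd c q))" using c by (simp add: F_def)
    then show ?case using G elim c by (simp add: H_def)
  qed
  ultimately show ?thesis using that by blast
qed

text \<open>Relatedness of fields under \<open>i\<close>, as a condition on germs so that it can be
  differentiated. For the rigged field it coincides with \<open>extends_along\<close>, the condition
  behind the extension chosen in \<open>cov_along\<close>.\<close>

definition related :: "'l \<Rightarrow> 'l field \<Rightarrow> 'm field \<Rightarrow> bool" where
  "related p X Y \<longleftrightarrow> smooth_field_near B p X \<and> smooth_field_near A (i p) Y \<and>
     (\<forall>\<^sub>F q in nhds p. Y (i q) = di q (X q))"

text \<open>In an ambient chart the components of \<open>di q (X q)\<close> are functions on
  \<open>L\<close>. Each extends by \<open>extend_function\<close>, and the extensions are taken as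
  the coefficients of \<open>Y\<close>.\<close>

lemma extend_field:
  assumes X: "smooth_field_near B p X" obtains Y where "related p X Y"
proof -
  obtain d where d: "d \<in> A" "i p \<in> fst d" using M.ex_chart by blast
  define h where "h = (\<lambda>b q. X q ((\<lambda>m. snd d m \<bullet> b) \<circ> i))"
  have "smooth_fun_near B p (h b)" for b
    unfolding h_def
    by (intro L.smooth_field_near_apply[OF X] smooth_fun_near_pullback M.smooth_fun_near_coordinate d)
  then have "\<exists>H. smooth_fun_near A (i p) H \<and> (\<forall>\<^sub>F q in nhds p. H (i q) = h b q)" for b
    using extend_function by metis
  then obtain H where H: "\<And>b. smooth_fun_near A (i p) (H b)" "\<And>b. \<forall>\<^sub>F q in nhds p. H b (i q) = h b q"
    by metis
  define Y where "Y = (\<lambda>m. chart_vec A d m (\<Sum>b\<in>Basis. H b m *\<^sub>R b))"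
  have "smooth_field_near A (i p) Y"
    by (rule M.smooth_field_nearI[OF d, of H]) (simp_all add: Y_def H(1))
  moreover have "\<forall>\<^sub>F q in nhds p. \<forall>b\<in>Basis. H b (i q) = h b q"
    using H(2) by (intro eventually_ball_finite) auto
  then have "\<forall>\<^sub>F q in nhds p. Y (i q) = di q (X q)"
    using L.smooth_field_near_tangent[OF X] eventually_immersion[OF M.eventually_in_chart[OF d]]
  proof eventually_elim
    case (elim q)
    have "di q (X q) = chart_vec A d (i q) (\<Sum>b\<in>Basis. di q (X q) (\<lambda>m. snd d m \<bullet> b) *\<^sub>R b)"
      by (rule M.tangent_vector_coordinates[OF d(1) elim(3) differential_tangent[OF elim(2)]])
    also have "\<dots> = Y (i q)"
      using elim d by (simp add: Y_def h_def differential_apply[OF M.smooth_fun_near_coordinate])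
    finally show ?case by simp
  qed
  ultimately show ?thesis using that X by (simp add: related_def)
qed

lemma related_at: "related p X Y \<Longrightarrow> Y (i p) = di p (X p)"
  using eventually_nhds_x_imp_x[of "\<lambda>q. Y (i q) = di q (X q)" p] by (simp add: related_def)

lemma related_apply:
  assumes "related p X Y" "smooth_fun_near A (i p) f"
  shows "\<forall>\<^sub>F q in nhds p. Y (i q) f = X q (f \<circ> i)"
proof -
  have "\<forall>\<^sub>F q in nhds p. Y (i q) = di q (X q)" using assms(1) by (simp add: related_def)
  with eventually_immersion[OF M.eventually_smooth_fun_near[OF assms(2)]] show ?thesis
    by eventually_elim (simp add: differential_apply)
qed

lemma related_tensor:
  assumes g: "symmetric_tensor A g" and X: "related p X X'" and Y: "related p Y Y'"
  shows related_tensor_smooth: "smooth_fun_near B p (\<lambda>q. g (i q) (di q (X q)) (di q (Y q)))"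
    and related_tensor_derivative: "u \<in> tangent_space B p \<Longrightarrow>
      di p u (\<lambda>m. g m (X' m) (Y' m)) = u (\<lambda>q. g (i q) (di q (X q)) (di q (Y q)))"
proof -
  have s: "smooth_fun_near A (i p) (\<lambda>m. g m (X' m) (Y' m))"
    using g X Y M.tensor_smooth by (simp add: related_def)
  have "\<forall>\<^sub>F q in nhds p. X' (i q) = di q (X q)" "\<forall>\<^sub>F q in nhds p. Y' (i q) = di q (Y q)"
    using X Y by (simp_all add: related_def)
  then have ev: "\<forall>\<^sub>F q in nhds p. ((\<lambda>m. g m (X' m) (Y' m)) \<circ> i) q = g (i q) (di q (X q)) (di q (Y q))"
    by eventually_elim simp
  from L.smooth_fun_near_cong[OF this smooth_fun_near_pullback[OF s]]
  show "smooth_fun_near B p (\<lambda>q. g (i q) (di q (X q)) (di q (Y q)))" .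
  show "di p u (\<lambda>m. g m (X' m) (Y' m)) = u (\<lambda>q. g (i q) (di q (X q)) (di q (Y q)))"
    if "u \<in> tangent_space B p"
    unfolding differential_apply[OF s] by (rule L.tangent_vector_cong[OF that ev])
qed

text \<open>Each of the two iterated derivatives in the bracket pulls back separately. The inner
  identity gets differentiated, so it must hold in a neighbourhood of \<open>p\<close> and not just
  at \<open>p\<close>.\<close>

lemma related_lie_bracket:
  assumes X: "related p X X'" and Y: "related p Y Y'"
  shows "lie_bracket A X' Y' (i p) = di p (lie_bracket B X Y p)"
proof
  fix f
  show "lie_bracket A X' Y' (i p) f = di p (lie_bracket B X Y p) f"
  proof (cases "smooth_fun_near A (i p) f")
    case True
    have Z: "Z' (i p) (\<lambda>m. W' m f) = Z p (\<lambda>q. W q (f \<circ> i))"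
      if "related p Z Z'" "related p W W'" for Z Z' W W'
    proof -
      have s: "smooth_fun_near A (i p) (\<lambda>m. W' m f)"
        using that(2) True M.smooth_field_near_apply by (simp add: related_def)
      have "Z' (i p) (\<lambda>m. W' m f) = Z p ((\<lambda>m. W' m f) \<circ> i)"
        using related_at[OF that(1)] differential_apply[OF s] by simp
      also have "\<dots> = Z p (\<lambda>q. W q (f \<circ> i))"
      proof (rule L.tangent_vector_cong[of "Z p" p])
        show "Z p \<in> tangent_space B p"
          using that(1) L.smooth_field_near_tangent_at by (simp add: related_def)
        show "\<forall>\<^sub>F q in nhds p. ((\<lambda>m. W' m f) \<circ> i) q = W q (f \<circ> i)"
          using related_apply[OF that(2) True] by (simp add: o_def)
      qed
      finally show ?thesis .
    qed
    show ?thesis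
      using True smooth_fun_near_pullback[OF True]
      by (simp add: lie_bracket_def differential_def Z[OF X Y] Z[OF Y X])
  qed (simp add: lie_bracket_def differential_def)
qed

end

section \<open>Rigged null hypersurfaces\<close>

locale rigged_null_hypersurface = hypersurface_in_manifold A B i
  for A :: "('m::t2_space, 'e::euclidean_space) chart set"
    and B :: "('l::t2_space, 'f::euclidean_space) chart set" and i :: "'l \<Rightarrow> 'm" +
  fixes g :: "'m tensor2" and D :: "'m connection" and W :: "'m set" and \<zeta> :: "'m field"
    and \<xi> :: "'l field" and D' :: "'l connection"
  assumes lorentzian: "lorentzian_metric A g"
    and levi_civita: "levi_civita A g D"
    and null: "null_hypersurface B A g i"
    and closed_rigging: "closed_rigging B A g i W \<zeta>"
    and rigged_field: "rigged_field B A g i \<zeta> \<xi>"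
    and levi_civita': "levi_civita B (rigged_metric A g i \<zeta>) D'"
begin

abbreviation \<omega> :: "'l form1" where "\<omega> \<equiv> rigged_form A g i \<zeta>"
abbreviation h :: "'l tensor2" where "h \<equiv> rigged_metric A g i \<zeta>"
abbreviation sff :: "'l tensor2" where "sff \<equiv> null_sff A g D i \<xi>"

text \<open>The pullback of \<open>g\<close> to \<open>L\<close>; it is degenerate, and its radical
  turns out to be the line spanned by \<xi>.\<close>

definition gL :: "'l tensor2" where "gL p u v = g (i p) (di p u) (di p v)"

lemma h_eq: "h p u v = gL p u v + \<omega> p u * \<omega> p v"
  by (simp add: rigged_metric_def gL_def)

lemma g_tensor: "symmetric_tensor A g"
  using lorentzian by (simp add: lorentzian_metric_def)

lemma zeta_near: "smooth_field_near A (i p) \<zeta>"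
proof -
  have "i p \<in> W" "smooth_field A W \<zeta>"
    using closed_rigging by (auto simp: closed_rigging_def rigging_def)
  then show ?thesis using M.smooth_field_imp_near by blast
qed

lemmas zeta_tangent = M.smooth_field_near_tangent_at[OF zeta_near]

text \<open>Pairing with the frame vector \<open>E c\<close> isolates the coefficient
  \<open>a c\<close> up to sign. The frame is given only as a spanning family; orthonormality also
  shows that it has no repetitions, so that elements of the span are sums over
  \<open>Basis\<close>.\<close>

lemma g_nondegenerate:
  assumes w: "w \<in> tangent_space A p" and zero: "\<And>v. v \<in> tangent_space A p \<Longrightarrow> g p w v = 0"
  shows "w = 0"
proof -
  obtain E :: "'e \<Rightarrow> 'm tvec" and b0 where sp: "span (E ` Basis) = tangent_space A p"
    and on: "\<forall>b\<in>Basis. \<forall>c\<in>Basis. g p (E b) (E c) = (if b \<noteq> c then 0 else if b = b0 then -1 else 1)"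
    using lorentzian unfolding lorentzian_metric_def by metis
  have E: "E b \<in> tangent_space A p" if "b \<in> Basis" for b
    using that sp span_base by (metis imageI)
  have "w \<in> range (\<lambda>a. \<Sum>b\<in>Basis. a b *\<^sub>R E b)"
  proof -
    have "inj_on E Basis"
    proof (rule inj_onI)
      fix b c :: 'e assume bc: "b \<in> Basis" "c \<in> Basis" "E b = E c"
      show "b = c"
      proof (rule ccontr)
        assume "b \<noteq> c"
        then have "g p (E b) (E c) = 0" "g p (E b) (E b) \<noteq> 0" using on bc(1,2) by auto
        then show False using bc by simp
      qed
    qed
    moreover have "w \<in> range (\<lambda>u. \<Sum>v\<in>E ` Basis. u v *\<^sub>R v)"
      using w sp span_finite[of "E ` Basis"] by simp
    ultimately show ?thesis
      by (auto simp: sum.reindex intro!: image_eqI[of _ _ "\<lambda>b. u (E b)" for u])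
  qed
  then obtain a where a: "w = (\<Sum>b\<in>Basis. a b *\<^sub>R E b)" by auto
  have sum_in: "(\<Sum>b\<in>I. a b *\<^sub>R E b) \<in> tangent_space A p" if "I \<subseteq> Basis" for I
    using that E by (intro subspace_sum[OF M.subspace_tangent_space] M.tangent_space_scale) auto
  have expand: "g p (\<Sum>b\<in>I. a b *\<^sub>R E b) (E c) = (\<Sum>b\<in>I. a b * g p (E b) (E c))"
    if "finite I" "I \<subseteq> Basis" "c \<in> Basis" for I c
    using that
  proof (induction I)
    case empty
    then show ?case using M.tensor_zero_left[OF g_tensor E] by (simp add: zero_fun_def)
  next
    case (insert b I)
    then show ?case
      using M.tensor_add_left[OF g_tensor M.tangent_space_scale[OF E] sum_in E, of b I c "a b"]
        M.tensor_scale_left[OF g_tensor E E, of b c "a b"]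
      by (simp add: plus_fun_def)
  qed
  have "a c = 0" if c: "c \<in> Basis" for c
  proof -
    have "0 = (\<Sum>b\<in>Basis. a b * g p (E b) (E c))"
      using zero[OF E[OF c]] expand[OF finite_Basis subset_refl c] a by simp
    also have "\<dots> = (\<Sum>b\<in>Basis. if b = c then a c * g p (E c) (E c) else 0)"
      using on c by (intro sum.cong) auto
    also have "\<dots> = a c * g p (E c) (E c)" using c by simp
    finally show ?thesis using on c by (auto split: if_splits)
  qed
  then show ?thesis using a by simp
qed

section \<open>The induced metric, the form \<omega> and the rigged metric\<close>

lemma gL_sym: "u \<in> tangent_space B p \<Longrightarrow> v \<in> tangent_space B p \<Longrightarrow> gL p u v = gL p v u"
  unfolding gL_def by (intro M.tensor_sym[OF g_tensor] differential_tangent)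

lemma gL_add_left: "u \<in> tangent_space B p \<Longrightarrow> v \<in> tangent_space B p \<Longrightarrow> w \<in> tangent_space B p \<Longrightarrow>
    gL p (u + v) w = gL p u w + gL p v w"
  unfolding gL_def differential_add by (intro M.tensor_add_left[OF g_tensor] differential_tangent)

lemma gL_scale_left: "u \<in> tangent_space B p \<Longrightarrow> w \<in> tangent_space B p \<Longrightarrow> gL p (a *\<^sub>R u) w = a * gL p u w"
  unfolding gL_def differential_scale by (intro M.tensor_scale_left[OF g_tensor] differential_tangent)

lemma omega_add: "u \<in> tangent_space B p \<Longrightarrow> v \<in> tangent_space B p \<Longrightarrow> \<omega> p (u + v) = \<omega> p u + \<omega> p v"
  unfolding rigged_form_def differential_add
  by (intro M.tensor_add_right[OF g_tensor] differential_tangent zeta_tangent)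

lemma omega_scale: "u \<in> tangent_space B p \<Longrightarrow> \<omega> p (a *\<^sub>R u) = a * \<omega> p u"
  unfolding rigged_form_def differential_scale
  by (intro M.tensor_scale_right[OF g_tensor] differential_tangent zeta_tangent)

lemma omega_diff: "u \<in> tangent_space B p \<Longrightarrow> v \<in> tangent_space B p \<Longrightarrow> \<omega> p (u - v) = \<omega> p u - \<omega> p v"
  using omega_add[of "u - v" p v] L.tangent_space_diff by simp

lemma omega_zero [simp]: "\<omega> p 0 = 0"
  using omega_scale[OF L.tangent_space_zero, of p 0] by simp

lemma omega_related:
  assumes X: "related p X X'"
  shows omega_smooth_related: "smooth_fun_near B p (\<lambda>q. \<omega> q (X q))"
    and omega_derivative_related: "u \<in> tangent_space B p \<Longrightarrow>
      di p u (\<lambda>m. g m (\<zeta> m) (X' m)) = u (\<lambda>q. \<omega> q (X q))"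
proof -
  have s: "smooth_fun_near A (i p) (\<lambda>m. g m (\<zeta> m) (X' m))"
    using X zeta_near M.tensor_smooth[OF g_tensor] by (simp add: related_def)
  have "\<forall>\<^sub>F q in nhds p. X' (i q) = di q (X q)" using X by (simp add: related_def)
  then have ev: "\<forall>\<^sub>F q in nhds p. ((\<lambda>m. g m (\<zeta> m) (X' m)) \<circ> i) q = \<omega> q (X q)"
    by eventually_elim (simp add: rigged_form_def)
  from L.smooth_fun_near_cong[OF this smooth_fun_near_pullback[OF s]]
  show "smooth_fun_near B p (\<lambda>q. \<omega> q (X q))" .
  show "di p u (\<lambda>m. g m (\<zeta> m) (X' m)) = u (\<lambda>q. \<omega> q (X q))" if "u \<in> tangent_space B p"
    unfolding differential_apply[OF s] by (rule L.tangent_vector_cong[OF that ev])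
qed

lemma omega_smooth:
  assumes "smooth_field_near B p X" shows "smooth_fun_near B p (\<lambda>q. \<omega> q (X q))"
  by (rule extend_field[OF assms]) (rule omega_smooth_related)

lemma gL_smooth:
  assumes "smooth_field_near B p X" "smooth_field_near B p Y"
  shows "smooth_fun_near B p (\<lambda>q. gL q (X q) (Y q))"
  unfolding gL_def
  by (rule extend_field[OF assms(1)], rule extend_field[OF assms(2)]) (rule related_tensor_smooth[OF g_tensor])

lemma h_tensor: "symmetric_tensor B h"
  unfolding symmetric_tensor_def
proof (intro conjI allI ballI impI)
  fix p u v w a assume t: "u \<in> tangent_space B p" "v \<in> tangent_space B p" "w \<in> tangent_space B p"
  show "h p u v = h p v u" using gL_sym t by (simp add: h_eq)
  show "h p (u + v) w = h p u w + h p v w"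
    using t by (simp add: h_eq gL_add_left omega_add algebra_simps)
  show "h p (a *\<^sub>R u) v = a * h p u v"
    using t by (simp add: h_eq gL_scale_left omega_scale algebra_simps)
next
  fix V X Y assume V: "smooth_field B V X \<and> smooth_field B V Y"
  show "smooth_fun B V (\<lambda>p. h p (X p) (Y p))"
  proof (rule L.smooth_fun_localI)
    show "open V" using V by (simp add: smooth_field_def)
    fix p assume "p \<in> V"
    then have "smooth_field_near B p X" "smooth_field_near B p Y" using V L.smooth_field_imp_near by blast+
    then show "smooth_fun_near B p (\<lambda>p. h p (X p) (Y p))"
      unfolding h_eq by (intro L.smooth_fun_near_add L.smooth_fun_near_mult gL_smooth omega_smooth)
  qed
qed

lemma xi_near: "smooth_field_near B p \<xi>"
  using rigged_field L.smooth_field_imp_near[of UNIV \<xi> p] by (simp add: rigged_field_def)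

lemmas xi_tangent = L.smooth_field_near_tangent_at[OF xi_near]

lemma h_xi: "u \<in> tangent_space B p \<Longrightarrow> h p (\<xi> p) u = \<omega> p u"
  using rigged_field by (simp add: rigged_field_def)

text \<open>The tangent space of \<open>L\<close> and the transversal vector \<zeta> span the
  ambient tangent space. A vector orthogonal to both is orthogonal to everything, hence zero as
  \<open>g\<close> is nondegenerate.\<close>

lemma perpendicular_imp_zero:
  assumes u: "u \<in> tangent_space B p" and g0: "\<And>v. v \<in> tangent_space B p \<Longrightarrow> gL p u v = 0" and o0: "\<omega> p u = 0"
  shows "u = 0"
proof -
  have "\<zeta> (i p) \<notin> di p ` tangent_space B p"
    using closed_rigging by (simp add: closed_rigging_def rigging_def)
  have "g (i p) (di p u) w = 0" if w: "w \<in> tangent_space A (i p)" for w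
  proof -
    obtain v a where v: "v \<in> tangent_space B p" "w = di p v + a *\<^sub>R \<zeta> (i p)"
      using tangent_decomposition[OF zeta_tangent \<open>\<zeta> (i p) \<notin> _\<close> w] .
    note t = differential_tangent[OF u] differential_tangent[OF v(1)] zeta_tangent[of p]
    have "g (i p) (di p u) w = gL p u v + a * \<omega> p u"
      using M.tensor_add_right[OF g_tensor t(2) M.tangent_space_scale[OF t(3)] t(1), of a]
        M.tensor_scale_right[OF g_tensor t(3) t(1)] M.tensor_sym[OF g_tensor t(1,3)]
      by (simp add: v(2) gL_def rigged_form_def)
    then show ?thesis using g0[OF v(1)] o0 by simp
  qed
  then have "di p u = 0" using g_nondegenerate[OF differential_tangent[OF u]] by blast
  then show ?thesis using differential_eq_0_iff[OF u] by simp
qed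

text \<open>On a null vector \<open>n\<close> the defining identity of \<xi> reads \<omega>(\<xi>)
  \<omega>(n) = \<omega>(n), and \<omega>(n) is nonzero by \<open>perpendicular_imp_zero\<close>.
  Once \<omega>(\<xi>) = 1 is known, the \<omega>-parts of the identity cancel, and what remains is
  that \<xi> is in the radical of \<open>gL\<close>.\<close>

lemma omega_xi [simp]: "\<omega> p (\<xi> p) = 1"
  and gL_xi: "u \<in> tangent_space B p \<Longrightarrow> gL p (\<xi> p) u = 0"
proof -
  obtain n where n: "n \<in> tangent_space B p" "n \<noteq> 0" "\<And>v. v \<in> tangent_space B p \<Longrightarrow> gL p n v = 0"
    using null unfolding null_hypersurface_def gL_def by metis
  then have "\<omega> p n \<noteq> 0" using perpendicular_imp_zero by blast
  moreover have "h p (\<xi> p) n = \<omega> p (\<xi> p) * \<omega> p n"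
    using n gL_sym[OF n(1) xi_tangent] by (simp add: h_eq xi_tangent)
  ultimately show 1: "\<omega> p (\<xi> p) = 1" using h_xi[OF n(1)] by simp
  show "gL p (\<xi> p) u = 0" if "u \<in> tangent_space B p"
    using h_xi[OF that] 1 by (simp add: h_eq)
qed

text \<open>Pairing with \<xi> gives \<omega>(u) = 0; then \<open>h\<close> and \<open>gL\<close>
  agree on \<open>u\<close>, and \<open>perpendicular_imp_zero\<close> applies.\<close>

lemma h_nondegenerate:
  assumes u: "u \<in> tangent_space B p" and zero: "\<And>v. v \<in> tangent_space B p \<Longrightarrow> h p u v = 0"
  shows "u = 0"
proof -
  have "\<omega> p u = 0"
    using h_xi[OF u] zero[OF xi_tangent] L.tensor_sym[OF h_tensor u xi_tangent] by simp
  then show ?thesis using perpendicular_imp_zero[OF u] zero by (simp add: h_eq)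
qed

text \<open>Closedness upstairs is tested on extensions of \<open>X\<close> and \<open>Y\<close>
  over a common open subset of \<open>W\<close>. Since brackets and derivatives of related fields
  pull back, the result is d\<omega>(X, Y) = 0 on \<open>L\<close>.\<close>

lemma omega_closed:
  assumes X: "smooth_field_near B p X" and Y: "smooth_field_near B p Y"
  shows "\<omega> p (lie_bracket B X Y p) = X p (\<lambda>q. \<omega> q (Y q)) - Y p (\<lambda>q. \<omega> q (X q))"
proof -
  obtain X' where r1: "related p X X'" by (rule extend_field[OF X])
  obtain Y' where r2: "related p Y Y'" by (rule extend_field[OF Y])
  note r = r1 r2
  have cr: "range i \<subseteq> W" "smooth_field A W \<zeta>" and cl: "closed_form A W (\<lambda>p. g p (\<zeta> p))"
    using closed_rigging by (auto simp: closed_rigging_def rigging_def)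
  have "smooth_field_near A (i p) X'" "smooth_field_near A (i p) Y'" using r by (simp_all add: related_def)
  then obtain V where V: "i p \<in> V" "smooth_field A V X'" "smooth_field A V Y'"
    by (rule M.common_domain)
  have "open (V \<inter> W)" using V cr by (auto simp: smooth_field_def)
  then have "smooth_field A (V \<inter> W) X'" "smooth_field A (V \<inter> W) Y'" "i p \<in> V \<inter> W"
    using V cr M.smooth_field_subset by blast+
  then have "ext_deriv A (\<lambda>p. g p (\<zeta> p)) X' Y' (i p) = 0"
    using cl unfolding closed_form_def by blast
  then show ?thesis
    using omega_derivative_related[OF r(1) L.smooth_field_near_tangent_at[OF Y]]
      omega_derivative_related[OF r(2) L.smooth_field_near_tangent_at[OF X]]
    by (simp add: ext_deriv_def related_at[OF r(1)] related_at[OF r(2)] related_lie_bracket[OF r] rigged_form_def)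
qed

text \<open>Every term on the right is a derivative along \<open>L\<close> of a function on
  \<open>L\<close>, or a bracket of tangent fields. So the pairing of the ambient derivative with
  tangent vectors is computed on \<open>L\<close> and does not depend on the extensions.\<close>

lemma related_koszul:
  assumes X: "related p X X'" and Y: "related p Y Y'" and Z: "related p Z Z'"
  shows "2 * g (i p) (D (i p) (di p (X p)) Y') (di p (Z p)) =
    X p (\<lambda>q. gL q (Y q) (Z q)) + Y p (\<lambda>q. gL q (X q) (Z q)) - Z p (\<lambda>q. gL q (X q) (Y q))
    + gL p (lie_bracket B X Y p) (Z p) - gL p (lie_bracket B X Z p) (Y p) - gL p (lie_bracket B Y Z p) (X p)"
proof -
  have n: "smooth_field_near A (i p) X'" "smooth_field_near A (i p) Y'" "smooth_field_near A (i p) Z'"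
    and t: "X p \<in> tangent_space B p" "Y p \<in> tangent_space B p" "Z p \<in> tangent_space B p"
    using X Y Z L.smooth_field_near_tangent_at by (auto simp: related_def)
  show ?thesis
    using M.koszul[OF levi_civita g_tensor n]
    unfolding related_at[OF X] related_at[OF Y] related_at[OF Z] gL_def
      related_tensor_derivative[OF g_tensor Y Z t(1)] related_tensor_derivative[OF g_tensor X Z t(2)]
      related_tensor_derivative[OF g_tensor X Y t(3)]
      related_lie_bracket[OF X Y] related_lie_bracket[OF X Z] related_lie_bracket[OF Y Z] .
qed

section \<open>The second fundamental form through the connection of the rigged metric\<close>

lemma extends_along_iff_related: "extends_along A i \<xi> p Y \<longleftrightarrow> related p \<xi> Y"
  by (auto simp: extends_along_def related_def xi_near eventually_nhds)

text \<open>Both sides are half the Lie derivative of the degenerate metric along \<open>\<xi>\<close>: since \<open>\<omega>\<close> is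
  closed and \<open>\<omega>(\<xi>) = 1\<close>, the Lie derivative of \<open>\<omega>\<close> along \<open>\<xi>\<close> vanishes.\<close>

lemma sff_eq:
  assumes u: "u \<in> tangent_space B p" and v: "v \<in> tangent_space B p"
  shows "sff p u v = - h p (D' p u \<xi>) v"
proof -
  \<comment> \<open>This is the extension that \<open>cov_along\<close> differentiates. All that is
    used of the choice is that it is related to \<xi>.\<close>
  define \<Xi> where "\<Xi> = (SOME Y. extends_along A i \<xi> p Y)"
  have "\<exists>Y. extends_along A i \<xi> p Y"
    unfolding extends_along_iff_related by (rule extend_field[OF xi_near]) (rule exI)
  then have \<Xi>: "related p \<xi> \<Xi>"
    unfolding \<Xi>_def extends_along_iff_related by (rule someI_ex)
  obtain U where U: "smooth_field_near B p U" "U p = u" using L.ex_smooth_field_near[OF u] .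
  obtain V where V: "smooth_field_near B p V" "V p = v" using L.ex_smooth_field_near[OF v] .
  obtain U' where U': "related p U U'" by (rule extend_field[OF U(1)])
  obtain V' where V': "related p V V'" by (rule extend_field[OF V(1)])
  note UV = U' V'
  have xig: "\<forall>\<^sub>F q in nhds p. gL q (\<xi> q) (X q) = 0 \<and> gL q (X q) (\<xi> q) = 0"
    if "smooth_field_near B p X" for X
    using L.smooth_field_near_tangent[OF that]
    by eventually_elim (use gL_xi gL_sym xi_tangent in auto)
  have g0: "w (\<lambda>q. gL q (\<xi> q) (X q)) = 0" "w (\<lambda>q. gL q (X q) (\<xi> q)) = 0"
    if "smooth_field_near B p X" "w \<in> tangent_space B p" for X w
    by (rule L.tangent_vector_const_near[OF that(2)]; use xig[OF that(1)] in \<open>auto elim: eventually_mono\<close>)+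
  have xih: "w (\<lambda>q. h q (\<xi> q) (X q)) = w (\<lambda>q. \<omega> q (X q))" "w (\<lambda>q. h q (X q) (\<xi> q)) = w (\<lambda>q. \<omega> q (X q))"
    if "smooth_field_near B p X" "w \<in> tangent_space B p" for X w
    by (rule L.tangent_vector_cong[OF that(2)];
        use L.smooth_field_near_tangent[OF that(1)] in
          \<open>rule eventually_mono; simp add: h_xi L.tensor_sym[OF h_tensor _ xi_tangent]\<close>)+
  \<comment> \<open>Vanishing of the Lie derivative of \<omega> along \<xi>: in d\<omega>(\<xi>, X)
    = 0 the term X(\<omega>(\<xi>)) is the derivative of the constant 1.\<close>
  have omega_Lie: "\<omega> p (lie_bracket B \<xi> X p) = \<xi> p (\<lambda>q. \<omega> q (X q))"
    "\<omega> p (lie_bracket B X \<xi> p) = - \<xi> p (\<lambda>q. \<omega> q (X q))"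
    if "smooth_field_near B p X" for X
    using omega_closed[OF xi_near that] omega_closed[OF that xi_near]
      L.tangent_vector_const[OF L.smooth_field_near_tangent_at[OF that], of 1] by simp_all
  have tb: "lie_bracket B X Y p \<in> tangent_space B p"
    if "smooth_field_near B p X" "smooth_field_near B p Y" for X Y
    using L.lie_bracket_tangent[OF levi_civita' that] .
  \<comment> \<open>The two products from the Leibniz rule will cancel the \<omega>-parts of the
    brackets \<open>[U, \<xi>]\<close> and \<open>[\<xi>, V]\<close>. The \<omega>-terms that are
    left in the Koszul formula for \<open>h\<close> add up to d\<omega>(U, V) = 0.\<close>
  have split: "\<xi> p (\<lambda>q. h q (U q) (V q)) =
      \<xi> p (\<lambda>q. gL q (U q) (V q)) + (\<omega> p u * \<xi> p (\<lambda>q. \<omega> q (V q)) + \<xi> p (\<lambda>q. \<omega> q (U q)) * \<omega> p v)"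
    unfolding h_eq
    by (simp add: L.tangent_vector_add[OF xi_tangent] L.tangent_vector_mult[OF xi_tangent]
        gL_smooth omega_smooth L.smooth_fun_near_mult U V)
  have "2 * g (i p) (D (i p) (di p u) \<Xi>) (di p v) =
      \<xi> p (\<lambda>q. gL q (U q) (V q)) + gL p (lie_bracket B U \<xi> p) v - gL p (lie_bracket B \<xi> V p) u"
    using related_koszul[OF UV(1) \<Xi> UV(2)] g0(1)[OF V(1) u] g0(2)[OF U(1) v] U V u v gL_xi[of "lie_bracket B U V p" p]
      gL_sym[OF tb[OF U(1) V(1)] xi_tangent] tb[OF U(1) V(1)] by simp
  moreover have "2 * h p (D' p u \<xi>) v =
      \<xi> p (\<lambda>q. gL q (U q) (V q)) + gL p (lie_bracket B U \<xi> p) v - gL p (lie_bracket B \<xi> V p) u"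
    using L.koszul[OF levi_civita' h_tensor U(1) xi_near V(1)] split xih(1)[OF V(1) u] xih(2)[OF U(1) v] U V u v
      omega_closed[OF U(1) V(1)] omega_Lie[OF U(1)] omega_Lie[OF V(1)]
      h_xi[OF tb[OF U(1) V(1)]] L.tensor_sym[OF h_tensor tb[OF U(1) V(1)] xi_tangent]
    by (simp add: h_eq[of p _ u] h_eq[of p _ v])
  ultimately show ?thesis
    by (simp add: null_sff_def cov_along_def \<Xi>_def)
qed

text \<open>Being dual to a closed form, \<xi> is locally a gradient for \<open>h\<close>, and
  \<open>B\<close> is minus the Hessian of a primitive of \<omega>. In formulas,
  \<open>h(D' u \<xi>, v) - h(D' v \<xi>, u)\<close> is d\<omega>(u, v).\<close>

lemma sff_sym:
  assumes u: "u \<in> tangent_space B p" and v: "v \<in> tangent_space B p" shows "sff p u v = sff p v u"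
proof -
  obtain U where U: "smooth_field_near B p U" "U p = u" using L.ex_smooth_field_near[OF u] .
  obtain V where V: "smooth_field_near B p V" "V p = v" using L.ex_smooth_field_near[OF v] .
  have h_omega: "w (\<lambda>q. h q (\<xi> q) (X q)) = w (\<lambda>q. \<omega> q (X q))"
    if "smooth_field_near B p X" "w \<in> tangent_space B p" for X w
    by (rule L.tangent_vector_cong[OF that(2)];
        use L.smooth_field_near_tangent[OF that(1)] in \<open>rule eventually_mono; simp add: h_xi\<close>)
  note t = L.levi_civita_tangent[OF levi_civita' u V(1)] L.levi_civita_tangent[OF levi_civita' v U(1)]
  have "\<omega> p (lie_bracket B U V p) = h p (\<xi> p) (D' p u V) - h p (\<xi> p) (D' p v U)"
    using L.levi_civita_torsion_free[OF levi_civita' U(1) V(1)] U V omega_diff[OF t] h_xi[OF t(1)] h_xi[OF t(2)]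
    by simp
  then show ?thesis
    using omega_closed[OF U(1) V(1)] h_omega[OF U(1) v] h_omega[OF V(1) u] U(2) V(2)
      L.levi_civita_metric[OF levi_civita' u xi_near V(1)] L.levi_civita_metric[OF levi_civita' v xi_near U(1)]
    by (simp add: sff_eq[OF u v] sff_eq[OF v u])
qed

lemma nabla_xi_tangent: "u \<in> tangent_space B p \<Longrightarrow> D' p u \<xi> \<in> tangent_space B p"
  by (rule L.levi_civita_tangent[OF levi_civita' _ xi_near])

text \<open>The field \<xi> has constant length 1 for \<open>h\<close>, so its derivative is
  orthogonal to it.\<close>

lemma sff_xi_right: assumes u: "u \<in> tangent_space B p" shows "sff p u (\<xi> p) = 0"
proof -
  have "u (\<lambda>q. h q (\<xi> q) (\<xi> q)) = 0"
    using L.tangent_vector_const[OF u, of 1] by (simp add: h_xi xi_tangent)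
  then show ?thesis
    using L.levi_civita_metric[OF levi_civita' u xi_near xi_near] L.tensor_sym[OF h_tensor nabla_xi_tangent[OF u] xi_tangent]
    by (simp add: sff_eq[OF u xi_tangent])
qed

lemma sff_add_right:
  "u \<in> tangent_space B p \<Longrightarrow> v \<in> tangent_space B p \<Longrightarrow> w \<in> tangent_space B p \<Longrightarrow>
    sff p u (v + w) = sff p u v + sff p u w"
  by (simp add: sff_eq L.tangent_space_add L.tensor_add_right[OF h_tensor] nabla_xi_tangent)

lemma sff_scale_right:
  "u \<in> tangent_space B p \<Longrightarrow> v \<in> tangent_space B p \<Longrightarrow> sff p u (a *\<^sub>R v) = a * sff p u v"
  by (simp add: sff_eq L.tangent_space_scale L.tensor_scale_right[OF h_tensor] nabla_xi_tangent)

lemma totally_geodesic_iff_parallel: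
  "null_totally_geodesic B A g D i \<xi> \<longleftrightarrow> parallel_field B D' \<xi>"
proof
  assume "null_totally_geodesic B A g D i \<xi>"
  then have "h p (D' p u \<xi>) v = 0" if "u \<in> tangent_space B p" "v \<in> tangent_space B p" for p u v
    using sff_eq[OF that] that by (simp add: null_totally_geodesic_def)
  then show "parallel_field B D' \<xi>"
    unfolding parallel_field_def using h_nondegenerate[OF nabla_xi_tangent] by blast
next
  assume "parallel_field B D' \<xi>"
  then show "null_totally_geodesic B A g D i \<xi>"
    by (simp add: null_totally_geodesic_def parallel_field_def sff_eq L.tensor_zero_left[OF h_tensor])
qed

end

section \<open>The Poincare lemma on a ball\<close>

text \<open>The primitive is the line integral of \<open>a\<close> along the segment from the
  centre, differentiated under the integral sign.\<close>

lemma poincare_ball: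
  fixes a :: "'a::euclidean_space \<Rightarrow> 'a"
  assumes a: "smooth_on (ball x0 r) a"
    and sym: "\<And>x b c. x \<in> ball x0 r \<Longrightarrow> b \<in> Basis \<Longrightarrow> c \<in> Basis \<Longrightarrow>
      frechet_derivative a (at x) b \<bullet> c = frechet_derivative a (at x) c \<bullet> b"
  obtains F where "\<And>x. x \<in> ball x0 r \<Longrightarrow> (F has_derivative (\<lambda>v. a x \<bullet> v)) (at x)"
proof -
  define Da where "Da = (\<lambda>x. frechet_derivative a (at x))"
  let ?U = "ball x0 r"
  have da: "(a has_derivative Da x) (at x)" if "x \<in> ?U" for x
    unfolding Da_def by (rule smooth_on_has_derivative[OF open_ball a that])
  have sym': "Da x v \<bullet> w = Da x w \<bullet> v" if x: "x \<in> ?U" for x v w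
  proof -
    have lin: "linear (Da x)" using da[OF x] has_derivative_linear by blast
    have e: "Da x v \<bullet> w = (\<Sum>b\<in>Basis. \<Sum>c\<in>Basis. (v \<bullet> b) * (w \<bullet> c) * (Da x b \<bullet> c))" for v w
    proof -
      have "Da x v \<bullet> w = (\<Sum>b\<in>Basis. (v \<bullet> b) * (Da x b \<bullet> w))"
        by (subst linear_basis_expand[OF lin]) (simp add: inner_sum_left)
      then show ?thesis
        by (simp add: euclidean_inner[of "Da x _" w] sum_distrib_left mult_ac)
    qed
    have "(\<Sum>b\<in>Basis. \<Sum>c\<in>Basis. (v \<bullet> b) * (w \<bullet> c) * (Da x b \<bullet> c)) =
        (\<Sum>b\<in>Basis. \<Sum>c\<in>Basis. (w \<bullet> c) * (v \<bullet> b) * (Da x c \<bullet> b))"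
      by (intro sum.cong refl) (use sym[OF x] in \<open>simp add: Da_def\<close>)
    also have "\<dots> = (\<Sum>c\<in>Basis. \<Sum>b\<in>Basis. (w \<bullet> c) * (v \<bullet> b) * (Da x c \<bullet> b))"
      by (rule sum.swap)
    finally show ?thesis by (rule trans[OF e[of v w] trans[OF _ e[of w v, symmetric]]])
  qed
  define y where "y = (\<lambda>(x::'a) (t::real). x0 + t *\<^sub>R (x - x0))"
  have yU: "y x t \<in> ?U" if "x \<in> ?U" "t \<in> cbox 0 1" for x t
  proof -
    have "norm (t *\<^sub>R (x - x0)) \<le> norm (x - x0)"
      using that by (simp add: mult_left_le_one_le)
    then show ?thesis using that by (simp add: y_def dist_norm norm_minus_commute)
  qed
  \<comment> \<open>\<open>G x t\<close> plays two roles. By symmetry of the derivative of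
    \<open>a\<close> it is the gradient in \<open>x\<close> of the integrand
    \<open>a (y x t) \<bullet> (x - x0)\<close>; it is also the derivative in \<open>t\<close> of
    \<open>t *\<^sub>R a (y x t)\<close>, so that its integral over \<open>{0..1}\<close> is
    \<open>a x\<close>.\<close>
  define G where "G = (\<lambda>x t. t *\<^sub>R Da (y x t) (x - x0) + a (y x t))"
  have yc: "continuous_on (?U \<times> cbox 0 1) (\<lambda>(x, t). y x t)"
    unfolding y_def case_prod_unfold by (intro continuous_intros)
  have cont_comp: "continuous_on (?U \<times> cbox 0 1) (\<lambda>(x, t). k (y x t))"
    if "continuous_on ?U k" for k :: "'a \<Rightarrow> 'a"
  proof -
    have "(\<lambda>(x, t). y x t) ` (?U \<times> cbox 0 1) \<subseteq> ?U" using yU by fastforce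
    from continuous_on_compose2[OF that yc this] show ?thesis by (simp add: case_prod_unfold)
  qed
  have G_cont: "continuous_on (?U \<times> cbox 0 1) (\<lambda>(x, t). G x t)"
  proof -
    have "continuous_on (?U \<times> cbox 0 1)
        (\<lambda>(x, t). t *\<^sub>R (\<Sum>b\<in>Basis. ((x - x0) \<bullet> b) *\<^sub>R Da (y x t) b) + a (y x t))"
      using cont_comp[OF smooth_on_imp_continuous_on[OF smooth_on_frechet_derivative[OF a]]]
        cont_comp[OF smooth_on_imp_continuous_on[OF a]]
      unfolding case_prod_unfold Da_def by (intro continuous_intros) auto
    then show ?thesis
      by (rule continuous_on_cong[THEN iffD1, rotated 2])
         (auto simp: G_def linear_basis_expand[OF has_derivative_linear[OF da[OF yU]], symmetric])
  qed
  have pair: "continuous_on (cbox 0 1) (Pair x)" "Pair x ` cbox 0 1 \<subseteq> ?U \<times> cbox 0 (1::real)" if "x \<in> ?U" for x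
    using that by (auto intro: continuous_on_Pair continuous_on_const continuous_on_id)
  define F where "F = (\<lambda>x. integral (cbox 0 1) (\<lambda>t. a (y x t) \<bullet> (x - x0)))"
  have "(F has_derivative (\<lambda>v. a x \<bullet> v)) (at x)" if x: "x \<in> ?U" for x
  proof -
    have Gx: "continuous_on (cbox 0 1) (G x)"
      using continuous_on_compose2[OF G_cont pair[OF x]] by simp
    have "(F has_derivative integral (cbox 0 1) (\<lambda>t. blinfun_inner_right (G x t))) (at x within ?U)"
      unfolding F_def
    proof (rule leibniz_rule[OF _ _ _ x convex_ball])
      fix x' and t :: real assume x': "x' \<in> ?U" and t: "t \<in> cbox 0 1"
      have dy: "((\<lambda>x. y x t) has_derivative (\<lambda>v. t *\<^sub>R v)) (at x')"
        unfolding y_def by (auto intro!: derivative_eq_intros)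
      have "((\<lambda>x. a (y x t)) has_derivative (\<lambda>v. Da (y x' t) (t *\<^sub>R v))) (at x')"
        using diff_chain_at[OF dy da[OF yU[OF x' t]]] by (simp add: o_def)
      then have "((\<lambda>x. a (y x t) \<bullet> (x - x0)) has_derivative
          (\<lambda>v. a (y x' t) \<bullet> v + Da (y x' t) (t *\<^sub>R v) \<bullet> (x' - x0))) (at x')"
        by (auto intro!: derivative_eq_intros)
      moreover have "a (y x' t) \<bullet> v + Da (y x' t) (t *\<^sub>R v) \<bullet> (x' - x0) = G x' t \<bullet> v" for v
        using sym'[OF yU[OF x' t], of v "x' - x0"] linear_scale[OF has_derivative_linear[OF da[OF yU[OF x' t]]]]
        by (simp add: G_def inner_add_left)
      ultimately show "((\<lambda>x. a (y x t) \<bullet> (x - x0)) has_derivative blinfun_apply (blinfun_inner_right (G x' t)))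
          (at x' within ?U)"
        by (simp add: has_derivative_at_withinI)
    next
      fix x' assume x': "x' \<in> ?U"
      have "continuous_on (cbox 0 1) (\<lambda>t. a (y x' t))"
        using continuous_on_compose2[OF cont_comp[OF smooth_on_imp_continuous_on[OF a]] pair[OF x']] by simp
      then show "(\<lambda>t. a (y x' t) \<bullet> (x' - x0)) integrable_on cbox 0 1"
        by (intro integrable_continuous continuous_intros)
    next
      show "continuous_on (?U \<times> cbox 0 1) (\<lambda>(x, t). blinfun_inner_right (G x t))"
        using bounded_linear.continuous_on[OF bounded_linear_blinfun_inner_right G_cont]
        by (simp add: case_prod_unfold)
    qed
    also have "integral (cbox 0 1) (\<lambda>t. blinfun_inner_right (G x t)) = blinfun_inner_right (integral (cbox 0 1) (G x))"
      using integral_linear[OF integrable_continuous[OF Gx] bounded_linear_blinfun_inner_right]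
      by (simp add: o_def)
    also have "integral (cbox 0 1) (G x) = a x"
    proof -
      have "((\<lambda>t. t *\<^sub>R a (y x t)) has_vector_derivative G x t) (at t within {0..1})" if t: "t \<in> {0..1}" for t
      proof -
        have t': "t \<in> cbox 0 1" using t by simp
        have dy: "(y x has_derivative (\<lambda>s. s *\<^sub>R (x - x0))) (at t)"
          unfolding y_def by (auto intro!: derivative_eq_intros)
        have "((\<lambda>t. a (y x t)) has_derivative (\<lambda>s. Da (y x t) (s *\<^sub>R (x - x0)))) (at t)"
          using diff_chain_at[OF dy da[OF yU[OF x t']]] by (simp add: o_def)
        then have "((\<lambda>t. t *\<^sub>R a (y x t)) has_derivative
            (\<lambda>s. t *\<^sub>R Da (y x t) (s *\<^sub>R (x - x0)) + s *\<^sub>R a (y x t))) (at t)"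
          by (auto intro!: derivative_eq_intros)
        moreover have "(\<lambda>s. t *\<^sub>R Da (y x t) (s *\<^sub>R (x - x0)) + s *\<^sub>R a (y x t)) = (\<lambda>s. s *\<^sub>R G x t)"
          using linear_scale[OF has_derivative_linear[OF da[OF yU[OF x t']]]]
          by (simp add: G_def scaleR_add_right mult.commute add.commute)
        ultimately show ?thesis
          by (simp add: has_vector_derivative_def has_derivative_at_withinI)
      qed
      from fundamental_theorem_of_calculus[OF _ this] have "(G x has_integral a x) {0..1}"
        by (simp add: y_def)
      then show ?thesis by (simp add: integral_unique)
    qed
    finally have "(F has_derivative (\<lambda>v. a x \<bullet> v)) (at x within ?U)" by simp
    then show ?thesis using at_within_open[OF x open_ball] by simp
  qed
  then show ?thesis using that by blast
qed

section \<open>Coordinate slices\<close>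

context smooth_manifold
begin

text \<open>A smooth change of coordinates is compatible with all charts, so maximality of the atlas
  puts it into \<open>A\<close>. This matters because \<open>slice\<close> accepts only charts of
  the atlas.\<close>

lemma compose_chart:
  assumes c: "c \<in> A" and K: "open K" "K \<subseteq> snd c ` fst c" and V: "open V"
    and hom: "homeomorphism K V \<Psi> G" and \<Psi>: "smooth_on K \<Psi>" and G: "smooth_on V G"
  shows "(fst c \<inter> snd c -` K, \<Psi> \<circ> snd c) \<in> A"
    and "(\<Psi> \<circ> snd c) ` (fst c \<inter> snd c -` K) = V"
    and "\<And>y. y \<in> V \<Longrightarrow> inv_into (fst c \<inter> snd c -` K) (\<Psi> \<circ> snd c) y = cinv c (G y)"
proof -
  define U where "U = fst c \<inter> snd c -` K"
  define \<phi> where "\<phi> = \<Psi> \<circ> snd c"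
  have U: "open U" unfolding U_def by (rule open_chart_vimage[OF c K(1)])
  have im: "snd c ` U = K" using K by (auto simp: U_def)
  have h1: "homeomorphism U K (snd c) (cinv c)"
    by (rule homeomorphism_of_subsets[OF chart_homeomorphism[OF c] _ K(2) im]) (simp add: U_def)
  have h2: "homeomorphism U V \<phi> (cinv c \<circ> G)"
    unfolding \<phi>_def by (rule homeomorphism_compose[OF h1 hom])
  then have im2: "\<phi> ` U = V" and inj: "inj_on \<phi> U"
    by (auto simp: homeomorphism_def intro: inj_on_inverseI)
  have inv: "inv_into U \<phi> y = cinv c (G y)" if "y \<in> V" for y
  proof (rule inv_into_f_eq[OF inj])
    show "cinv c (G y) \<in> U" "\<phi> (cinv c (G y)) = y" using h2 that by (auto simp: homeomorphism_def)
  qed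
  have h3: "homeomorphism U V \<phi> (inv_into U \<phi>)"
    by (rule homeomorphism_cong[OF h2]) (simp_all add: inv)
  have chart: "is_chart (U, \<phi>)" using h3 U V im2 by (simp add: is_chart_def)
  have cG: "G ` V = K" "continuous_on V G" using hom by (auto simp: homeomorphism_def)
  have comp: "compatible (U, \<phi>) d" if d: "d \<in> A" for d
  proof -
    have o1: "open (\<phi> ` (U \<inter> fst d))"
    proof -
      have "\<phi> ` (U \<inter> fst d) = V \<inter> G -` (snd c ` (fst c \<inter> (U \<inter> fst d)))"
        using inv im2 h2 hom c by (fastforce simp: homeomorphism_def U_def \<phi>_def)
      then show ?thesis
        using continuous_open_preimage[OF cG(2) V open_chart_image[OF c open_Int[OF U open_chart_domain[OF d]]]]
        by simp
    qed
    have "smooth_on (\<phi> ` (U \<inter> fst d)) (\<lambda>y. (snd d \<circ> cinv c) (G y))"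
    proof (rule smooth_on_compose[OF o1 open_chart_image[OF c open_chart_domain[OF d]]
        smooth_on_subset[OF G] transition_smooth[OF c d]])
      show "\<phi> ` (U \<inter> fst d) \<subseteq> V" using im2 by blast
      show "G ` \<phi> ` (U \<inter> fst d) \<subseteq> snd c ` (fst c \<inter> fst d)"
        using hom by (auto simp: \<phi>_def U_def homeomorphism_def)
    qed
    then have 1: "smooth_on (\<phi> ` (U \<inter> fst d)) (snd d \<circ> inv_into U \<phi>)"
      by (rule smooth_on_cong[OF o1, rotated]) (use inv im2 in auto)
    have o2: "open (snd d ` (U \<inter> fst d))"
      using open_chart_image[OF d U] by (simp add: Int_commute)
    have "smooth_on (snd d ` (U \<inter> fst d)) (\<lambda>x. \<Psi> ((snd c \<circ> cinv d) x))"
    proof (rule smooth_on_compose[OF o2 K(1) _ \<Psi>])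
      show "smooth_on (snd d ` (U \<inter> fst d)) (snd c \<circ> cinv d)"
        by (rule smooth_on_subset[OF transition_smooth[OF d c]]) (auto simp: U_def)
      show "(snd c \<circ> cinv d) ` snd d ` (U \<inter> fst d) \<subseteq> K"
        using d by (auto simp: U_def)
    qed
    then have 2: "smooth_on (snd d ` (U \<inter> fst d)) (\<phi> \<circ> cinv d)"
      by (simp add: \<phi>_def o_def)
    show ?thesis using 1 2 by (simp add: compatible_def case_prod_unfold)
  qed
  have "\<forall>c. is_chart c \<and> (\<forall>d\<in>A. compatible c d) \<longrightarrow> c \<in> A"
    using smooth_structure unfolding smooth_structure_def by (elim conjE)
  then have "(U, \<phi>) \<in> A" using chart comp by blast
  then show "(fst c \<inter> snd c -` K, \<Psi> \<circ> snd c) \<in> A"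
    and "(\<Psi> \<circ> snd c) ` (fst c \<inter> snd c -` K) = V"
    and "\<And>y. y \<in> V \<Longrightarrow> inv_into (fst c \<inter> snd c -` K) (\<Psi> \<circ> snd c) y = cinv c (G y)"
    using im2 inv by (simp_all add: U_def \<phi>_def)
qed

text \<open>In the chart, \<open>u\<close> is a direction \<open>w\<close> with
  \<open>w \<bullet> b = 0\<close>. The straight line through \<open>snd c q\<close> along
  \<open>w\<close> stays in the slice, and \<open>u k\<close> is the derivative of \<open>k\<close>
  along this line; the values of \<open>k\<close> off the slice do not matter. If \<open>k\<close>
  is not smooth, \<open>u k\<close> is 0 by default.\<close>

lemma vanish_on_slice:
  assumes c: "c \<in> A" "q \<in> fst c" "snd c q \<bullet> b = 0"
    and u: "u \<in> tangent_space A q" "u (\<lambda>x. snd c x \<bullet> b) = 0"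
    and k: "\<forall>\<^sub>F x in nhds q. snd c x \<bullet> b = 0 \<longrightarrow> k x = 0"
  shows "u k = 0"
proof (cases "smooth_fun_near A q k")
  case True
  obtain w where w: "u = chart_vec A c q w" using u tangent_space_eq_range[OF c(1,2)] by blast
  have wb: "w \<bullet> b = 0" using u(2) chart_vec_coordinate[OF c(1,2)] w by simp
  let ?K = "k \<circ> cinv c" and ?x = "snd c q"
  let ?l = "\<lambda>t::real. ?x + t *\<^sub>R w"
  have dl: "(?l has_derivative (\<lambda>t. t *\<^sub>R w)) (at 0)" by (auto intro!: derivative_eq_intros)
  have "(?K has_derivative frechet_derivative ?K (at ?x)) (at (?l 0))"
    using smooth_fun_near_has_derivative[OF c(1,2) True] by simp
  from diff_chain_at[OF dl this]
  have d: "((\<lambda>t. ?K (?l t)) has_derivative (\<lambda>t. frechet_derivative ?K (at ?x) (t *\<^sub>R w))) (at 0)"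
    by (simp add: o_def)
  have "\<forall>\<^sub>F x in nhds ?x. snd c (cinv c x) \<bullet> b = 0 \<longrightarrow> k (cinv c x) = 0"
    using k eventually_chart_iff[OF c(1,2), of "\<lambda>x. snd c x \<bullet> b = 0 \<longrightarrow> k x = 0"] by blast
  then have "\<forall>\<^sub>F x in nhds ?x. x \<bullet> b = 0 \<longrightarrow> ?K x = 0"
    using eventually_in_chart_range[OF c(1,2)]
    by eventually_elim (simp add: c(1))
  moreover have "isCont ?l 0" by (intro continuous_intros)
  then have "filterlim ?l (nhds ?x) (nhds 0)" using isCont_imp_filterlim_nhds by fastforce
  ultimately have "\<forall>\<^sub>F t in nhds 0. ?l t \<bullet> b = 0 \<longrightarrow> ?K (?l t) = 0"
    by (rule eventually_compose_filterlim)
  then have "\<forall>\<^sub>F t in nhds 0. ?K (?l t) = 0"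
    using c(3) wb by (simp add: inner_add_left)
  then obtain T where T: "open T" "0 \<in> T" "\<And>t. t \<in> T \<Longrightarrow> ?K (?l t) = 0"
    unfolding eventually_nhds by blast
  have "((\<lambda>t. ?K (?l t)) has_derivative (\<lambda>t. 0)) (at 0)"
    by (rule has_derivative_transform_within_open[OF has_derivative_const[of 0] T(1,2)]) (use T(3) in simp)
  from fun_cong[OF has_derivative_unique[OF d this], of 1]
  show ?thesis by (simp add: w chart_vec_apply[OF True])
qed (use u tangent_vector_not_smooth in blast)

text \<open>For \<open>b = 0\<close> the slice is a whole neighbourhood.\<close>

lemma constant_on_slice:
  assumes c: "c \<in> A" "q \<in> fst c" "snd c q \<bullet> b = 0"
    and f: "smooth_fun_near A q f"
    and v: "\<forall>\<^sub>F x in nhds q. snd c x \<bullet> b = 0 \<longrightarrow>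
      (\<forall>v\<in>tangent_space A x. v (\<lambda>x. snd c x \<bullet> b) = 0 \<longrightarrow> v f = 0)"
  shows "\<forall>\<^sub>F x in nhds q. snd c x \<bullet> b = 0 \<longrightarrow> f x = f q"
proof -
  let ?K = "f \<circ> cinv c" and ?x = "snd c q"
  let ?P = "\<lambda>x. x \<in> fst c \<and> smooth_fun_near A x f \<and> (snd c x \<bullet> b = 0 \<longrightarrow>
      (\<forall>v\<in>tangent_space A x. v (\<lambda>x. snd c x \<bullet> b) = 0 \<longrightarrow> v f = 0))"
  have "\<forall>\<^sub>F x in nhds q. ?P x"
    using eventually_in_chart[OF c(1,2)] eventually_smooth_fun_near[OF f] v
    by (intro eventually_conj)
  then have "\<forall>\<^sub>F y in nhds ?x. ?P (cinv c y)"
    using eventually_chart_iff[OF c(1,2), of ?P] by blast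
  then have "\<forall>\<^sub>F y in nhds ?x. y \<in> snd c ` fst c \<and> ?P (cinv c y)"
    by (rule eventually_conj[OF eventually_in_chart_range[OF c(1,2)]])
  then obtain r where r: "r > 0" "\<And>y. y \<in> ball ?x r \<Longrightarrow> y \<in> snd c ` fst c \<and> ?P (cinv c y)"
    unfolding eventually_nhds_metric by (auto simp: dist_commute)
  have const: "?K x = ?K ?x" if x: "x \<in> ball ?x r" "x \<bullet> b = 0" for x
  proof -
    \<comment> \<open>This segment stays in the ball and in the hyperplane, and its velocity
      represents a vector tangent to the slice. So \<open>f\<close> has zero derivative along
      it.\<close>
    let ?l = "\<lambda>t::real. ?x + t *\<^sub>R (x - ?x)"
    have wb: "(x - ?x) \<bullet> b = 0" using x c(3) by (simp add: inner_diff_left)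
    have "((\<lambda>t. ?K (?l t)) has_derivative (\<lambda>h. 0)) (at t within {0..1})" if t: "t \<in> {0..1}" for t
    proof -
      have "norm (t *\<^sub>R (x - ?x)) \<le> norm (x - ?x)"
        using t by (simp add: mult_left_le_one_le)
      then have lt: "?l t \<in> ball ?x r" using x by (simp add: dist_norm norm_minus_commute)
      define m where "m = cinv c (?l t)"
      have m: "m \<in> fst c" "smooth_fun_near A m f" "snd c m = ?l t" "snd c m \<bullet> b = 0"
        using r(2)[OF lt] c(1,3) wb by (auto simp: m_def inner_add_left)
      have "chart_vec A c m (x - ?x) f = 0"
        using r(2)[OF lt] m(4) chart_vec_in_tangent_space[OF c(1) m(1)]
          chart_vec_coordinate[OF c(1) m(1), of "x - ?x" b] wb
        by (simp add: m_def)
      then have z: "frechet_derivative ?K (at (?l t)) (x - ?x) = 0"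
        by (simp add: chart_vec_apply[OF m(2)] m(3))
      have dK: "(?K has_derivative frechet_derivative ?K (at (?l t))) (at (?l t))"
        using smooth_fun_near_has_derivative[OF c(1) m(1,2)] m(3) by simp
      have dl: "(?l has_derivative (\<lambda>s. s *\<^sub>R (x - ?x))) (at t)" by (auto intro!: derivative_eq_intros)
      from diff_chain_at[OF dl dK]
      have "((\<lambda>t. ?K (?l t)) has_derivative
          (\<lambda>s. frechet_derivative ?K (at (?l t)) (s *\<^sub>R (x - ?x)))) (at t)"
        by (simp add: o_def)
      then show ?thesis
        using linear_scale[OF has_derivative_linear[OF dK]] z
        by (simp add: has_derivative_at_withinI)
    qed
    then have "?K (?l 1) = ?K (?l 0)"
      by (intro has_derivative_zero_unique[of "{0..1}" "\<lambda>t. ?K (?l t)"]) auto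
    then show ?thesis by simp
  qed
  have "\<forall>\<^sub>F y in nhds ?x. y \<in> ball ?x r" using r by (intro eventually_nhds_in_open) auto
  then have "\<forall>\<^sub>F x in nhds q. snd c x \<in> ball ?x r"
    using filterlim_chart[OF c(1,2)] by (rule eventually_compose_filterlim)
  with eventually_in_chart[OF c(1,2)] show ?thesis
  proof eventually_elim
    case (elim x)
    then show ?case using const[of "snd c x"] c by simp
  qed
qed

lemma slice_eq:
  assumes "slice A N V c b" shows "V = {x \<in> fst c. snd c x \<bullet> b = 0}"
proof -
  have c: "c \<in> A" "V \<subseteq> fst c" and im: "snd c ` V = {x \<in> snd c ` fst c. x \<bullet> b = 0}"
    using assms by (auto simp: slice_def)
  have "x \<in> V" if "x \<in> fst c" "snd c x \<bullet> b = 0" for x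
  proof -
    have "snd c x \<in> snd c ` V" using im that by blast
    then obtain y where "y \<in> V" "snd c x = snd c y" by blast
    then show ?thesis using c that cinv_chart by (metis subsetD)
  qed
  moreover have "snd c x \<bullet> b = 0" if "x \<in> V" for x using im that by blast
  ultimately show ?thesis using c by blast
qed

text \<open>A slice carries the subspace topology, so membership in an \<open>N\<close>-open set
  becomes a statement about ordinary neighbourhoods, restricted to the hyperplane. In this way all
  later arguments avoid the finer topology \<open>N\<close>.\<close>

lemma slice_eventually:
  assumes s: "slice A N V c b" and q: "q \<in> V" and S: "openin N S" "q \<in> S"
  shows "\<forall>\<^sub>F x in nhds q. snd c x \<bullet> b = 0 \<longrightarrow> x \<in> S"
proof -
  have c: "c \<in> A" "q \<in> fst c" using s q by (auto simp: slice_def)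
  have "openin (subtopology N V) (V \<inter> S)" using S by (auto simp: openin_subtopology)
  then have "openin (top_of_set V) (V \<inter> S)" using s by (simp add: slice_def)
  then obtain T where T: "open T" "V \<inter> S = V \<inter> T" by (auto simp: openin_open)
  have "\<forall>\<^sub>F x in nhds q. x \<in> T" using T S(2) q by (intro eventually_nhds_in_open) auto
  with eventually_in_chart[OF c] show ?thesis
    by eventually_elim (use T slice_eq[OF s] in auto)
qed

text \<open>\<open>sub_tangent\<close> asks for some slice through \<open>q\<close>. Two such slices
  agree near \<open>q\<close>, so the defining coordinate of the second vanishes along the first,
  and every slice gives the same tangent space.\<close>

lemma slice_tangent_imp:
  assumes s: "slice A N V c b" "q \<in> V" and s': "slice A N V' c' b'" "q \<in> V'"
    and v: "v \<in> tangent_space A q" "v (\<lambda>x. snd c x \<bullet> b) = 0"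
  shows "v (\<lambda>x. snd c' x \<bullet> b') = 0"
proof (rule vanish_on_slice[OF _ _ _ v])
  show "c \<in> A" "q \<in> fst c" "snd c q \<bullet> b = 0" using s slice_eq[OF s(1)] by (auto simp: slice_def)
  have "openin N V'" using s' by (simp add: slice_def)
  from slice_eventually[OF s this s'(2)]
  show "\<forall>\<^sub>F x in nhds q. snd c x \<bullet> b = 0 \<longrightarrow> snd c' x \<bullet> b' = 0"
    by eventually_elim (use slice_eq[OF s'(1)] in auto)
qed

lemma sub_tangent_slice:
  assumes "slice A N V c b" "q \<in> V"
  shows "sub_tangent A N q = {v \<in> tangent_space A q. v (\<lambda>x. snd c x \<bullet> b) = 0}"
  unfolding sub_tangent_def using assms slice_tangent_imp by blast

lemma vanish_on_immersed_hypersurface: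
  assumes N: "immersed_hypersurface A N" and q: "q \<in> topspace N" and u: "u \<in> sub_tangent A N q"
    and S: "openin N S" "q \<in> S" and k: "\<And>x. x \<in> S \<Longrightarrow> k x = 0"
  shows "u k = 0"
proof -
  obtain V c b where s: "slice A N V c b" "q \<in> V" using N q unfolding immersed_hypersurface_def by blast
  have "u \<in> tangent_space A q" "u (\<lambda>x. snd c x \<bullet> b) = 0" using u sub_tangent_slice[OF s] by auto
  moreover have "c \<in> A" "q \<in> fst c" "snd c q \<bullet> b = 0" using s slice_eq[OF s(1)] by (auto simp: slice_def)
  moreover have "\<forall>\<^sub>F x in nhds q. snd c x \<bullet> b = 0 \<longrightarrow> k x = 0"
    using slice_eventually[OF s S] by eventually_elim (use k in blast)
  ultimately show ?thesis using vanish_on_slice by blast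
qed

end

section \<open>Leaves of the kernel of a closed one-form\<close>

text \<open>What is needed to integrate the kernel of a nowhere vanishing closed form. Tangency of
  brackets is an assumption because the interpretation obtains it from a torsion-free
  connection.\<close>

locale closed_form_manifold = smooth_manifold A
  for A :: "('m::t2_space, 'e::euclidean_space) chart set" +
  fixes \<omega> :: "'m form1"
  assumes form_add: "u \<in> tangent_space A p \<Longrightarrow> v \<in> tangent_space A p \<Longrightarrow> \<omega> p (u + v) = \<omega> p u + \<omega> p v"
    and form_scale: "u \<in> tangent_space A p \<Longrightarrow> \<omega> p (a *\<^sub>R u) = a * \<omega> p u"
    and form_smooth: "smooth_field_near A p X \<Longrightarrow> smooth_fun_near A p (\<lambda>q. \<omega> q (X q))"
    and form_closed: "smooth_field_near A p X \<Longrightarrow> smooth_field_near A p Y \<Longrightarrow>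
      \<omega> p (lie_bracket A X Y p) = X p (\<lambda>q. \<omega> q (Y q)) - Y p (\<lambda>q. \<omega> q (X q))"
    and form_nonzero: "\<exists>v\<in>tangent_space A p. \<omega> p v \<noteq> 0"
    and bracket_tangent: "smooth_field_near A p X \<Longrightarrow> smooth_field_near A p Y \<Longrightarrow>
      lie_bracket A X Y p \<in> tangent_space A p"
begin

definition primitive :: "'m set \<Rightarrow> ('m \<Rightarrow> real) \<Rightarrow> bool" where
  "primitive V f \<longleftrightarrow> smooth_fun A V f \<and> (\<forall>q\<in>V. \<forall>v\<in>tangent_space A q. v f = \<omega> q v)"

text \<open>The topology generated by small pieces of level sets of local primitives, expressed
  through neighbourhoods of each point. That the choice of primitive is immaterial is
  \<open>leaf_openD\<close>.\<close>

definition leaf_open :: "'m set \<Rightarrow> bool" where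
  "leaf_open S \<longleftrightarrow> (\<forall>q\<in>S. \<exists>V f. primitive V f \<and> q \<in> V \<and> (\<forall>\<^sub>F x in nhds q. f x = f q \<longrightarrow> x \<in> S))"

definition leaf_topology :: "'m topology" where
  "leaf_topology = topology leaf_open"

definition leaf :: "'m \<Rightarrow> 'm topology" where
  "leaf p = subtopology leaf_topology (connected_component_of_set leaf_topology p)"

abbreviation kernel :: "'m \<Rightarrow> 'm tvec set" where
  "kernel q \<equiv> {v \<in> tangent_space A q. \<omega> q v = 0}"

text \<open>A coordinate field takes constant values on coordinate functions, so the bracket
  annihilates all coordinates. As a tangent vector it is then zero; symmetry of second derivatives
  does not have to be discussed.\<close>

lemma lie_bracket_chart_vec:
  assumes c: "c \<in> A" "p \<in> fst c"
  shows "lie_bracket A (\<lambda>q. chart_vec A c q u) (\<lambda>q. chart_vec A c q w) p = 0"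
proof -
  let ?X = "\<lambda>u q. chart_vec A c q u"
  have n: "smooth_field_near A p (?X u)" for u by (rule smooth_field_near_chart_vec[OF c])
  have z: "?X u p (\<lambda>q. ?X w q (\<lambda>x. snd c x \<bullet> b)) = 0" for u w b
  proof (rule tangent_vector_const_near[OF chart_vec_in_tangent_space[OF c]])
    show "\<forall>\<^sub>F q in nhds p. ?X w q (\<lambda>x. snd c x \<bullet> b) = w \<bullet> b"
      using eventually_in_chart[OF c] by eventually_elim (rule chart_vec_coordinate[OF c(1)])
  qed
  have "lie_bracket A (?X u) (?X w) p (\<lambda>x. snd c x \<bullet> b) = 0" for b
    by (simp add: lie_bracket_def z)
  then show ?thesis
    using tangent_vector_coordinates[OF c bracket_tangent[OF n n], of u w] linear_0[OF linear_chart_vec[OF c]]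
    by simp
qed

lemma form_zero: "\<omega> p 0 = 0"
  using form_scale[OF tangent_space_zero, of p 0] by simp

text \<open>In a chart \<omega> becomes the vector function \<open>a\<close> of its coefficients.
  Coordinate fields commute, so closedness of \<omega> is exactly symmetry of the derivative of
  \<open>a\<close>, and \<open>poincare_ball\<close> applies on a small ball of the chart.\<close>

lemma ex_primitive: obtains V f where "primitive V f" "p \<in> V"
proof -
  obtain c where c: "c \<in> A" "p \<in> fst c" using ex_chart by blast
  define X where "X = (\<lambda>b q. chart_vec A c q b)"
  define w where "w = (\<lambda>b q. \<omega> q (X b q))"
  define a where "a = (\<lambda>x. \<Sum>b\<in>Basis. w b (cinv c x) *\<^sub>R b)"
  obtain r where r: "r > 0" "ball (snd c p) r \<subseteq> snd c ` fst c"
    using open_chart_range[OF c(1)] c(2) openE by blast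
  let ?U = "ball (snd c p) r"
  have X: "smooth_field_near A q (X b)" if "q \<in> fst c" for q b
    unfolding X_def by (rule smooth_field_near_chart_vec[OF c(1) that])
  have w: "smooth_fun_near A q (w b)" if "q \<in> fst c" for q b
    unfolding w_def by (rule form_smooth[OF X[OF that]])
  have sw: "smooth_on ?U (w b \<circ> cinv c)" for b
  proof -
    have "smooth_fun A (fst c) (w b)" by (rule smooth_fun_localI[OF open_chart_domain[OF c(1)] w])
    then have "smooth_on (snd c ` (fst c \<inter> fst c)) (w b \<circ> cinv c)"
      using c(1) unfolding smooth_fun_iff by blast
    then show ?thesis by (rule smooth_on_subset) (use r in simp)
  qed
  have sa: "smooth_on ?U a"
    unfolding a_def using sw
    by (intro smooth_on_sum smooth_on_scaleR smooth_on_const open_ball) (simp add: o_def)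
  have ab: "a x \<bullet> b = w b (cinv c x)" if "b \<in> Basis" for x b
    using that by (simp add: a_def inner_sum_left inner_Basis if_distrib cong: if_cong)
  have da: "frechet_derivative a (at x) v \<bullet> b = X v (cinv c x) (w b)"
    if x: "x \<in> ?U" and b: "b \<in> Basis" for x v b
  proof -
    have q: "cinv c x \<in> fst c" "snd c (cinv c x) = x" using x r c(1) by (auto intro: chart_cinv)
    have "((\<lambda>x. a x \<bullet> b) has_derivative (\<lambda>v. frechet_derivative a (at x) v \<bullet> b)) (at x)"
      using has_derivative_inner_left[OF smooth_on_has_derivative[OF open_ball sa x]] .
    then have "((w b \<circ> cinv c) has_derivative (\<lambda>v. frechet_derivative a (at x) v \<bullet> b)) (at x)"
      by (simp add: ab[OF b] o_def)
    then show ?thesis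
      using chart_vec_eqI[OF c(1) q(1) w[OF q(1)]] q(2) by (simp add: X_def)
  qed
  have sym: "frechet_derivative a (at x) b \<bullet> k = frechet_derivative a (at x) k \<bullet> b"
    if "x \<in> ?U" "b \<in> Basis" "k \<in> Basis" for x b k
  proof -
    have q: "cinv c x \<in> fst c" using that r c(1) cinv_in_domain by blast
    have "X b (cinv c x) (w k) - X k (cinv c x) (w b) = 0"
      using form_closed[OF X[OF q, of b] X[OF q, of k]] lie_bracket_chart_vec[OF c(1) q] form_zero
      by (simp add: w_def X_def)
    then show ?thesis using da that by simp
  qed
  obtain F where F: "\<And>x. x \<in> ?U \<Longrightarrow> (F has_derivative (\<lambda>v. a x \<bullet> v)) (at x)"
    by (rule poincare_ball[OF sa]) (erule (2) sym, rule that, blast)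
  have sF: "smooth_on ?U F"
    by (rule smooth_onI_derivative[OF open_ball F smooth_on_inner[OF open_ball sa]])
  define V where "V = fst c \<inter> snd c -` ?U"
  define f where "f = F \<circ> snd c"
  have dF: "((f \<circ> cinv c) has_derivative (\<lambda>v. a (snd c q) \<bullet> v)) (at (snd c q))" if "q \<in> V" for q
    by (rule has_derivative_transform_within_open[OF F open_ball])
       (use that r c(1) in \<open>auto simp: V_def f_def subset_iff\<close>)
  have near: "smooth_fun_near A q f" if "q \<in> V" for q
  proof -
    have "smooth_on ?U (f \<circ> cinv c)"
      by (rule smooth_on_cong[OF open_ball _ sF]) (use r c(1) in \<open>auto simp: f_def subset_iff\<close>)
    moreover have "q \<in> fst c" "snd c q \<in> ?U" using that by (auto simp: V_def)
    ultimately show ?thesis using smooth_fun_near_chart_iff[OF c(1)] open_ball by metis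
  qed
  have "v f = \<omega> q v" if q: "q \<in> V" and v: "v \<in> tangent_space A q" for q v
  proof -
    have qc: "q \<in> fst c" using q by (simp add: V_def)
    obtain u where u: "v = chart_vec A c q u" using v tangent_space_eq_range[OF c(1) qc] by blast
    have "linear (\<lambda>u. \<omega> q (chart_vec A c q u))"
      using linear_chart_vec[OF c(1) qc] chart_vec_in_tangent_space[OF c(1) qc]
      by (intro linearI) (simp_all add: linear_add linear_scale form_add form_scale)
    from linear_basis_expand[OF this, of u]
    have "\<omega> q v = (\<Sum>b\<in>Basis. (u \<bullet> b) * (a (snd c q) \<bullet> b))"
      using c(1) qc by (simp add: u ab w_def X_def)
    then show ?thesis
      using chart_vec_eqI[OF c(1) qc near[OF q] dF[OF q], of u]
      by (simp add: u euclidean_inner[of "a _" u] mult.commute)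
  qed
  moreover have "smooth_fun A V f"
    by (rule smooth_fun_localI[OF _ near]) (simp_all add: V_def open_chart_vimage[OF c(1)])
  moreover have "p \<in> V" using c r by (simp add: V_def)
  ultimately show ?thesis using that[of V f] unfolding primitive_def by blast
qed

section \<open>The topology of plaques\<close>

lemma primitiveD: "primitive V f \<Longrightarrow> q \<in> V \<Longrightarrow> v \<in> tangent_space A q \<Longrightarrow> v f = \<omega> q v"
  by (simp add: primitive_def)

lemma primitive_open: "primitive V f \<Longrightarrow> open V"
  by (simp add: primitive_def smooth_fun_iff)

lemma primitive_near: "primitive V f \<Longrightarrow> q \<in> V \<Longrightarrow> smooth_fun_near A q f"
  using smooth_fun_imp_near by (auto simp: primitive_def)

lemma primitive_eventually: "primitive V f \<Longrightarrow> q \<in> V \<Longrightarrow> \<forall>\<^sub>F x in nhds q. x \<in> V"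
  using primitive_open eventually_nhds_in_open by blast

text \<open>The difference has zero differential. With the zero vector in the role of
  \<open>b\<close>, \<open>constant_on_slice\<close> turns this into local constancy.\<close>

lemma primitive_diff_constant:
  assumes f: "primitive V f" "q \<in> V" and k: "primitive V' k" "q \<in> V'"
  shows "\<forall>\<^sub>F x in nhds q. f x - k x = f q - k q"
proof -
  obtain c where c: "c \<in> A" "q \<in> fst c" using ex_chart by blast
  have "\<forall>\<^sub>F x in nhds q. snd c x \<bullet> 0 = 0 \<longrightarrow> (\<lambda>x. f x - k x) x = (\<lambda>x. f x - k x) q"
  proof (rule constant_on_slice[OF c])
    show "smooth_fun_near A q (\<lambda>x. f x - k x)"
      by (intro smooth_fun_near_diff primitive_near[OF f] primitive_near[OF k])
    show "\<forall>\<^sub>F x in nhds q. snd c x \<bullet> 0 = 0 \<longrightarrow>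
      (\<forall>v\<in>tangent_space A x. v (\<lambda>x. snd c x \<bullet> 0) = 0 \<longrightarrow> v (\<lambda>x. f x - k x) = 0)"
      using primitive_eventually[OF f] primitive_eventually[OF k]
    proof eventually_elim
      case (elim x)
      show ?case
      proof (intro impI ballI)
        fix v assume v: "v \<in> tangent_space A x"
        from tangent_vector_diff[OF v primitive_near[OF f(1) elim(1)] primitive_near[OF k(1) elim(2)]]
        show "v (\<lambda>x. f x - k x) = 0"
          using primitiveD[OF f(1) elim(1) v] primitiveD[OF k(1) elim(2) v] by simp
      qed
    qed
  qed simp
  then show ?thesis by simp
qed

text \<open>Primitives differ by local constants, so near \<open>q\<close> they have the same level
  sets and any of them can test leaf-openness. Without this freedom of choice, two leaf-open sets
  could not be intersected.\<close>

lemma leaf_openD: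
  assumes S: "leaf_open S" "q \<in> S" and f: "primitive V f" "q \<in> V"
  shows "\<forall>\<^sub>F x in nhds q. f x = f q \<longrightarrow> x \<in> S"
proof -
  obtain V' k where k: "primitive V' k" "q \<in> V'" and ev: "\<forall>\<^sub>F x in nhds q. k x = k q \<longrightarrow> x \<in> S"
    using S unfolding leaf_open_def by blast
  from ev primitive_diff_constant[OF f k] show ?thesis by eventually_elim auto
qed

lemma openin_leaf_topology: "openin leaf_topology = leaf_open"
  unfolding leaf_topology_def
proof (rule topology_inverse', unfold istopology_def, intro conjI allI impI)
  fix S T assume S: "leaf_open S" and T: "leaf_open T"
  show "leaf_open (S \<inter> T)"
    unfolding leaf_open_def
  proof
    fix q assume q: "q \<in> S \<inter> T"
    obtain V f where f: "primitive V f" "q \<in> V" using ex_primitive .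
    have "\<forall>\<^sub>F x in nhds q. f x = f q \<longrightarrow> x \<in> S" "\<forall>\<^sub>F x in nhds q. f x = f q \<longrightarrow> x \<in> T"
      using leaf_openD[OF S _ f] leaf_openD[OF T _ f] q by auto
    then have "\<forall>\<^sub>F x in nhds q. f x = f q \<longrightarrow> x \<in> S \<inter> T" by eventually_elim blast
    then show "\<exists>V f. primitive V f \<and> q \<in> V \<and> (\<forall>\<^sub>F x in nhds q. f x = f q \<longrightarrow> x \<in> S \<inter> T)"
      using f by blast
  qed
next
  fix K assume K: "\<forall>S\<in>K. leaf_open S"
  show "leaf_open (\<Union>K)"
    unfolding leaf_open_def
  proof
    fix q assume "q \<in> \<Union>K"
    then obtain S where S: "S \<in> K" "q \<in> S" by blast
    obtain V f where f: "primitive V f" "q \<in> V" using ex_primitive .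
    have "leaf_open S" using K S by blast
    from leaf_openD[OF this S(2) f]
    have "\<forall>\<^sub>F x in nhds q. f x = f q \<longrightarrow> x \<in> \<Union>K"
      by eventually_elim (use S in blast)
    then show "\<exists>V f. primitive V f \<and> q \<in> V \<and> (\<forall>\<^sub>F x in nhds q. f x = f q \<longrightarrow> x \<in> \<Union>K)"
      using f by blast
  qed
qed

lemma open_imp_leaf_open:
  assumes "open S" shows "leaf_open S"
  unfolding leaf_open_def
proof
  fix q assume "q \<in> S"
  then have S: "\<forall>\<^sub>F x in nhds q. x \<in> S" by (rule eventually_nhds_in_open[OF assms])
  obtain V f where f: "primitive V f" "q \<in> V" using ex_primitive .
  have "\<forall>\<^sub>F x in nhds q. f x = f q \<longrightarrow> x \<in> S" using S by eventually_elim simp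
  then show "\<exists>V f. primitive V f \<and> q \<in> V \<and> (\<forall>\<^sub>F x in nhds q. f x = f q \<longrightarrow> x \<in> S)"
    using f by blast
qed

lemma topspace_leaf_topology: "topspace leaf_topology = UNIV"
  using openin_subset[of leaf_topology UNIV] open_imp_leaf_open[OF open_UNIV]
  by (auto simp: openin_leaf_topology)

lemma leaf_open_plaque:
  assumes "primitive V f" shows "leaf_open {x \<in> V. f x = a}"
  unfolding leaf_open_def
proof
  fix q assume q: "q \<in> {x \<in> V. f x = a}"
  have "\<forall>\<^sub>F x in nhds q. f x = f q \<longrightarrow> x \<in> {x \<in> V. f x = a}"
    using primitive_eventually[OF assms, of q] q by (auto elim: eventually_mono)
  then show "\<exists>V' k. primitive V' k \<and> q \<in> V' \<and> (\<forall>\<^sub>F x in nhds q. k x = k q \<longrightarrow> x \<in> {x \<in> V. f x = a})"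
    using assms q by blast
qed

text \<open>By \<open>leaf_openD\<close> a leaf-open set contains, near each of its points, the
  whole piece of the level set through it, and inside the plaque such a piece is a relative
  neighbourhood. The converse holds because open sets are leaf-open.\<close>

lemma subtopology_plaque:
  assumes f: "primitive V f"
  shows "subtopology leaf_topology {x \<in> V. f x = a} = top_of_set {x \<in> V. f x = a}"
proof (rule topology_eq[THEN iffD2], intro allI)
  fix S
  let ?P = "{x \<in> V. f x = a}"
  show "openin (subtopology leaf_topology ?P) S \<longleftrightarrow> openin (top_of_set ?P) S"
  proof
    assume "openin (subtopology leaf_topology ?P) S"
    then obtain U where U: "leaf_open U" "S = U \<inter> ?P"
      by (auto simp: openin_subtopology openin_leaf_topology)
    have "\<exists>T. open T \<and> q \<in> T \<and> T \<inter> ?P \<subseteq> S" if q: "q \<in> S" for q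
    proof -
      have "\<forall>\<^sub>F x in nhds q. f x = f q \<longrightarrow> x \<in> U" using leaf_openD[OF U(1) _ f] q U(2) by auto
      then obtain T where "open T" "q \<in> T" "\<And>x. x \<in> T \<Longrightarrow> f x = f q \<longrightarrow> x \<in> U"
        unfolding eventually_nhds by blast
      then show ?thesis using q U(2) by (intro exI[of _ T]) auto
    qed
    then obtain T where T: "\<And>q. q \<in> S \<Longrightarrow> open (T q) \<and> q \<in> T q \<and> T q \<inter> ?P \<subseteq> S" by metis
    then have "S = ?P \<inter> (\<Union>q\<in>S. T q)" using U(2) by blast
    moreover have "open (\<Union>q\<in>S. T q)" using T by (intro open_UN) blast
    ultimately show "openin (top_of_set ?P) S"
      unfolding openin_open by (intro exI[of _ "\<Union>q\<in>S. T q"] conjI)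
  next
    assume "openin (top_of_set ?P) S"
    then obtain T where T: "open T" "S = ?P \<inter> T" unfolding openin_open by blast
    show "openin (subtopology leaf_topology ?P) S"
      unfolding openin_subtopology openin_leaf_topology
      by (rule exI[of _ T]) (simp add: T(2) open_imp_leaf_open[OF T(1)] Int_commute)
  qed
qed

lemma primitive_subset: "primitive V f \<Longrightarrow> open V' \<Longrightarrow> V' \<subseteq> V \<Longrightarrow> primitive V' f"
  unfolding primitive_def using smooth_fun_subset by blast

text \<open>Since \<omega> is nonzero at \<open>p\<close>, some partial derivative of
  \<open>f\<close> is nonzero there, so \<open>f\<close> can serve as a coordinate. The plaque
  through \<open>p\<close> becomes the coordinate hyperplane that \<open>slice\<close>
  requires.\<close>

lemma adapted_chart:
  assumes f: "primitive V f" "p \<in> V"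
  obtains c b r where "c \<in> A" "b \<in> Basis" "p \<in> fst c" "fst c \<subseteq> V" "r > 0" "snd c ` fst c = ball 0 r"
    "\<And>x. x \<in> fst c \<Longrightarrow> snd c x \<bullet> b = f x - f p"
proof -
  obtain c where c: "c \<in> A" "p \<in> fst c" using ex_chart by blast
  define F where "F = f \<circ> cinv c"
  let ?x = "snd c p"
  define T where "T = snd c ` (fst c \<inter> V)"
  have T: "open T" "?x \<in> T" unfolding T_def
    using open_chart_image[OF c(1) primitive_open[OF f(1)]] c f by auto
  have F: "smooth_on T F"
    using f(1) c(1) unfolding T_def F_def primitive_def smooth_fun_iff by blast
  let ?D = "frechet_derivative F (at ?x)"
  have dF: "(F has_derivative ?D) (at ?x)" by (rule smooth_on_has_derivative[OF T(1) F T(2)])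
  obtain v where v: "v \<in> tangent_space A p" "\<omega> p v \<noteq> 0" using form_nonzero by blast
  obtain u where u: "v = chart_vec A c p u" using v tangent_space_eq_range[OF c] by blast
  have "v f \<noteq> 0" using primitiveD[OF f v(1)] v(2) by simp
  then have "?D u \<noteq> 0" using chart_vec_apply[OF primitive_near[OF f]] by (simp add: u F_def)
  then have "(\<Sum>b\<in>Basis. (u \<bullet> b) *\<^sub>R ?D b) \<noteq> 0"
    using linear_basis_expand[OF has_derivative_linear[OF dF], of u] by simp
  then obtain b where b: "b \<in> Basis" "(u \<bullet> b) *\<^sub>R ?D b \<noteq> 0"
    by (rule sum.not_neutral_contains_not_neutral)
  then have b: "b \<in> Basis" "?D b \<noteq> 0" by auto
  \<comment> \<open>The \<open>b\<close>-coordinate of \<open>x - ?x\<close> is replaced by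
    \<open>F x - F ?x\<close> and the others are kept. The derivative is injective: a vector in its
    kernel is a multiple of \<open>b\<close> annihilated by \<open>?D\<close>, and
    \<open>?D b\<close> is nonzero.\<close>
  define \<Psi> where "\<Psi> = (\<lambda>x. (x - ?x) + (((F x - F ?x) - (x - ?x) \<bullet> b) *\<^sub>R b))"
  have s\<Psi>: "smooth_on T \<Psi>"
  proof -
    have id: "smooth_on T (\<lambda>x. x - ?x)"
      using smooth_on_add[OF T(1) smooth_on_bounded_linear[OF T(1) bounded_linear_ident] smooth_on_const[of T "- ?x"]]
      by simp
    have "smooth_on T (\<lambda>x. F x + (- F ?x))" by (intro smooth_on_add T F smooth_on_const)
    moreover have "smooth_on T (\<lambda>x. (- 1) * ((x - ?x) \<bullet> b))"
      by (intro smooth_on_mult smooth_on_inner id T smooth_on_const)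
    ultimately have "smooth_on T (\<lambda>x. (F x + (- F ?x)) + (- 1) * ((x - ?x) \<bullet> b))"
      by (rule smooth_on_add[OF T(1)])
    then have "smooth_on T (\<lambda>x. (F x - F ?x) - (x - ?x) \<bullet> b)" by simp
    then show ?thesis unfolding \<Psi>_def by (intro smooth_on_add id smooth_on_scaleR smooth_on_const T)
  qed
  have d\<Psi>: "(\<Psi> has_derivative (\<lambda>w. w + (?D w - w \<bullet> b) *\<^sub>R b)) (at ?x)"
    unfolding \<Psi>_def by (auto intro!: derivative_eq_intros dF)
  have inj: "w = 0" if "frechet_derivative \<Psi> (at ?x) w = 0" for w
  proof -
    have e: "w + (?D w - w \<bullet> b) *\<^sub>R b = 0"
      using that fun_cong[OF frechet_derivative_at[OF d\<Psi>], of w] by simp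
    then have "(w + (?D w - w \<bullet> b) *\<^sub>R b) \<bullet> b = 0" by simp
    then have Dw: "?D w = 0" using b by (simp add: inner_add_left)
    then have w: "w = (w \<bullet> b) *\<^sub>R b" using e by simp
    then have "?D w = (w \<bullet> b) * ?D b"
      using linear_scale[OF has_derivative_linear[OF dF], of "w \<bullet> b" b] by simp
    then show ?thesis using Dw b w by simp
  qed
  obtain U V' G where U: "open U" "?x \<in> U" "U \<subseteq> T" "open V'" "homeomorphism U V' \<Psi> G" "smooth_on V' G"
    by (rule smooth_inverse_function[OF T(1) s\<Psi> T(2) inj]) (assumption, rule that)
  have \<Psi>0: "\<Psi> ?x = 0" by (simp add: \<Psi>_def)
  then have "0 \<in> V'" using U by (metis homeomorphism_def imageI)
  then obtain r where r: "r > 0" "ball 0 r \<subseteq> V'" using U(4) openE by blast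
  \<comment> \<open>With a ball as chart image the hyperplane section is convex, hence connected;
    \<open>leaf_slice\<close> relies on this.\<close>
  define K where "K = U \<inter> \<Psi> -` ball 0 r"
  have \<Psi>c: "continuous_on U \<Psi>" using U(5) by (simp add: homeomorphism_def)
  have K: "open K" unfolding K_def by (rule continuous_open_preimage[OF \<Psi>c U(1) open_ball])
  have "\<Psi> ` K = ball 0 r"
    using U(5) r(2) unfolding K_def homeomorphism_def by force
  then have hom: "homeomorphism K (ball 0 r) \<Psi> G"
    by (rule homeomorphism_of_subsets[OF U(5) _ r(2), rotated]) (simp add: K_def)
  have KT: "K \<subseteq> T" using U(3) by (auto simp: K_def)
  then have Kc: "K \<subseteq> snd c ` fst c" by (auto simp: T_def)
  note cc = compose_chart[OF c(1) K Kc open_ball hom smooth_on_subset[OF s\<Psi> KT] smooth_on_subset[OF U(6) r(2)]]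
  let ?c = "(fst c \<inter> snd c -` K, \<Psi> \<circ> snd c)"
  show ?thesis
  proof (rule that[of ?c b r])
    show "?c \<in> A" by (rule cc(1))
    show "snd ?c ` fst ?c = ball 0 r" using cc(2) by simp
    show "p \<in> fst ?c" using c U(2) \<Psi>0 r by (simp add: K_def)
    show "fst ?c \<subseteq> V"
    proof
      fix x assume "x \<in> fst ?c"
      then have "x \<in> fst c" "snd c x \<in> T" using KT by auto
      then obtain y where "y \<in> fst c" "y \<in> V" "snd c x = snd c y" by (auto simp: T_def)
      then show "x \<in> V" using c(1) \<open>x \<in> fst c\<close> cinv_chart by metis
    qed
    show "snd ?c x \<bullet> b = f x - f p" if "x \<in> fst ?c" for x
      using that b c by (simp add: \<Psi>_def F_def inner_add_left inner_diff_left)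
  qed (use b r in auto)
qed

section \<open>Leaves as connected components\<close>

lemma topspace_leaf: "topspace (leaf p) = connected_component_of_set leaf_topology p"
  by (simp add: leaf_def topspace_leaf_topology)

lemma mem_leaf: "p \<in> topspace (leaf p)"
  by (simp add: topspace_leaf connected_component_of_refl topspace_leaf_topology)

text \<open>The plaque of an adapted chart is the image of a hyperplane section of a ball, so it is
  connected. It stays connected in the leaf topology, which induces the subspace topology on
  plaques. Hence it lies in the component of \<open>q\<close>, where it is open.\<close>

lemma leaf_slice:
  assumes q: "q \<in> topspace (leaf p)"
  obtains P c b f V where "slice A (leaf p) P c b" "q \<in> P" "primitive V f" "q \<in> V" "fst c \<subseteq> V"
    "\<And>x. x \<in> fst c \<Longrightarrow> snd c x \<bullet> b = f x - f q"
proof -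
  obtain V f where f: "primitive V f" "q \<in> V" using ex_primitive .
  obtain c b r where c: "c \<in> A" "b \<in> Basis" "q \<in> fst c" "fst c \<subseteq> V" "r > 0" "snd c ` fst c = ball 0 r"
    and cf: "\<And>x. x \<in> fst c \<Longrightarrow> snd c x \<bullet> b = f x - f q"
    by (rule adapted_chart[OF f]) blast
  let ?C = "connected_component_of_set leaf_topology p"
  have fc: "primitive (fst c) f" by (rule primitive_subset[OF f(1) open_chart_domain[OF c(1)] c(4)])
  define P where "P = {x \<in> fst c. f x = f q}"
  have P': "P = {x \<in> fst c. snd c x \<bullet> b = 0}" using cf by (auto simp: P_def)
  have "P = cinv c ` (ball 0 r \<inter> {x. x \<bullet> b = 0})"
  proof -
    have "x \<in> cinv c ` (ball 0 r \<inter> {x. x \<bullet> b = 0})" if "x \<in> P" for x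
    proof (rule image_eqI)
      show "x = cinv c (snd c x)" using that c(1) by (simp add: P')
      have "snd c x \<in> snd c ` fst c" using that by (simp add: P')
      then show "snd c x \<in> ball 0 r \<inter> {x. x \<bullet> b = 0}" using that c(6) by (simp add: P')
    qed
    moreover have "cinv c y \<in> P" if "y \<in> ball 0 r \<inter> {x. x \<bullet> b = 0}" for y
    proof -
      have y: "y \<in> snd c ` fst c" "y \<bullet> b = 0" using that c(6) by simp_all
      show ?thesis using cinv_in_domain[OF c(1) y(1)] chart_cinv[OF c(1) y(1)] y(2) by (simp add: P')
    qed
    ultimately show ?thesis by blast
  qed
  moreover have "connected (cinv c ` (ball 0 r \<inter> {x. x \<bullet> b = 0}))"
  proof (rule connected_continuous_image)
    show "continuous_on (ball 0 r \<inter> {x. x \<bullet> b = 0}) (cinv c)"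
      by (rule continuous_on_subset[OF continuous_on_cinv[OF c(1)]]) (simp add: c(6))
    have "convex {x::'e. x \<bullet> b = 0}" using convex_hyperplane[of b 0] by (simp add: inner_commute)
    then show "connected (ball 0 r \<inter> {x. x \<bullet> b = 0})"
      by (intro convex_connected convex_Int convex_ball)
  qed
  ultimately have conn: "connected P" by simp
  have st: "subtopology leaf_topology P = top_of_set P"
    using subtopology_plaque[OF fc, of "f q"] by (simp add: P_def)
  have "connectedin (top_of_set P) P" using conn by simp
  then have "connectedin leaf_topology P" using st connectedin_absolute by metis
  moreover have qP: "q \<in> P" using c by (simp add: P_def)
  ultimately have "P \<subseteq> connected_component_of_set leaf_topology q"
    by (rule connected_component_of_maximal)
  moreover have "connected_component_of_set leaf_topology q = ?C"
  proof -
    have "connected_component_of leaf_topology p q" using q by (simp add: topspace_leaf)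
    then have "connected_component_of leaf_topology p = connected_component_of leaf_topology q"
      using connected_component_of_equiv[of leaf_topology p q] by (elim iffD1[THEN conjunct2, THEN conjunct2])
    then show ?thesis by simp
  qed
  ultimately have PC: "P \<subseteq> ?C" by simp
  have "leaf_open P" unfolding P_def by (rule leaf_open_plaque[OF fc])
  then have "openin (leaf p) P"
    unfolding leaf_def openin_subtopology openin_leaf_topology
    by (intro exI[of _ P] conjI Int_absorb2[OF PC, symmetric])
  moreover have "subtopology (leaf p) P = top_of_set P"
    using st PC by (simp add: leaf_def subtopology_subtopology inf_absorb2)
  moreover have "snd c ` P = {x \<in> snd c ` fst c. x \<bullet> b = 0}" unfolding P' by auto
  moreover have "P \<subseteq> fst c" by (auto simp: P_def)
  ultimately have "slice A (leaf p) P c b"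
    using c(1,2) unfolding slice_def by (intro conjI)
  then show ?thesis using that qP f c(4) cf by blast
qed

lemma leaf_integral_manifold: "connected_integral_manifold A kernel (leaf p)"
  unfolding connected_integral_manifold_def
proof (intro conjI ballI)
  show "immersed_hypersurface A (leaf p)"
    unfolding immersed_hypersurface_def
  proof
    fix q assume q: "q \<in> topspace (leaf p)"
    show "\<exists>W c b. slice A (leaf p) W c b \<and> q \<in> W"
      by (rule leaf_slice[OF q]) blast
  qed
  show "topspace (leaf p) \<noteq> {}" using mem_leaf by blast
  show "connected_space (leaf p)"
    using connectedin_connected_component_of[of leaf_topology p] by (simp add: leaf_def connectedin_def)
  fix q assume q: "q \<in> topspace (leaf p)"
  obtain P c b f V where s: "slice A (leaf p) P c b" "q \<in> P" and f: "primitive V f" "q \<in> V"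
    and cf: "\<And>x. x \<in> fst c \<Longrightarrow> snd c x \<bullet> b = f x - f q"
    by (rule leaf_slice[OF q]) blast
  have c: "c \<in> A" "q \<in> fst c" using s by (auto simp: slice_def)
  have "v (\<lambda>x. snd c x \<bullet> b) = \<omega> q v" if v: "v \<in> tangent_space A q" for v
  proof -
    have "\<forall>\<^sub>F x in nhds q. snd c x \<bullet> b = f x - f q"
      using eventually_in_chart[OF c] by eventually_elim (rule cf)
    from tangent_vector_cong[OF v this]
    show ?thesis
      using tangent_vector_diff[OF v primitive_near[OF f] smooth_fun_near_const] tangent_vector_const[OF v]
        primitiveD[OF f v]
      by simp
  qed
  then show "sub_tangent A (leaf p) q = kernel q"
    unfolding sub_tangent_slice[OF s] by auto
qed

text \<open>A primitive is annihilated by the kernel of \<omega>, hence locally constant along the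
  slices of \<open>N\<close>, and small pieces of slices lie in plaques. Every integral manifold
  thus has a topology at least as fine as the one induced by the leaf topology, which is what
  maximality of leaves rests on.\<close>

lemma integral_manifold_continuous:
  assumes N: "connected_integral_manifold A kernel N"
  shows "continuous_map N leaf_topology id"
  unfolding continuous_map_def
proof (intro conjI allI impI)
  show "id \<in> topspace N \<rightarrow> topspace leaf_topology" by (simp add: topspace_leaf_topology)
  fix U assume "openin leaf_topology U"
  then have U: "leaf_open U" by (simp add: openin_leaf_topology)
  have imm: "immersed_hypersurface A N" and st: "\<And>q. q \<in> topspace N \<Longrightarrow> sub_tangent A N q = kernel q"
    using N by (auto simp: connected_integral_manifold_def)
  show "openin N {x \<in> topspace N. id x \<in> U}"
  proof (subst openin_subopen, intro ballI)
    fix q assume q: "q \<in> {x \<in> topspace N. id x \<in> U}"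
    obtain V' c b where s: "slice A N V' c b" "q \<in> V'"
      using imm q unfolding immersed_hypersurface_def by blast
    have c: "c \<in> A" "q \<in> fst c" "snd c q \<bullet> b = 0" and oV: "openin N V'"
      using s slice_eq[OF s(1)] by (auto simp: slice_def)
    obtain V f where f: "primitive V f" "q \<in> V" using ex_primitive .
    have "\<forall>\<^sub>F x in nhds q. snd c x \<bullet> b = 0 \<longrightarrow> f x = f q"
    proof (rule constant_on_slice[OF c primitive_near[OF f]])
      show "\<forall>\<^sub>F x in nhds q. snd c x \<bullet> b = 0 \<longrightarrow>
          (\<forall>v\<in>tangent_space A x. v (\<lambda>x. snd c x \<bullet> b) = 0 \<longrightarrow> v f = 0)"
        using primitive_eventually[OF f] eventually_in_chart[OF c(1,2)]
      proof eventually_elim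
        case (elim x)
        show ?case
        proof (intro impI ballI)
          fix v assume x: "snd c x \<bullet> b = 0" and v: "v \<in> tangent_space A x" "v (\<lambda>x. snd c x \<bullet> b) = 0"
          have "x \<in> V'" using x elim slice_eq[OF s(1)] by blast
          then have "v \<in> sub_tangent A N x" "x \<in> topspace N"
            using sub_tangent_slice[OF s(1)] v openin_subset[OF oV] by auto
          then show "v f = 0" using st primitiveD[OF f(1) elim(1) v(1)] by simp
        qed
      qed
    qed
    moreover have "\<forall>\<^sub>F x in nhds q. f x = f q \<longrightarrow> x \<in> U" using leaf_openD[OF U _ f] q by simp
    ultimately have "\<forall>\<^sub>F x in nhds q. snd c x \<bullet> b = 0 \<longrightarrow> x \<in> U" by eventually_elim blast
    then obtain T where T: "open T" "q \<in> T" "\<And>x. x \<in> T \<Longrightarrow> snd c x \<bullet> b = 0 \<longrightarrow> x \<in> U"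
      unfolding eventually_nhds by blast
    have "openin (top_of_set V') (V' \<inter> T)" using T(1) by (auto simp: openin_open)
    then have "openin N (V' \<inter> T)"
      using s(1) oV openin_trans_full unfolding slice_def by metis
    moreover have "V' \<inter> T \<subseteq> {x \<in> topspace N. id x \<in> U}"
      using T(3) slice_eq[OF s(1)] openin_subset[OF oV] by auto
    ultimately show "\<exists>T. openin N T \<and> q \<in> T \<and> T \<subseteq> {x \<in> topspace N. id x \<in> U}"
      using s(2) T(2) by blast
  qed
qed

text \<open>A connected integral manifold through \<open>p\<close> is still connected in the coarser
  leaf topology, so it cannot exceed the component of \<open>p\<close>.\<close>

lemma leaf_is_leaf: "is_leaf A kernel (leaf p)"
  unfolding is_leaf_def
proof (intro conjI allI impI leaf_integral_manifold)
  fix N assume N: "connected_integral_manifold A kernel N \<and> topspace (leaf p) \<subseteq> topspace N"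
  then have "connectedin N (topspace N)"
    by (simp add: connectedin_topspace connected_integral_manifold_def)
  then have "connectedin leaf_topology (id ` topspace N)"
    using N by (intro connectedin_continuous_map_image[OF integral_manifold_continuous]) auto
  moreover have "p \<in> id ` topspace N" using N mem_leaf by auto
  ultimately have "id ` topspace N \<subseteq> topspace (leaf p)"
    unfolding topspace_leaf by (rule connected_component_of_maximal)
  then show "topspace N = topspace (leaf p)" using N by auto
qed

end

section \<open>Screen leaves of a null hypersurface\<close>

context rigged_null_hypersurface
begin

sublocale F: closed_form_manifold B \<omega>
proof
  show "\<omega> p (u + v) = \<omega> p u + \<omega> p v"
    if "u \<in> tangent_space B p" "v \<in> tangent_space B p" for p u v
    using that by (rule omega_add)
  show "\<omega> p (a *\<^sub>R u) = a * \<omega> p u" if "u \<in> tangent_space B p" for p u a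
    using that by (rule omega_scale)
  show "smooth_fun_near B p (\<lambda>q. \<omega> q (X q))" if "smooth_field_near B p X" for p X
    using that by (rule omega_smooth)
  show "\<omega> p (lie_bracket B X Y p) = X p (\<lambda>q. \<omega> q (Y q)) - Y p (\<lambda>q. \<omega> q (X q))"
    if "smooth_field_near B p X" "smooth_field_near B p Y" for p X Y
    using that by (rule omega_closed)
  show "\<exists>v\<in>tangent_space B p. \<omega> p v \<noteq> 0" for p
    using xi_tangent[of p] by (intro bexI[of _ "\<xi> p"]) simp_all
  show "lie_bracket B X Y p \<in> tangent_space B p"
    if "smooth_field_near B p X" "smooth_field_near B p Y" for p X Y
    using L.lie_bracket_tangent[OF levi_civita' that] .
qed

section \<open>Splitting tangent vectors into screen and rigged parts\<close>

lemma xi_nonzero: "\<xi> p \<noteq> 0"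
  using omega_xi[of p] omega_zero[of p] by (metis zero_neq_one)

lemma screen_eq_kernel: "screen B A g i \<zeta> = F.kernel"
  by (simp add: screen_def rigged_form_def fun_eq_iff)

lemma screen_decomposition:
  assumes u: "u \<in> tangent_space B p"
  shows "u - \<omega> p u *\<^sub>R \<xi> p \<in> F.kernel p"
  using u xi_tangent[of p]
  by (simp add: L.tangent_space_diff L.tangent_space_scale omega_diff omega_scale)

lemma h_screen: "u \<in> F.kernel p \<Longrightarrow> v \<in> tangent_space B p \<Longrightarrow> h p u v = gL p u v"
  by (simp add: h_eq)

text \<open>\<xi> lies in the radical of both \<open>sff\<close> and \<open>gL\<close>, so only the
  screen parts of \<open>u\<close> and \<open>v\<close> contribute, and on the screen
  \<open>gL\<close> is \<open>h\<close>. What the leaves tell about screen vectors thus extends to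
  all tangent vectors.\<close>

lemma sff_screen:
  assumes u: "u \<in> tangent_space B p" and v: "v \<in> tangent_space B p"
  shows "sff p u v = sff p (u - \<omega> p u *\<^sub>R \<xi> p) (v - \<omega> p v *\<^sub>R \<xi> p)"
    and "gL p u v = h p (u - \<omega> p u *\<^sub>R \<xi> p) (v - \<omega> p v *\<^sub>R \<xi> p)"
proof -
  define u' v' where u': "u' = u - \<omega> p u *\<^sub>R \<xi> p" and v': "v' = v - \<omega> p v *\<^sub>R \<xi> p"
  have t: "u' \<in> tangent_space B p" "v' \<in> tangent_space B p" and k: "u' \<in> F.kernel p"
    using screen_decomposition u v unfolding u' v' by blast+
  note x = xi_tangent[of p] L.tangent_space_scale[OF xi_tangent[of p]]
  have drop: "sff p w (w' + a *\<^sub>R \<xi> p) = sff p w w'"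
    if "w \<in> tangent_space B p" "w' \<in> tangent_space B p" for w w' a
    using that by (simp add: sff_add_right[OF _ _ x(2)] sff_scale_right[OF _ x(1)] sff_xi_right)
  have u_eq: "u = u' + \<omega> p u *\<^sub>R \<xi> p" and v_eq: "v = v' + \<omega> p v *\<^sub>R \<xi> p" by (simp_all add: u' v')
  have "sff p u v = sff p u v'" using drop[OF u t(2)] v_eq by metis
  also have "\<dots> = sff p v' u'" using drop[OF t(2) t(1)] u_eq sff_sym[OF u t(2)] by metis
  also have "\<dots> = sff p u' v'" by (rule sff_sym[OF t(2,1)])
  finally show "sff p u v = sff p (u - \<omega> p u *\<^sub>R \<xi> p) (v - \<omega> p v *\<^sub>R \<xi> p)" by (simp add: u' v')
  have dropg: "gL p (w' + a *\<^sub>R \<xi> p) w = gL p w' w"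
    if "w \<in> tangent_space B p" "w' \<in> tangent_space B p" for w w' a
    using that by (simp add: gL_add_left[OF _ x(2)] gL_scale_left[OF x(1)] gL_xi)
  have "gL p u v = gL p u' v" using dropg[OF v t(1)] u_eq by metis
  also have "\<dots> = gL p v' u'" using dropg[OF t(1,2)] v_eq gL_sym[OF t(1) v] by metis
  also have "\<dots> = h p u' v'" using gL_sym[OF t] h_screen[OF k t(2)] by simp
  finally show "gL p u v = h p (u - \<omega> p u *\<^sub>R \<xi> p) (v - \<omega> p v *\<^sub>R \<xi> p)" by (simp add: u' v')
qed

lemma screen_field:
  assumes X: "smooth_field_near B p X"
  shows "smooth_field_near B p (\<lambda>q. X q - \<omega> q (X q) *\<^sub>R \<xi> q)"
    and "\<forall>\<^sub>F q in nhds p. X q - \<omega> q (X q) *\<^sub>R \<xi> q \<in> F.kernel q"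
proof -
  have "smooth_field_near B p (\<lambda>q. X q + (- \<omega> q (X q)) *\<^sub>R \<xi> q)"
    by (intro L.smooth_field_near_add X L.smooth_field_near_scale L.smooth_fun_near_uminus omega_smooth xi_near)
  then show "smooth_field_near B p (\<lambda>q. X q - \<omega> q (X q) *\<^sub>R \<xi> q)" by simp
  show "\<forall>\<^sub>F q in nhds p. X q - \<omega> q (X q) *\<^sub>R \<xi> q \<in> F.kernel q"
    using L.smooth_field_near_tangent[OF X] by eventually_elim (rule screen_decomposition)
qed

section \<open>Extrinsic geometry of a single integral manifold of the screen\<close>

context
  fixes N :: "'l topology"
  assumes N: "connected_integral_manifold B F.kernel N"
begin

lemma sub_tangent_eq: "q \<in> topspace N \<Longrightarrow> sub_tangent B N q = F.kernel q"
  using N by (simp add: connected_integral_manifold_def)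

text \<open>Subtracting \<open>\<omega> q n *\<^sub>R \<xi> q\<close> from a normal vector
  \<open>n\<close> leaves a vector orthogonal to the screen and to \<xi>, hence to everything;
  nondegeneracy of \<open>h\<close> makes it zero.\<close>

lemma normal_to_eq:
  assumes q: "q \<in> topspace N" shows "normal_to B h N q = range (\<lambda>a. a *\<^sub>R \<xi> q)"
proof
  show "range (\<lambda>a. a *\<^sub>R \<xi> q) \<subseteq> normal_to B h N q"
    using xi_tangent[of q] by (auto simp: normal_to_def sub_tangent_eq[OF q] L.tangent_space_scale
        L.tensor_scale_left[OF h_tensor] h_xi)
  show "normal_to B h N q \<subseteq> range (\<lambda>a. a *\<^sub>R \<xi> q)"
  proof
    fix n assume "n \<in> normal_to B h N q"
    then have n: "n \<in> tangent_space B q" "\<And>u. u \<in> F.kernel q \<Longrightarrow> h q n u = 0"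
      by (auto simp: normal_to_def sub_tangent_eq[OF q])
    let ?m = "n - \<omega> q n *\<^sub>R \<xi> q"
    have m: "?m \<in> tangent_space B q" "\<omega> q ?m = 0" using screen_decomposition[OF n(1)] by auto
    have "h q ?m v = 0" if v: "v \<in> tangent_space B q" for v
    proof -
      let ?v = "v - \<omega> q v *\<^sub>R \<xi> q"
      have k: "?v \<in> F.kernel q" by (rule screen_decomposition[OF v])
      have "h q ?m (?v + \<omega> q v *\<^sub>R \<xi> q) = h q ?m ?v + \<omega> q v * h q ?m (\<xi> q)"
        using k m(1) xi_tangent[of q]
        by (simp only: L.tensor_add_right[OF h_tensor] L.tensor_scale_right[OF h_tensor]
            L.tangent_space_scale mem_Collect_eq)
      moreover have "h q ?m (\<xi> q) = 0"
        using h_xi[OF m(1)] m(2) L.tensor_sym[OF h_tensor m(1) xi_tangent] by simp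
      moreover have "h q ?m ?v = h q n ?v - \<omega> q n * h q (\<xi> q) ?v"
        using k n(1) xi_tangent[of q]
        by (simp only: L.tensor_diff_left[OF h_tensor] L.tensor_scale_left[OF h_tensor]
            L.tangent_space_scale mem_Collect_eq)
      moreover have "h q n ?v - \<omega> q n * h q (\<xi> q) ?v = 0" using n(2)[OF k] h_xi k by simp
      ultimately show ?thesis by simp
    qed
    then have "?m = 0" by (rule h_nondegenerate[OF m(1)])
    then have "n = \<omega> q n *\<^sub>R \<xi> q" by simp
    then show "n \<in> range (\<lambda>a. a *\<^sub>R \<xi> q)" by blast
  qed
qed

text \<open>Uniqueness in the definite description: \<omega> kills the tangent part and reads off
  the coefficient of \<xi>.\<close>

lemma normal_part_eq:
  assumes q: "q \<in> topspace N" and w: "w \<in> tangent_space B q"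
  shows "normal_part B h N q w = \<omega> q w *\<^sub>R \<xi> q"
  unfolding normal_part_def
proof (rule the_equality)
  show "\<omega> q w *\<^sub>R \<xi> q \<in> normal_to B h N q \<and> w - \<omega> q w *\<^sub>R \<xi> q \<in> sub_tangent B N q"
    unfolding normal_to_eq[OF q] sub_tangent_eq[OF q] using screen_decomposition[OF w] by blast
  fix n assume n: "n \<in> normal_to B h N q \<and> w - n \<in> sub_tangent B N q"
  then obtain a where a: "n = a *\<^sub>R \<xi> q" by (auto simp: normal_to_eq[OF q])
  have "\<omega> q (w - n) = 0" using n by (simp add: sub_tangent_eq[OF q])
  then have "\<omega> q w = a"
    unfolding a using omega_diff[OF w L.tangent_space_scale[OF xi_tangent]] omega_scale[OF xi_tangent] by simp
  then show "n = \<omega> q w *\<^sub>R \<xi> q" using a by simp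
qed

text \<open>Differentiating \<open>h(\<xi>, V) = 0\<close> along the leaf moves the derivative from \<open>V\<close> to \<open>\<xi>\<close>.\<close>

lemma second_ff_eq:
  assumes q: "q \<in> topspace N" and u: "u \<in> sub_tangent B N q" and V: "tangent_field_near B N q V"
  shows "second_ff B h D' N q u V = sff q u (V q) *\<^sub>R \<xi> q"
proof -
  obtain S where S: "openin N S" "q \<in> S" "\<And>x. x \<in> S \<Longrightarrow> V x \<in> sub_tangent B N x" and Vn: "smooth_field_near B q V"
    using V unfolding tangent_field_near_def by blast
  have ut: "u \<in> tangent_space B q" using u by (simp add: sub_tangent_def)
  note Vt = L.smooth_field_near_tangent_at[OF Vn] L.levi_civita_tangent[OF levi_civita' ut Vn]
  have "h x (\<xi> x) (V x) = 0" if "x \<in> S" for x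
  proof -
    have "x \<in> topspace N" using S(1) that openin_subset by blast
    then have "V x \<in> F.kernel x" using S(3)[OF that] sub_tangent_eq by simp
    then show ?thesis by (simp add: h_xi)
  qed
  then have "u (\<lambda>x. h x (\<xi> x) (V x)) = 0"
    using L.vanish_on_immersed_hypersurface[OF _ q u S(1,2)] N
    by (simp add: connected_integral_manifold_def)
  then have "\<omega> q (D' q u V) = sff q u (V q)"
    using L.levi_civita_metric[OF levi_civita' ut xi_near Vn] sff_eq[OF ut Vt(1)] h_xi[OF Vt(2)] by simp
  then show ?thesis
    unfolding second_ff_def normal_part_eq[OF q Vt(2)] by simp
qed

text \<open>\<open>second_ff\<close> differentiates fields while \<open>sff\<close> is evaluated on
  vectors, so passing from one to the other requires a screen field with prescribed value.
  Projecting an arbitrary extension along \<xi> keeps the value at \<open>q\<close>, which already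
  lies in the screen.\<close>

lemma ex_tangent_field:
  assumes q: "q \<in> topspace N" and v: "v \<in> F.kernel q"
  obtains V where "tangent_field_near B N q V" "V q = v"
proof -
  obtain X where X: "smooth_field_near B q X" "X q = v" using L.ex_smooth_field_near v by blast
  let ?V = "\<lambda>x. X x - \<omega> x (X x) *\<^sub>R \<xi> x"
  obtain T where T: "open T" "q \<in> T" "\<And>x. x \<in> T \<Longrightarrow> ?V x \<in> F.kernel x"
    using screen_field(2)[OF X(1)] unfolding eventually_nhds by blast
  obtain P c b where s: "slice B N P c b" "q \<in> P"
    using N q unfolding connected_integral_manifold_def immersed_hypersurface_def by blast
  have "openin (top_of_set P) (P \<inter> T)" using T(1) by (auto simp: openin_open)
  then have o: "openin N (P \<inter> T)" using s(1) openin_trans_full unfolding slice_def by metis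
  have "?V x \<in> sub_tangent B N x" if "x \<in> P \<inter> T" for x
  proof -
    have "x \<in> topspace N" using o that openin_subset by blast
    then show ?thesis using T(3)[of x] that sub_tangent_eq by simp
  qed
  then have "tangent_field_near B N q ?V"
    unfolding tangent_field_near_def using screen_field(1)[OF X(1)] o s(2) T(2)
    by (intro conjI exI[of _ "P \<inter> T"]) auto
  then show ?thesis using that[of ?V] X(2) v by simp
qed

lemma totally_geodesic_iff:
  "totally_geodesic B h D' N \<longleftrightarrow> (\<forall>q\<in>topspace N. \<forall>u\<in>F.kernel q. \<forall>v\<in>F.kernel q. sff q u v = 0)"
proof
  assume tg: "totally_geodesic B h D' N"
  show "\<forall>q\<in>topspace N. \<forall>u\<in>F.kernel q. \<forall>v\<in>F.kernel q. sff q u v = 0"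
  proof (intro ballI)
    fix q u v assume q: "q \<in> topspace N" and u: "u \<in> F.kernel q" and v: "v \<in> F.kernel q"
    obtain V where V: "tangent_field_near B N q V" "V q = v" using ex_tangent_field[OF q v] .
    have "u \<in> sub_tangent B N q" using u sub_tangent_eq[OF q] by simp
    then have "sff q u v *\<^sub>R \<xi> q = 0"
      using tg second_ff_eq[OF q _ V(1)] q V unfolding totally_geodesic_def by metis
    then show "sff q u v = 0" by (simp add: xi_nonzero)
  qed
next
  assume z: "\<forall>q\<in>topspace N. \<forall>u\<in>F.kernel q. \<forall>v\<in>F.kernel q. sff q u v = 0"
  show "totally_geodesic B h D' N"
    unfolding totally_geodesic_def
  proof (intro ballI allI impI)
    fix q u V assume q: "q \<in> topspace N" and u: "u \<in> sub_tangent B N q" and V: "tangent_field_near B N q V"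
    have "V q \<in> sub_tangent B N q" using V by (auto simp: tangent_field_near_def)
    then show "second_ff B h D' N q u V = 0"
      using z q u unfolding second_ff_eq[OF q u V] sub_tangent_eq[OF q] by simp
  qed
qed

text \<open>\<open>H q\<close> is normal, so it is a multiple of \<xi>. Only the number at
  \<open>q\<close> is extracted, since smoothness of \<open>H\<close> along one leaf says nothing
  about neighbouring leaves.\<close>

lemma totally_umbilic_imp:
  assumes tu: "totally_umbilic B h D' N" and q: "q \<in> topspace N"
  obtains a where "\<And>u v. u \<in> F.kernel q \<Longrightarrow> v \<in> F.kernel q \<Longrightarrow> sff q u v = a * h q u v"
proof -
  obtain H where H: "smooth_normal_field B h N H"
    and II: "\<And>u V. u \<in> sub_tangent B N q \<Longrightarrow> tangent_field_near B N q V \<Longrightarrow>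
      second_ff B h D' N q u V = h q u (V q) *\<^sub>R H q"
    using tu q unfolding totally_umbilic_def by blast
  have "H q \<in> normal_to B h N q" using H q by (simp add: smooth_normal_field_def)
  then obtain a where a: "H q = a *\<^sub>R \<xi> q" by (auto simp: normal_to_eq[OF q])
  have "sff q u v = a * h q u v" if u: "u \<in> F.kernel q" and v: "v \<in> F.kernel q" for u v
  proof -
    obtain V where V: "tangent_field_near B N q V" "V q = v" using ex_tangent_field[OF q v] .
    have u': "u \<in> sub_tangent B N q" using u sub_tangent_eq[OF q] by simp
    have "sff q u v *\<^sub>R \<xi> q = (a * h q u v) *\<^sub>R \<xi> q"
      using second_ff_eq[OF q u' V(1)] II[OF u' V(1)] V(2) a xi_nonzero[of q] by (simp add: mult.commute)
    then show ?thesis by (simp add: xi_nonzero)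
  qed
  then show ?thesis using that by blast
qed

lemma totally_umbilicI:
  assumes \<rho>: "\<And>p. smooth_fun_near B p \<rho>"
    and z: "\<And>q u v. u \<in> F.kernel q \<Longrightarrow> v \<in> F.kernel q \<Longrightarrow> sff q u v = \<rho> q * h q u v"
  shows "totally_umbilic B h D' N"
  unfolding totally_umbilic_def
proof (intro exI[of _ "\<lambda>q. \<rho> q *\<^sub>R \<xi> q"] conjI ballI allI impI)
  show "smooth_normal_field B h N (\<lambda>q. \<rho> q *\<^sub>R \<xi> q)"
    unfolding smooth_normal_field_def
  proof (intro ballI conjI)
    fix q assume q: "q \<in> topspace N"
    show "\<rho> q *\<^sub>R \<xi> q \<in> normal_to B h N q" unfolding normal_to_eq[OF q] by blast
    show "\<exists>X W. smooth_field_near B q X \<and> openin N W \<and> q \<in> W \<and> (\<forall>x\<in>W. \<rho> x *\<^sub>R \<xi> x = X x)"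
      using q L.smooth_field_near_scale[OF \<rho> xi_near]
      by (intro exI[of _ "\<lambda>q. \<rho> q *\<^sub>R \<xi> q"] exI[of _ "topspace N"]) simp
  qed
  fix q u V assume q: "q \<in> topspace N" and u: "u \<in> sub_tangent B N q" and V: "tangent_field_near B N q V"
  have "V q \<in> sub_tangent B N q" using V by (auto simp: tangent_field_near_def)
  then show "second_ff B h D' N q u V = h q u (V q) *\<^sub>R \<rho> q *\<^sub>R \<xi> q"
    using z[of u q "V q"] u unfolding second_ff_eq[OF q u V] sub_tangent_eq[OF q]
    by (simp add: mult.commute)
qed

end

section \<open>From all leaves to the null hypersurface\<close>

lemma leaf_integral:
  "is_leaf B (screen B A g i \<zeta>) N \<Longrightarrow> connected_integral_manifold B F.kernel N"
  by (simp add: is_leaf_def screen_eq_kernel)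

lemma leaf_exists: "is_leaf B (screen B A g i \<zeta>) (F.leaf p)" "p \<in> topspace (F.leaf p)"
  using F.leaf_is_leaf F.mem_leaf by (simp_all add: screen_eq_kernel)

text \<open>For the converse, a leaf runs through every point, so \<open>sff\<close> vanishes on all
  screen vectors, and \<open>sff_screen\<close> carries this over to all tangent vectors.\<close>

lemma totally_geodesic_iff_leaves:
  "null_totally_geodesic B A g D i \<xi> \<longleftrightarrow>
     (\<forall>N. is_leaf B (screen B A g i \<zeta>) N \<longrightarrow> totally_geodesic B h D' N)"
proof
  assume "null_totally_geodesic B A g D i \<xi>"
  then show "\<forall>N. is_leaf B (screen B A g i \<zeta>) N \<longrightarrow> totally_geodesic B h D' N"
    using totally_geodesic_iff leaf_integral by (auto simp: null_totally_geodesic_def)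
next
  assume leaves: "\<forall>N. is_leaf B (screen B A g i \<zeta>) N \<longrightarrow> totally_geodesic B h D' N"
  have z: "sff p u v = 0" if "u \<in> F.kernel p" "v \<in> F.kernel p" for p u v
    using leaves leaf_exists totally_geodesic_iff[OF leaf_integral[OF leaf_exists(1)]] that by blast
  show "null_totally_geodesic B A g D i \<xi>"
    unfolding null_totally_geodesic_def
    using sff_screen(1) z[OF screen_decomposition screen_decomposition] by simp
qed

lemma sff_smooth:
  assumes X: "smooth_field_near B p X" and Y: "smooth_field_near B p Y"
  shows "smooth_fun_near B p (\<lambda>q. sff q (X q) (Y q))"
proof -
  have "smooth_fun_near B p (\<lambda>q. - h q (D' q (X q) \<xi>) (Y q))"
    by (intro L.smooth_fun_near_uminus L.tensor_smooth[OF h_tensor] L.levi_civita_smooth[OF levi_civita'] X Y xi_near)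
  then show ?thesis
  proof (rule L.smooth_fun_near_cong[rotated])
    show "\<forall>\<^sub>F q in nhds p. - h q (D' q (X q) \<xi>) (Y q) = sff q (X q) (Y q)"
      using L.smooth_field_near_tangent[OF X] L.smooth_field_near_tangent[OF Y]
      by eventually_elim (simp add: sff_eq)
  qed
qed

text \<open>Where the screen is nonzero, the umbilicity factor is a quotient of smooth functions
  \<open>B(E,E) / g(E,E)\<close> for a local screen field \<open>E\<close> that is not null at the given point, which exists by
  polarization.\<close>

lemma umbilic_factor_smooth:
  assumes \<rho>: "\<And>q u v. u \<in> F.kernel q \<Longrightarrow> v \<in> F.kernel q \<Longrightarrow> sff q u v = \<rho> q * h q u v"
    and s: "s \<in> F.kernel p" "s \<noteq> 0"
  shows "smooth_fun_near B p \<rho>"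
proof -
  have "\<exists>e\<in>F.kernel p. h p e e \<noteq> 0"
  proof (rule ccontr)
    assume "\<not> ?thesis"
    then have null: "h p e e = 0" if "e \<in> F.kernel p" for e using that by blast
    have "h p s v = 0" if v: "v \<in> tangent_space B p" for v
    proof -
      let ?v = "v - \<omega> p v *\<^sub>R \<xi> p"
      have k: "?v \<in> F.kernel p" by (rule screen_decomposition[OF v])
      have t: "s \<in> tangent_space B p" "?v \<in> tangent_space B p" using s(1) k by auto
      have "s + ?v \<in> F.kernel p" using s(1) k by (simp add: L.tangent_space_add omega_add)
      from null[OF this] have "h p s ?v = 0"
        using null[OF s(1)] null[OF k] L.tensor_sym[OF h_tensor t]
          L.tensor_add_left[OF h_tensor t L.tangent_space_add[OF t]]
          L.tensor_add_right[OF h_tensor t t(1)] L.tensor_add_right[OF h_tensor t t(2)]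
        by simp
      moreover have "h p s (?v + \<omega> p v *\<^sub>R \<xi> p) = h p s ?v + \<omega> p v * h p s (\<xi> p)"
        using t xi_tangent[of p]
        by (simp only: L.tensor_add_right[OF h_tensor] L.tensor_scale_right[OF h_tensor] L.tangent_space_scale)
      moreover have "h p s (\<xi> p) = 0"
        using h_xi[OF t(1)] s(1) L.tensor_sym[OF h_tensor t(1) xi_tangent] by simp
      ultimately show ?thesis by simp
    qed
    then show False using h_nondegenerate[of s p] s by blast
  qed
  then obtain e where e: "e \<in> F.kernel p" "h p e e \<noteq> 0" by blast
  obtain X where X: "smooth_field_near B p X" "X p = e" using L.ex_smooth_field_near e(1) by blast
  define E where "E = (\<lambda>x. X x - \<omega> x (X x) *\<^sub>R \<xi> x)"
  have E: "smooth_field_near B p E" "\<forall>\<^sub>F q in nhds p. E q \<in> F.kernel q" "E p = e"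
    using screen_field[OF X(1)] X(2) e(1) by (simp_all add: E_def)
  have hE: "smooth_fun_near B p (\<lambda>q. h q (E q) (E q))" by (rule L.tensor_smooth[OF h_tensor E(1) E(1)])
  have "smooth_fun_near B p (\<lambda>q. sff q (E q) (E q) * inverse (h q (E q) (E q)))"
    by (intro L.smooth_fun_near_mult sff_smooth E L.smooth_fun_near_inverse hE) (simp add: E e)
  moreover have "\<forall>\<^sub>F q in nhds p. h q (E q) (E q) \<in> - {0}"
    by (rule topological_tendstoD[OF L.smooth_fun_near_imp_isCont[OF hE]]) (simp_all add: E e open_Compl)
  then have "\<forall>\<^sub>F q in nhds p. sff q (E q) (E q) * inverse (h q (E q) (E q)) = \<rho> q"
    using E(2) by eventually_elim (simp add: \<rho>)
  ultimately show ?thesis by (rule L.smooth_fun_near_cong[rotated])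
qed

lemma totally_umbilic_iff_leaves:
  "null_totally_umbilic B A g D i \<xi> \<longleftrightarrow>
     (\<forall>N. is_leaf B (screen B A g i \<zeta>) N \<longrightarrow> totally_umbilic B h D' N)"
proof
  assume "null_totally_umbilic B A g D i \<xi>"
  then obtain \<rho> where \<rho>: "smooth_fun B UNIV \<rho>"
    and z: "\<And>p u v. u \<in> tangent_space B p \<Longrightarrow> v \<in> tangent_space B p \<Longrightarrow> sff p u v = \<rho> p * gL p u v"
    unfolding null_totally_umbilic_def gL_def by blast
  show "\<forall>N. is_leaf B (screen B A g i \<zeta>) N \<longrightarrow> totally_umbilic B h D' N"
  proof (intro allI impI)
    fix N assume N: "is_leaf B (screen B A g i \<zeta>) N"
    show "totally_umbilic B h D' N"
    proof (rule totally_umbilicI[OF leaf_integral[OF N]])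
      show "smooth_fun_near B p \<rho>" for p by (rule L.smooth_fun_imp_near[OF \<rho> UNIV_I])
      fix q u v assume u: "u \<in> F.kernel q" and v: "v \<in> F.kernel q"
      then show "sff q u v = \<rho> q * h q u v" using z[of u q v] h_screen[OF u, of v] by simp
    qed
  qed
next
  assume leaves: "\<forall>N. is_leaf B (screen B A g i \<zeta>) N \<longrightarrow> totally_umbilic B h D' N"
  have ex: "\<exists>a. \<forall>u\<in>F.kernel p. \<forall>v\<in>F.kernel p. sff p u v = a * h p u v" for p
  proof -
    have tu: "totally_umbilic B h D' (F.leaf p)" using leaves leaf_exists(1) by blast
    show ?thesis
      by (rule totally_umbilic_imp[OF leaf_integral[OF leaf_exists(1)] tu leaf_exists(2)]) blast
  qed
  \<comment> \<open>Each point takes a factor from the leaf through it, chosen independently of all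
    other points, so nothing is known yet about smoothness.\<close>
  define \<rho> where "\<rho> = (\<lambda>p. SOME a. \<forall>u\<in>F.kernel p. \<forall>v\<in>F.kernel p. sff p u v = a * h p u v)"
  have \<rho>: "sff p u v = \<rho> p * h p u v" if "u \<in> F.kernel p" "v \<in> F.kernel p" for p u v
  proof -
    have "\<forall>u\<in>F.kernel p. \<forall>v\<in>F.kernel p. sff p u v = \<rho> p * h p u v"
      unfolding \<rho>_def by (rule someI_ex[OF ex])
    from bspec[OF bspec[OF this that(1)] that(2)] show ?thesis .
  qed
  have all: "sff p u v = a * gL p u v"
    if "\<And>u v. u \<in> F.kernel p \<Longrightarrow> v \<in> F.kernel p \<Longrightarrow> sff p u v = a * h p u v"
      "u \<in> tangent_space B p" "v \<in> tangent_space B p" for p u v a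
    by (subst sff_screen(1)[OF that(2,3)], subst sff_screen(2)[OF that(2,3)])
       (rule that(1)[OF screen_decomposition[OF that(2)] screen_decomposition[OF that(3)]])
  have "\<exists>\<sigma>. (\<forall>p. smooth_fun_near B p \<sigma>) \<and>
      (\<forall>p. \<forall>u\<in>F.kernel p. \<forall>v\<in>F.kernel p. sff p u v = \<sigma> p * h p u v)"
  proof (cases "DIM('f) = 1")
    \<comment> \<open>If \<open>L\<close> is a curve, the screen is zero and the leaves are points.
      Every number then qualifies as a factor and \<open>\<rho>\<close> may be wild, so the constant
      0 is taken instead.\<close>
    case True
    have k0: "u = 0" if u: "u \<in> F.kernel p" for u p
    proof (rule ccontr)
      assume "u \<noteq> 0"
      obtain c where c: "c \<in> B" "p \<in> fst c" using L.ex_chart by blast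
      obtain x y where x: "u = chart_vec B c p x" and y: "\<xi> p = chart_vec B c p y"
        using u xi_tangent[of p] L.tangent_space_eq_range[OF c] by auto
      have "x \<noteq> 0" using \<open>u \<noteq> 0\<close> x linear_0[OF L.linear_chart_vec[OF c]] by auto
      obtain b where b: "(Basis :: 'f set) = {b}" using True by (auto simp: card_1_singleton_iff)
      have rep: "z = (z \<bullet> b) *\<^sub>R b" for z :: 'f using euclidean_representation[of z] unfolding b by simp
      then have "x \<bullet> b \<noteq> 0" using \<open>x \<noteq> 0\<close> by (metis scaleR_zero_left)
      then have "y = ((y \<bullet> b) / (x \<bullet> b)) *\<^sub>R x" using rep[of x] rep[of y]
        by (metis nonzero_mult_div_cancel_right scaleR_scaleR times_divide_eq_left)
      then have "\<xi> p = ((y \<bullet> b) / (x \<bullet> b)) *\<^sub>R u"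
        using x y linear_scale[OF L.linear_chart_vec[OF c]] by metis
      then have "\<omega> p (\<xi> p) = 0" using u by (simp add: omega_scale)
      then show False by simp
    qed
    have "\<forall>p. \<forall>u\<in>F.kernel p. \<forall>v\<in>F.kernel p. sff p u v = 0 * h p u v"
    proof (intro allI ballI)
      fix p u v assume u: "u \<in> F.kernel p" and v: "v \<in> F.kernel p"
      have "v = 0" by (rule k0[OF v])
      then show "sff p u v = 0 * h p u v"
        using u v sff_eq[of u p v] L.tensor_zero_right[OF h_tensor nabla_xi_tangent[of u p]] by simp
    qed
    then show ?thesis using L.smooth_fun_near_const by (intro exI[of _ "\<lambda>p. 0"]) simp
  next
    \<comment> \<open>A zero screen would make every tangent vector a multiple of \<xi> and force
      dimension 1. So the screen is nonzero at every point, \<open>\<rho>\<close> is uniquely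
      determined, and \<open>umbilic_factor_smooth\<close> applies.\<close>
    case False
    have "\<exists>s\<in>F.kernel p. s \<noteq> 0" for p
    proof (rule ccontr)
      assume "\<not> ?thesis"
      then have k0: "u = 0" if "u \<in> F.kernel p" for u using that by blast
      obtain c where c: "c \<in> B" "p \<in> fst c" using L.ex_chart by blast
      obtain y where y: "\<xi> p = chart_vec B c p y"
        using xi_tangent[of p] L.tangent_space_eq_range[OF c] by auto
      have "x \<in> span {y}" for x
      proof -
        let ?u = "chart_vec B c p x"
        have "?u = \<omega> p ?u *\<^sub>R \<xi> p"
          using k0[OF screen_decomposition[OF L.chart_vec_in_tangent_space[OF c, of x]]] by simp
        then have "chart_vec B c p x = chart_vec B c p (\<omega> p ?u *\<^sub>R y)"
          using y linear_scale[OF L.linear_chart_vec[OF c]] by metis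
        then have "x = \<omega> p ?u *\<^sub>R y" using L.inj_chart_vec[OF c] by (metis injD)
        then show ?thesis by (metis span_base span_scale singletonI)
      qed
      then have "dim {y} = DIM('f)" using dim_eq_full by blast
      moreover have "dim {y} \<le> 1" using dim_le_card'[of "{y}"] by simp
      moreover have "DIM('f) > 0" by simp
      ultimately show False using False by linarith
    qed
    then have "smooth_fun_near B p \<rho>" for p using umbilic_factor_smooth[OF \<rho>] by blast
    then show ?thesis using \<rho> by blast
  qed
  then obtain \<sigma> where \<sigma>: "\<And>p. smooth_fun_near B p \<sigma>"
    "\<And>p u v. u \<in> F.kernel p \<Longrightarrow> v \<in> F.kernel p \<Longrightarrow> sff p u v = \<sigma> p * h p u v" by blast
  have "smooth_fun B UNIV \<sigma>" by (rule L.smooth_fun_localI[OF open_UNIV \<sigma>(1)])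
  then show "null_totally_umbilic B A g D i \<xi>"
    unfolding null_totally_umbilic_def using all[OF \<sigma>(2)]
    by (intro exI[of _ \<sigma>]) (simp add: gL_def)
qed

end

theorem corollary15:
  fixes A :: "('m::{t2_space, second_countable_topology}, 'e::euclidean_space) chart set"
    and B :: "('l::{t2_space, second_countable_topology}, 'f::euclidean_space) chart set"
    and g :: "'m tensor2" and D :: "'m connection"
    and i :: "'l \<Rightarrow> 'm" and W :: "'m set" and \<zeta> :: "'m field"
    and \<xi> :: "'l field" and D' :: "'l connection"
  assumes "smooth_structure A" and "lorentzian_metric A g" and "time_orientable A g"
    and "levi_civita A g D"
    and "smooth_structure B" and "null_hypersurface B A g i"
    and "closed_rigging B A g i W \<zeta>"
    and "rigged_field B A g i \<zeta> \<xi>"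
    and "levi_civita B (rigged_metric A g i \<zeta>) D'"
  shows "(null_totally_geodesic B A g D i \<xi> \<longleftrightarrow> parallel_field B D' \<xi>) \<and>
    (null_totally_geodesic B A g D i \<xi> \<longleftrightarrow>
       (\<forall>N. is_leaf B (screen B A g i \<zeta>) N \<longrightarrow>
          totally_geodesic B (rigged_metric A g i \<zeta>) D' N)) \<and>
    (null_totally_umbilic B A g D i \<xi> \<longleftrightarrow>
       (\<forall>N. is_leaf B (screen B A g i \<zeta>) N \<longrightarrow>
          totally_umbilic B (rigged_metric A g i \<zeta>) D' N))"
proof -
  interpret rigged_null_hypersurface A B i g D W \<zeta> \<xi> D'
    using assms by unfold_locales (simp_all add: null_hypersurface_def)
  show ?thesis
    using totally_geodesic_iff_parallel totally_geodesic_iff_leaves totally_umbilic_iff_leaves by blast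
qed

end
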